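(* Let $\{C_n\}_{n\ge 0}$ be a precyclic object with the last degeneracy in an abelian category $\mathcal{A}$. Write $H_n = H_n(C_\bullet)$ for its homology and $HC_n=HC_n(C_\bullet)$ for its cyclic homology (with $HC_m=0$ and $H_m=0$ for $m<0$). Then there is a natural long exact sequence $$\cdots \overset{B}{\to} H_n \overset{I}{\to} HC_n \overset{S}{\to} HC_{n-2}\overset{B}{\to} H_{n-1}\overset{I}{\to}\cdots .$$
   Context: A precyclic object with the last degeneracy in $\mathcal{A}$ consists of objects $C_n$ ($n\ge 0$) with morphisms $d_i:C_n\to C_{n-1}$ ($0\le i\le n$, $n\ge1$), $T_n:C_n\to C_n$ and $s_n:C_n\to C_{n+1}$ such that: $d_id_j=d_{j-1}d_i$ for $i<j$; $T_n^{n+1}=\mathrm{id}$, $d_0T_n=d_n$, $d_iT_n=T_{n-1}d_{i-1}$ for $1\le i\le n$; and $d_is_n=s_{n-1}d_i$ for $0\le i\le n-1$, $d_ns_n=d_{n+1}s_n=\mathrm{id}$. Put $t=t_n=(-1)^nT_n$, $N=N_n=1+t+\cdots+t^n:C_n\to C_n$, $\partial=\sum_{i=0}^n(-1)^id_i$ and $\partial'=\sum_{i=0}^{n-1}(-1)^id_i$, both $C_n\to C_{n-1}$ (and zero on $C_0$). $H_n(C_\bullet)$ is the $n$-th homology of the complex $(C_\bullet,\partial)$. The cyclic bicomplex $CC(C_\bullet)$ is the first quadrant bicomplex with $CC_{p,m}=C_m$ ($p,m\ge0$); the vertical differential is $\partial$ in columns with $p$ even and $-\partial'$ in columns with $p$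 odd; the horizontal differential $CC_{p,m}\to CC_{p-1,m}$ is $1-t$ for $p$ odd and $N$ for $p\ge2$ even. The cyclic homology is $HC_n(C_\bullet)=H_n(\mathrm{Tot}(CC(C_\bullet)))$. *)

theory Defs
  imports "HOL-Algebra.FiniteProduct"
begin

section \<open>Abelian categories\<close>

text \<open>
  A category consists of a set of objects and a set of arrows; composition \<open>g \<cdot> f\<close> (first \<open>f\<close>,
  then \<open>g\<close>) is only meaningful when \<open>Cod f = Dom g\<close>.
\<close>

record ('o, 'm) category =
  Obj :: "'o set"
  Arr :: "'m set"
  Dom :: "'m \<Rightarrow> 'o"
  Cod :: "'m \<Rightarrow> 'o"
  Ident :: "'o \<Rightarrow> 'm"
  Comp :: "'m \<Rightarrow> 'm \<Rightarrow> 'm"  (infixr "\<cdot>\<index>" 70)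

definition Hom :: "('o, 'm, 'z) category_scheme \<Rightarrow> 'o \<Rightarrow> 'o \<Rightarrow> 'm set"
  where "Hom A X Y = {f \<in> Arr A. Dom A f = X \<and> Cod A f = Y}"

locale category =
  fixes A (structure)
  assumes Dom_in_Obj: "f \<in> Arr A \<Longrightarrow> Dom A f \<in> Obj A"
    and Cod_in_Obj: "f \<in> Arr A \<Longrightarrow> Cod A f \<in> Obj A"
    and Ident_in_Hom: "X \<in> Obj A \<Longrightarrow> Ident A X \<in> Hom A X X"
    and Comp_in_Hom: "\<lbrakk>f \<in> Hom A X Y; g \<in> Hom A Y Z\<rbrakk> \<Longrightarrow> g \<cdot> f \<in> Hom A X Z"
    and Comp_Ident: "f \<in> Hom A X Y \<Longrightarrow> f \<cdot> Ident A X = f"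
    and Ident_Comp: "f \<in> Hom A X Y \<Longrightarrow> Ident A Y \<cdot> f = f"
    and Comp_assoc: "\<lbrakk>f \<in> Hom A X Y; g \<in> Hom A Y Z; h \<in> Hom A Z W\<rbrakk>
      \<Longrightarrow> (h \<cdot> g) \<cdot> f = h \<cdot> (g \<cdot> f)"

record ('o, 'm) preadditive = "('o, 'm) category" +
  Zero :: "'o \<Rightarrow> 'o \<Rightarrow> 'm"
  Plus :: "'m \<Rightarrow> 'm \<Rightarrow> 'm"  (infixl "\<boxplus>\<index>" 65)

definition hom_group :: "('o, 'm, 'z) preadditive_scheme \<Rightarrow> 'o \<Rightarrow> 'o \<Rightarrow> 'm monoid"
  where "hom_group A X Y = \<lparr>carrier = Hom A X Y, monoid.mult = Plus A, one = Zero A X Y\<rparr>"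

locale preadditive_category = category +
  assumes hom_group_comm_group:
      "\<lbrakk>X \<in> Obj A; Y \<in> Obj A\<rbrakk> \<Longrightarrow> comm_group (hom_group A X Y)"
    and Comp_Plus: "\<lbrakk>f \<in> Hom A X Y; f' \<in> Hom A X Y; g \<in> Hom A Y Z\<rbrakk>
      \<Longrightarrow> g \<cdot> (f \<boxplus> f') = g \<cdot> f \<boxplus> g \<cdot> f'"
    and Plus_Comp: "\<lbrakk>f \<in> Hom A X Y; g \<in> Hom A Y Z; g' \<in> Hom A Y Z\<rbrakk>
      \<Longrightarrow> (g \<boxplus> g') \<cdot> f = g \<cdot> f \<boxplus> g' \<cdot> f"

definition arr_sum ::
    "('o, 'm, 'z) preadditive_scheme \<Rightarrow> 'o \<Rightarrow> 'o \<Rightarrow> ('i \<Rightarrow> 'm) \<Rightarrow> 'i set \<Rightarrow> 'm"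
  where "arr_sum A X Y f J = finprod (hom_group A X Y) f J"

definition arr_neg :: "('o, 'm, 'z) preadditive_scheme \<Rightarrow> 'm \<Rightarrow> 'm"
  where "arr_neg A f = m_inv (hom_group A (Dom A f) (Cod A f)) f"

definition is_zero_object :: "('o, 'm, 'z) preadditive_scheme \<Rightarrow> 'o \<Rightarrow> bool"
  where "is_zero_object A Z \<longleftrightarrow>
    Z \<in> Obj A \<and> (\<forall>X \<in> Obj A. (\<exists>!f. f \<in> Hom A X Z) \<and> (\<exists>!f. f \<in> Hom A Z X))"

text \<open>
  \<open>P\<close> is the direct sum (biproduct) of \<open>X 0, \<dots>, X (n - 1)\<close>, with injections \<open>\<iota> i\<close> and
  projections \<open>\<pi> i\<close>.
\<close>

definition is_direct_sum ::
    "('o, 'm, 'z) preadditive_scheme \<Rightarrow> nat \<Rightarrow> (nat \<Rightarrow> 'o) \<Rightarrow>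
      'o \<Rightarrow> (nat \<Rightarrow> 'm) \<Rightarrow> (nat \<Rightarrow> 'm) \<Rightarrow> bool"
  where "is_direct_sum A n X P \<iota> \<pi> \<longleftrightarrow>
    P \<in> Obj A \<and>
    (\<forall>i<n. \<iota> i \<in> Hom A (X i) P \<and> \<pi> i \<in> Hom A P (X i)) \<and>
    (\<forall>i<n. \<forall>j<n. \<pi> j \<cdot>\<^bsub>A\<^esub> \<iota> i = (if i = j then Ident A (X i) else Zero A (X i) (X j))) \<and>
    arr_sum A P P (\<lambda>i. \<iota> i \<cdot>\<^bsub>A\<^esub> \<pi> i) {..<n} = Ident A P"

definition is_mono :: "('o, 'm, 'z) category_scheme \<Rightarrow> 'm \<Rightarrow> bool"
  where "is_mono A f \<longleftrightarrow> f \<in> Arr A \<and>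
    (\<forall>W. \<forall>g \<in> Hom A W (Dom A f). \<forall>h \<in> Hom A W (Dom A f). f \<cdot>\<^bsub>A\<^esub> g = f \<cdot>\<^bsub>A\<^esub> h \<longrightarrow> g = h)"

definition is_epi :: "('o, 'm, 'z) category_scheme \<Rightarrow> 'm \<Rightarrow> bool"
  where "is_epi A f \<longleftrightarrow> f \<in> Arr A \<and>
    (\<forall>W. \<forall>g \<in> Hom A (Cod A f) W. \<forall>h \<in> Hom A (Cod A f) W. g \<cdot>\<^bsub>A\<^esub> f = h \<cdot>\<^bsub>A\<^esub> f \<longrightarrow> g = h)"

definition is_kernel :: "('o, 'm, 'z) preadditive_scheme \<Rightarrow> 'm \<Rightarrow> 'm \<Rightarrow> bool"
  where "is_kernel A k f \<longleftrightarrow>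
    k \<in> Arr A \<and> f \<in> Arr A \<and> Cod A k = Dom A f \<and>
    f \<cdot>\<^bsub>A\<^esub> k = Zero A (Dom A k) (Cod A f) \<and>
    (\<forall>W. \<forall>g \<in> Hom A W (Dom A f). f \<cdot>\<^bsub>A\<^esub> g = Zero A W (Cod A f) \<longrightarrow>
      (\<exists>!h. h \<in> Hom A W (Dom A k) \<and> k \<cdot>\<^bsub>A\<^esub> h = g))"

definition is_cokernel :: "('o, 'm, 'z) preadditive_scheme \<Rightarrow> 'm \<Rightarrow> 'm \<Rightarrow> bool"
  where "is_cokernel A q f \<longleftrightarrow>
    q \<in> Arr A \<and> f \<in> Arr A \<and> Dom A q = Cod A f \<and>
    q \<cdot>\<^bsub>A\<^esub> f = Zero A (Dom A f) (Cod A q) \<and>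
    (\<forall>W. \<forall>g \<in> Hom A (Cod A f) W. g \<cdot>\<^bsub>A\<^esub> f = Zero A (Dom A f) W \<longrightarrow>
      (\<exists>!h. h \<in> Hom A (Cod A q) W \<and> h \<cdot>\<^bsub>A\<^esub> q = g))"

locale abelian_category = preadditive_category +
  assumes ex_zero_object: "\<exists>Z. is_zero_object A Z"
    and ex_direct_sum: "(\<And>i. i < n \<Longrightarrow> X i \<in> Obj A) \<Longrightarrow> \<exists>P \<iota> \<pi>. is_direct_sum A n X P \<iota> \<pi>"
    and ex_kernel: "f \<in> Arr A \<Longrightarrow> \<exists>k. is_kernel A k f"
    and ex_cokernel: "f \<in> Arr A \<Longrightarrow> \<exists>q. is_cokernel A q f"
    and mono_is_kernel: "is_mono A f \<Longrightarrow> \<exists>g. is_kernel A f g"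
    and epi_is_cokernel: "is_epi A f \<Longrightarrow> \<exists>g. is_cokernel A f g"

text \<open>
  Zero object, direct sums, kernels and cokernels are determined only up to unique compatible
  isomorphism; the following constants fix a choice.
\<close>

definition zero_object :: "('o, 'm, 'z) preadditive_scheme \<Rightarrow> 'o"
  where "zero_object A = (SOME Z. is_zero_object A Z)"

definition direct_sum ::
    "('o, 'm, 'z) preadditive_scheme \<Rightarrow> nat \<Rightarrow> (nat \<Rightarrow> 'o) \<Rightarrow> 'o \<times> (nat \<Rightarrow> 'm) \<times> (nat \<Rightarrow> 'm)"
  where "direct_sum A n X = (SOME (P, \<iota>, \<pi>). is_direct_sum A n X P \<iota> \<pi>)"

definition ds_obj :: "('o, 'm, 'z) preadditive_scheme \<Rightarrow> nat \<Rightarrow> (nat \<Rightarrow> 'o) \<Rightarrow> 'o"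
  where "ds_obj A n X = fst (direct_sum A n X)"

definition ds_inj :: "('o, 'm, 'z) preadditive_scheme \<Rightarrow> nat \<Rightarrow> (nat \<Rightarrow> 'o) \<Rightarrow> nat \<Rightarrow> 'm"
  where "ds_inj A n X = fst (snd (direct_sum A n X))"

definition ds_prj :: "('o, 'm, 'z) preadditive_scheme \<Rightarrow> nat \<Rightarrow> (nat \<Rightarrow> 'o) \<Rightarrow> nat \<Rightarrow> 'm"
  where "ds_prj A n X = snd (snd (direct_sum A n X))"

definition ker_arr :: "('o, 'm, 'z) preadditive_scheme \<Rightarrow> 'm \<Rightarrow> 'm"
  where "ker_arr A f = (SOME k. is_kernel A k f)"

definition coker_arr :: "('o, 'm, 'z) preadditive_scheme \<Rightarrow> 'm \<Rightarrow> 'm"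
  where "coker_arr A f = (SOME q. is_cokernel A q f)"

definition im_arr :: "('o, 'm, 'z) preadditive_scheme \<Rightarrow> 'm \<Rightarrow> 'm"
  where "im_arr A f = ker_arr A (coker_arr A f)"

text \<open>Exactness of \<open>X \<rightarrow> Y \<rightarrow> Z\<close> at \<open>Y\<close>: the image of \<open>f\<close> is the kernel of \<open>g\<close>.\<close>

definition exact_at :: "('o, 'm, 'z) preadditive_scheme \<Rightarrow> 'm \<Rightarrow> 'm \<Rightarrow> bool"
  where "exact_at A f g \<longleftrightarrow>
    f \<in> Arr A \<and> g \<in> Arr A \<and> Cod A f = Dom A g \<and> is_kernel A (im_arr A f) g"


section \<open>Homology\<close>

text \<open>Chain complexes are indexed by the integers, with \<open>Bd K n : Ch K n \<rightarrow> Ch K (n - 1)\<close>.\<close>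

record ('o, 'm) chain_complex =
  Ch :: "int \<Rightarrow> 'o"
  Bd :: "int \<Rightarrow> 'm"

definition cycles :: "('o, 'm, 'z) preadditive_scheme \<Rightarrow> ('o, 'm) chain_complex \<Rightarrow> int \<Rightarrow> 'm"
  where "cycles A K n = ker_arr A (Bd K n)"

definition boundaries :: "('o, 'm, 'z) preadditive_scheme \<Rightarrow> ('o, 'm) chain_complex \<Rightarrow> int \<Rightarrow> 'm"
  where "boundaries A K n = im_arr A (Bd K (n + 1))"

definition boundaries_to_cycles ::
    "('o, 'm, 'z) preadditive_scheme \<Rightarrow> ('o, 'm) chain_complex \<Rightarrow> int \<Rightarrow> 'm"
  where "boundaries_to_cycles A K n =
    (THE j. j \<in> Hom A (Dom A (boundaries A K n)) (Dom A (cycles A K n)) \<and>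
      cycles A K n \<cdot>\<^bsub>A\<^esub> j = boundaries A K n)"

text \<open>The \<open>n\<close>-th homology is the quotient of the cycles by the boundaries.\<close>

definition homology_prj ::
    "('o, 'm, 'z) preadditive_scheme \<Rightarrow> ('o, 'm) chain_complex \<Rightarrow> int \<Rightarrow> 'm"
  where "homology_prj A K n = coker_arr A (boundaries_to_cycles A K n)"

definition homology ::
    "('o, 'm, 'z) preadditive_scheme \<Rightarrow> ('o, 'm) chain_complex \<Rightarrow> int \<Rightarrow> 'o"
  where "homology A K n = Cod A (homology_prj A K n)"

definition cycles_map ::
    "('o, 'm, 'z) preadditive_scheme \<Rightarrow> ('o, 'm) chain_complex \<Rightarrow> ('o, 'm) chain_complex \<Rightarrow>
      (int \<Rightarrow> 'm) \<Rightarrow> int \<Rightarrow> 'm"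
  where "cycles_map A K L \<phi> n =
    (THE z. z \<in> Hom A (Dom A (cycles A K n)) (Dom A (cycles A L n)) \<and>
      cycles A L n \<cdot>\<^bsub>A\<^esub> z = \<phi> n \<cdot>\<^bsub>A\<^esub> cycles A K n)"

definition homology_map ::
    "('o, 'm, 'z) preadditive_scheme \<Rightarrow> ('o, 'm) chain_complex \<Rightarrow> ('o, 'm) chain_complex \<Rightarrow>
      (int \<Rightarrow> 'm) \<Rightarrow> int \<Rightarrow> 'm"
  where "homology_map A K L \<phi> n =
    (THE h. h \<in> Hom A (homology A K n) (homology A L n) \<and>
      h \<cdot>\<^bsub>A\<^esub> homology_prj A K n = homology_prj A L n \<cdot>\<^bsub>A\<^esub> cycles_map A K L \<phi> n)"


section \<open>Total complex of a first quadrant bicomplex\<close>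

text \<open>
  \<open>Vert K p m : Bi K p m \<rightarrow> Bi K p (m - 1)\<close> is used for \<open>m \<ge> 1\<close> only, and
  \<open>Horiz K p m : Bi K p m \<rightarrow> Bi K (p - 1) m\<close> for \<open>p \<ge> 1\<close> only. The squares of a bicomplex
  anticommute, so that the total differential is the sum of the two without further signs.
\<close>

record ('o, 'm) bicomplex =
  Bi :: "nat \<Rightarrow> nat \<Rightarrow> 'o"
  Vert :: "nat \<Rightarrow> nat \<Rightarrow> 'm"
  Horiz :: "nat \<Rightarrow> nat \<Rightarrow> 'm"

text \<open>
  The summand of index \<open>p\<close> in total degree \<open>n\<close> is \<open>Bi K p (n - p)\<close>, \<open>p \<le> n\<close>. In negative degree
  there are no summands, and the total object is an empty direct sum, i.e. a zero object.
\<close>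

definition tot_size :: "int \<Rightarrow> nat"
  where "tot_size n = nat (n + 1)"

definition tot_summand :: "('o, 'm) bicomplex \<Rightarrow> int \<Rightarrow> nat \<Rightarrow> 'o"
  where "tot_summand K n p = Bi K p (nat n - p)"

definition tot_obj :: "('o, 'm, 'z) preadditive_scheme \<Rightarrow> ('o, 'm) bicomplex \<Rightarrow> int \<Rightarrow> 'o"
  where "tot_obj A K n = ds_obj A (tot_size n) (tot_summand K n)"

definition tot_inj :: "('o, 'm, 'z) preadditive_scheme \<Rightarrow> ('o, 'm) bicomplex \<Rightarrow> int \<Rightarrow> nat \<Rightarrow> 'm"
  where "tot_inj A K n = ds_inj A (tot_size n) (tot_summand K n)"

definition tot_prj :: "('o, 'm, 'z) preadditive_scheme \<Rightarrow> ('o, 'm) bicomplex \<Rightarrow> int \<Rightarrow> nat \<Rightarrow> 'm"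
  where "tot_prj A K n = ds_prj A (tot_size n) (tot_summand K n)"

definition tot_bd :: "('o, 'm, 'z) preadditive_scheme \<Rightarrow> ('o, 'm) bicomplex \<Rightarrow> int \<Rightarrow> 'm"
  where "tot_bd A K n =
    (if n \<le> 0 then Zero A (tot_obj A K n) (tot_obj A K (n - 1))
     else
       arr_sum A (tot_obj A K n) (tot_obj A K (n - 1))
         (\<lambda>p. tot_inj A K (n - 1) p \<cdot>\<^bsub>A\<^esub> Vert K p (nat n - p) \<cdot>\<^bsub>A\<^esub> tot_prj A K n p)
         {..<nat n}
       \<boxplus>\<^bsub>A\<^esub>
       arr_sum A (tot_obj A K n) (tot_obj A K (n - 1))
         (\<lambda>p. tot_inj A K (n - 1) (p - 1) \<cdot>\<^bsub>A\<^esub> Horiz K p (nat n - p) \<cdot>\<^bsub>A\<^esub> tot_prj A K n p)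
         {1..nat n})"

definition Tot :: "('o, 'm, 'z) preadditive_scheme \<Rightarrow> ('o, 'm) bicomplex \<Rightarrow> ('o, 'm) chain_complex"
  where "Tot A K = \<lparr>Ch = tot_obj A K, Bd = tot_bd A K\<rparr>"

text \<open>The chain map of total complexes induced by a family \<open>\<phi> p m : Bi K p m \<rightarrow> Bi L p m\<close>.\<close>

definition tot_map ::
    "('o, 'm, 'z) preadditive_scheme \<Rightarrow> ('o, 'm) bicomplex \<Rightarrow> ('o, 'm) bicomplex \<Rightarrow>
      (nat \<Rightarrow> nat \<Rightarrow> 'm) \<Rightarrow> int \<Rightarrow> 'm"
  where "tot_map A K L \<phi> n =
    arr_sum A (tot_obj A K n) (tot_obj A L n)
      (\<lambda>p. tot_inj A L n p \<cdot>\<^bsub>A\<^esub> \<phi> p (nat n - p) \<cdot>\<^bsub>A\<^esub> tot_prj A K n p)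
      {..<tot_size n}"


section \<open>Precyclic objects with the last degeneracy\<close>

record ('o, 'm) precyclic =
  Cob :: "nat \<Rightarrow> 'o"
  face :: "nat \<Rightarrow> nat \<Rightarrow> 'm"   \<comment> \<open>\<open>face C n i\<close> is \<open>d\<^sub>i : C\<^sub>n \<rightarrow> C\<^sub>n\<^sub>-\<^sub>1\<close>\<close>
  rot :: "nat \<Rightarrow> 'm"           \<comment> \<open>\<open>rot C n\<close> is \<open>T\<^sub>n : C\<^sub>n \<rightarrow> C\<^sub>n\<close>\<close>
  degen :: "nat \<Rightarrow> 'm"         \<comment> \<open>\<open>degen C n\<close> is \<open>s\<^sub>n : C\<^sub>n \<rightarrow> C\<^sub>n\<^sub>+\<^sub>1\<close>\<close>

definition arr_pow :: "('o, 'm, 'z) category_scheme \<Rightarrow> 'm \<Rightarrow> nat \<Rightarrow> 'm"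
  where "arr_pow A f k = ((\<lambda>g. f \<cdot>\<^bsub>A\<^esub> g) ^^ k) (Ident A (Dom A f))"

locale precyclic_object = category A for A (structure) +
  fixes C :: "('o, 'm) precyclic"
  assumes Cob_in_Obj: "Cob C n \<in> Obj A"
    and face_in_Hom: "\<lbrakk>1 \<le> n; i \<le> n\<rbrakk> \<Longrightarrow> face C n i \<in> Hom A (Cob C n) (Cob C (n - 1))"
    and rot_in_Hom: "rot C n \<in> Hom A (Cob C n) (Cob C n)"
    and degen_in_Hom: "degen C n \<in> Hom A (Cob C n) (Cob C (n + 1))"
    and face_face: "\<lbrakk>2 \<le> n; i < j; j \<le> n\<rbrakk>
      \<Longrightarrow> face C (n - 1) i \<cdot> face C n j = face C (n - 1) (j - 1) \<cdot> face C n i"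
    and rot_pow: "arr_pow A (rot C n) (n + 1) = Ident A (Cob C n)"
    and face_0_rot: "1 \<le> n \<Longrightarrow> face C n 0 \<cdot> rot C n = face C n n"
    and face_rot: "\<lbrakk>1 \<le> i; i \<le> n\<rbrakk> \<Longrightarrow> face C n i \<cdot> rot C n = rot C (n - 1) \<cdot> face C n (i - 1)"
    and face_degen: "i < n \<Longrightarrow> face C (n + 1) i \<cdot> degen C n = degen C (n - 1) \<cdot> face C n i"
    and face_n_degen: "face C (n + 1) n \<cdot> degen C n = Ident A (Cob C n)"
    and face_last_degen: "face C (n + 1) (n + 1) \<cdot> degen C n = Ident A (Cob C n)"

locale precyclic_morphism =
  source: precyclic_object A C + target: precyclic_object A C'
  for A (structure) and C C' :: "('o, 'm) precyclic" +
  fixes \<phi> :: "nat \<Rightarrow> 'm"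
  assumes in_Hom: "\<phi> n \<in> Hom A (Cob C n) (Cob C' n)"
    and commutes_face: "\<lbrakk>1 \<le> n; i \<le> n\<rbrakk> \<Longrightarrow> \<phi> (n - 1) \<cdot> face C n i = face C' n i \<cdot> \<phi> n"
    and commutes_rot: "\<phi> n \<cdot> rot C n = rot C' n \<cdot> \<phi> n"
    and commutes_degen: "\<phi> (n + 1) \<cdot> degen C n = degen C' n \<cdot> \<phi> n"

text \<open>\<open>arr_signed A n f\<close> is \<open>(-1)\<^sup>n f\<close>.\<close>

definition arr_signed :: "('o, 'm, 'z) preadditive_scheme \<Rightarrow> nat \<Rightarrow> 'm \<Rightarrow> 'm"
  where "arr_signed A n f = (if even n then f else arr_neg A f)"

definition cyc_t :: "('o, 'm, 'z) preadditive_scheme \<Rightarrow> ('o, 'm) precyclic \<Rightarrow> nat \<Rightarrow> 'm"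
  where "cyc_t A C n = arr_signed A n (rot C n)"

definition cyc_N :: "('o, 'm, 'z) preadditive_scheme \<Rightarrow> ('o, 'm) precyclic \<Rightarrow> nat \<Rightarrow> 'm"
  where "cyc_N A C n = arr_sum A (Cob C n) (Cob C n) (\<lambda>k. arr_pow A (cyc_t A C n) k) {..n}"

text \<open>
  \<open>cyc_d\<close> and \<open>cyc_d'\<close> are \<open>\<partial>\<close> and \<open>\<partial>'\<close> on \<open>C\<^sub>n\<close> for \<open>n \<ge> 1\<close>. The zero differential on \<open>C\<^sub>0\<close> is
  supplied by \<open>hochschild\<close> and \<open>tot_bd\<close>.
\<close>

definition cyc_d :: "('o, 'm, 'z) preadditive_scheme \<Rightarrow> ('o, 'm) precyclic \<Rightarrow> nat \<Rightarrow> 'm"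
  where "cyc_d A C n =
    arr_sum A (Cob C n) (Cob C (n - 1)) (\<lambda>i. arr_signed A i (face C n i)) {..n}"

definition cyc_d' :: "('o, 'm, 'z) preadditive_scheme \<Rightarrow> ('o, 'm) precyclic \<Rightarrow> nat \<Rightarrow> 'm"
  where "cyc_d' A C n =
    arr_sum A (Cob C n) (Cob C (n - 1)) (\<lambda>i. arr_signed A i (face C n i)) {..<n}"

text \<open>The complex \<open>(C, \<partial>)\<close>, extended by zero to negative degrees.\<close>

definition hoch_obj :: "('o, 'm, 'z) preadditive_scheme \<Rightarrow> ('o, 'm) precyclic \<Rightarrow> int \<Rightarrow> 'o"
  where "hoch_obj A C n = (if n < 0 then zero_object A else Cob C (nat n))"

definition hochschild ::
    "('o, 'm, 'z) preadditive_scheme \<Rightarrow> ('o, 'm) precyclic \<Rightarrow> ('o, 'm) chain_complex"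
  where "hochschild A C =
    \<lparr>Ch = hoch_obj A C,
     Bd = (\<lambda>n. if n \<le> 0 then Zero A (hoch_obj A C n) (hoch_obj A C (n - 1))
              else cyc_d A C (nat n))\<rparr>"

definition hoch_map ::
    "('o, 'm, 'z) preadditive_scheme \<Rightarrow> (nat \<Rightarrow> 'm) \<Rightarrow> int \<Rightarrow> 'm"
  where "hoch_map A \<phi> n =
    (if n < 0 then Zero A (zero_object A) (zero_object A) else \<phi> (nat n))"

definition CC :: "('o, 'm, 'z) preadditive_scheme \<Rightarrow> ('o, 'm) precyclic \<Rightarrow> ('o, 'm) bicomplex"
  where "CC A C =
    \<lparr>Bi = (\<lambda>p m. Cob C m),
     Vert = (\<lambda>p m. if even p then cyc_d A C m else arr_neg A (cyc_d' A C m)),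
     Horiz = (\<lambda>p m. if odd p then Ident A (Cob C m) \<boxplus>\<^bsub>A\<^esub> arr_neg A (cyc_t A C m)
                    else cyc_N A C m)\<rparr>"

definition HH :: "('o, 'm, 'z) preadditive_scheme \<Rightarrow> ('o, 'm) precyclic \<Rightarrow> int \<Rightarrow> 'o"
  where "HH A C n = homology A (hochschild A C) n"

definition HC :: "('o, 'm, 'z) preadditive_scheme \<Rightarrow> ('o, 'm) precyclic \<Rightarrow> int \<Rightarrow> 'o"
  where "HC A C n = homology A (Tot A (CC A C)) n"

definition HH_map ::
    "('o, 'm, 'z) preadditive_scheme \<Rightarrow> ('o, 'm) precyclic \<Rightarrow> ('o, 'm) precyclic \<Rightarrow>
      (nat \<Rightarrow> 'm) \<Rightarrow> int \<Rightarrow> 'm"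
  where "HH_map A C C' \<phi> n =
    homology_map A (hochschild A C) (hochschild A C') (hoch_map A \<phi>) n"

definition HC_map ::
    "('o, 'm, 'z) preadditive_scheme \<Rightarrow> ('o, 'm) precyclic \<Rightarrow> ('o, 'm) precyclic \<Rightarrow>
      (nat \<Rightarrow> 'm) \<Rightarrow> int \<Rightarrow> 'm"
  where "HC_map A C C' \<phi> n =
    homology_map A (Tot A (CC A C)) (Tot A (CC A C'))
      (tot_map A (CC A C) (CC A C') (\<lambda>p m. \<phi> m)) n"

end

theory Submission
  imports Defs "HOL-Library.Product_Plus"
begin

text \<open>
  The bicomplex is periodic in the horizontal direction, so deleting its first two columns gives a
  degreewise split sequence of total complexes whose quotient is the total complex shifted by \<open>2\<close>.
  The maps \<open>\<eta>\<^sub>n = (-1)\<^sup>n s\<^sub>n\<close> satisfy \<open>\<partial>' \<eta> + \<eta> \<partial>' = id\<close>, so the column \<open>(C, - \<partial>')\<close> is contractible and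
  the first two columns compute \<open>H\<close>. Each of \<open>I\<close>, \<open>S\<close>, \<open>B\<close> is induced by an explicit natural map of
  complexes: the inclusion of column \<open>0\<close>, the shift of columns, and \<open>(1 - t) \<eta> N\<close> on column \<open>0\<close>, which
  commutes with the differentials up to sign. Exactness is checked on generalized elements
  \<open>W \<rightarrow> K\<^sub>n\<close>, which may be precomposed with epimorphisms.
\<close>

section \<open>The ring of operators generated by the arrows\<close>

text \<open>Composition of arrows is partial and an abelian category has no elements, whereas the
  argument consists of computations with signed sums of composites. Composition with an arrow is
  additive, so arrows embed faithfully into a genuine ring, where ordinary algebra applies and only
  the relation \<open>mor\<close> remembers source and target. The price is that identities of
  objects become idempotents different from \<open>1\<close>.

  The operator \<open>(1 - t) \<eta> N\<close> is the connecting map of the split sequence written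
  out: a cycle is lifted two columns to the right, the boundary of the lift leaves an error
  \<open>N z_0\<close> in column \<open>1\<close>, the contraction \<open>\<eta>\<close> removes
  that error, and \<open>1 - t\<close> records the effect on column \<open>0\<close>. Since
  \<open>\<eta>\<close> is built from the degeneracies, this is a formula in the structure maps, and
  its naturality is commutation with each factor.

  All degrees are integers, with zero objects in negative degrees. The identity of a zero object is
  \<open>0\<close> in the ring, so the relations hold in every degree without separate boundary
  cases.\<close>

text \<open>
  Signs, powers and finite sums of arrows are computed in a type of class \<open>ring_1\<close>: an arrow acts by
  composition on the additive group of all families of arrows. The summand \<open>int\<close> only ensures \<open>0 \<noteq> 1\<close>.
\<close>

typedef (overloaded) 'g additive_op =
  "{f :: 'g::ab_group_add \<times> int \<Rightarrow> 'g \<times> int. \<forall>x y. f (x + y) = f x + f y}"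
  morphisms app Abs_additive_op
proof
  show "(\<lambda>x. x) \<in> {f :: 'g \<times> int \<Rightarrow> 'g \<times> int. \<forall>x y. f (x + y) = f x + f y}"
    by simp
qed

setup_lifting type_definition_additive_op

instantiation additive_op :: (ab_group_add) ring_1
begin

lift_definition zero_additive_op :: "'a additive_op" is "\<lambda>x. 0" by simp
lift_definition one_additive_op :: "'a additive_op" is "\<lambda>x. x" by simp
lift_definition plus_additive_op :: "'a additive_op \<Rightarrow> 'a additive_op \<Rightarrow> 'a additive_op"
  is "\<lambda>f g x. f x + g x" by (simp add: algebra_simps)
lift_definition uminus_additive_op :: "'a additive_op \<Rightarrow> 'a additive_op"
  is "\<lambda>f x. - f x" by simp
lift_definition minus_additive_op :: "'a additive_op \<Rightarrow> 'a additive_op \<Rightarrow> 'a additive_op"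
  is "\<lambda>f g x. f x - g x" by (simp add: algebra_simps)
lift_definition times_additive_op :: "'a additive_op \<Rightarrow> 'a additive_op \<Rightarrow> 'a additive_op"
  is "\<lambda>f g x. f (g x)" by simp

instance
proof
  have "app 0 (0, 1) \<noteq> app (1 :: 'a additive_op) (0, 1)"
    by (simp add: zero_additive_op.rep_eq one_additive_op.rep_eq zero_prod_def)
  then show "(0 :: 'a additive_op) \<noteq> 1"
    by auto
  fix a b c :: "'a additive_op"
  show "a + b + c = a + (b + c)" "a + b = b + a" "0 + a = a" "- a + a = 0" "a - b = a + - b"
    by (transfer, simp add: algebra_simps)+
  show "a * b * c = a * (b * c)" "1 * a = a" "a * 1 = a" "(a + b) * c = a * c + b * c"
    by (transfer, simp)+
  show "a * (b + c) = a * b + a * c"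
    by transfer (simp del: split_paired_All)
qed

end

section \<open>The abelian group of families of arrows\<close>

definition proper_objects :: "('o, 'm, 'z) preadditive_scheme \<Rightarrow> 'o \<Rightarrow> 'o \<Rightarrow> bool"
  where "proper_objects A X Y \<longleftrightarrow> preadditive_category A \<and> X \<in> Obj A \<and> Y \<in> Obj A"

lemma proper_objects_comm_group: "proper_objects A X Y \<Longrightarrow> comm_group (hom_group A X Y)"
  by (simp add: proper_objects_def preadditive_category.hom_group_comm_group)

lemma
  assumes "proper_objects A X Y"
  shows Zero_in_Hom: "Zero A X Y \<in> Hom A X Y"
    and Plus_in_Hom: "\<lbrakk>f \<in> Hom A X Y; g \<in> Hom A X Y\<rbrakk> \<Longrightarrow> Plus A f g \<in> Hom A X Y"
    and m_inv_in_Hom: "f \<in> Hom A X Y \<Longrightarrow> m_inv (hom_group A X Y) f \<in> Hom A X Y"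
    and Plus_assoc: "\<lbrakk>f \<in> Hom A X Y; g \<in> Hom A X Y; h \<in> Hom A X Y\<rbrakk>
      \<Longrightarrow> Plus A (Plus A f g) h = Plus A f (Plus A g h)"
    and Plus_commute: "\<lbrakk>f \<in> Hom A X Y; g \<in> Hom A X Y\<rbrakk> \<Longrightarrow> Plus A f g = Plus A g f"
    and Zero_Plus: "f \<in> Hom A X Y \<Longrightarrow> Plus A (Zero A X Y) f = f"
    and m_inv_Plus: "f \<in> Hom A X Y \<Longrightarrow> Plus A (m_inv (hom_group A X Y) f) f = Zero A X Y"
proof -
  interpret G: comm_group "hom_group A X Y"
    using assms by (rule proper_objects_comm_group)
  have [simp]: "carrier (hom_group A X Y) = Hom A X Y" "monoid.mult (hom_group A X Y) = Plus A"
    "one (hom_group A X Y) = Zero A X Y"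
    by (simp_all add: hom_group_def)
  show "Zero A X Y \<in> Hom A X Y" using G.one_closed by simp
  show "\<lbrakk>f \<in> Hom A X Y; g \<in> Hom A X Y\<rbrakk> \<Longrightarrow> Plus A f g \<in> Hom A X Y" using G.m_closed[of f g] by simp
  show "f \<in> Hom A X Y \<Longrightarrow> m_inv (hom_group A X Y) f \<in> Hom A X Y" using G.inv_closed[of f] by simp
  show "\<lbrakk>f \<in> Hom A X Y; g \<in> Hom A X Y; h \<in> Hom A X Y\<rbrakk>
      \<Longrightarrow> Plus A (Plus A f g) h = Plus A f (Plus A g h)" using G.m_assoc[of f g h] by simp
  show "\<lbrakk>f \<in> Hom A X Y; g \<in> Hom A X Y\<rbrakk> \<Longrightarrow> Plus A f g = Plus A g f" using G.m_comm[of f g] by simp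
  show "f \<in> Hom A X Y \<Longrightarrow> Plus A (Zero A X Y) f = f" using G.l_one[of f] by simp
  show "f \<in> Hom A X Y \<Longrightarrow> Plus A (m_inv (hom_group A X Y) f) f = Zero A X Y"
    using G.l_inv[of f] by simp
qed

text \<open>
  A type cannot depend on the category, so a family has one arrow for every pair of objects of every
  preadditive category at once.
\<close>

typedef ('o, 'm, 'z) arrow_family =
  "{F :: ('o, 'm, 'z) preadditive_scheme \<Rightarrow> 'o \<Rightarrow> 'o \<Rightarrow> 'm.
     \<forall>A X Y. if proper_objects A X Y then F A X Y \<in> Hom A X Y else F A X Y = undefined}"
  morphisms member Abs_arrow_family
  by (rule exI[of _ "\<lambda>A X Y. if proper_objects A X Y then Zero A X Y else undefined"])
    (simp add: Zero_in_Hom)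

setup_lifting type_definition_arrow_family

instantiation arrow_family :: (type, type, type) ab_group_add
begin

lift_definition zero_arrow_family :: "('a, 'b, 'c) arrow_family"
  is "\<lambda>A X Y. if proper_objects A X Y then Zero A X Y else undefined"
  by (simp add: Zero_in_Hom)
lift_definition plus_arrow_family ::
    "('a, 'b, 'c) arrow_family \<Rightarrow> ('a, 'b, 'c) arrow_family \<Rightarrow> ('a, 'b, 'c) arrow_family"
  is "\<lambda>F G A X Y. if proper_objects A X Y then Plus A (F A X Y) (G A X Y) else undefined"
  by (simp add: Plus_in_Hom)
lift_definition uminus_arrow_family :: "('a, 'b, 'c) arrow_family \<Rightarrow> ('a, 'b, 'c) arrow_family"
  is "\<lambda>F A X Y. if proper_objects A X Y then m_inv (hom_group A X Y) (F A X Y) else undefined"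
  by (simp add: m_inv_in_Hom)
definition minus_arrow_family ::
    "('a, 'b, 'c) arrow_family \<Rightarrow> ('a, 'b, 'c) arrow_family \<Rightarrow> ('a, 'b, 'c) arrow_family"
  where "minus_arrow_family F G = F + - G"

instance
proof
  fix F G H :: "('a, 'b, 'c) arrow_family"
  show "F + G + H = F + (G + H)"
    by transfer (auto simp: fun_eq_iff Plus_assoc split: if_splits)
  show "F + G = G + F"
    by transfer (auto simp: fun_eq_iff Plus_commute split: if_splits)
  show "0 + F = F"
    by transfer (auto simp: fun_eq_iff Zero_Plus split: if_splits)
  show "- F + F = 0"
    by transfer (auto simp: fun_eq_iff m_inv_Plus split: if_splits)
  show "F - G = F + - G" by (simp add: minus_arrow_family_def)
qed

end

lemma member_in_Hom: "proper_objects A X Y \<Longrightarrow> member F A X Y \<in> Hom A X Y"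
  by transfer metis

lemma member_add: "proper_objects A X Y \<Longrightarrow> member (F + G) A X Y = Plus A (member F A X Y) (member G A X Y)"
  by transfer simp

lemma member_eqI:
  "(\<And>A X Y. proper_objects A X Y \<Longrightarrow> member F A X Y = member G A X Y) \<Longrightarrow> F = G"
  by transfer (metis ext)

type_synonym ('o, 'm, 'z) arrow_ring = "('o, 'm, 'z) arrow_family additive_op"

text \<open>\<open>f\<close> acts as a matrix with a single entry, from the components with target
  \<open>Dom A f\<close> to those with target \<open>Cod A f\<close>; all other components of the
  result are zero. Hence arrows that do not fit multiply to \<open>0\<close> in the ring, and the
  identity of an object becomes an idempotent.\<close>

lift_definition postcomp :: "('o, 'm, 'z) preadditive_scheme \<Rightarrow> 'm \<Rightarrow>
    ('o, 'm, 'z) arrow_family \<Rightarrow> ('o, 'm, 'z) arrow_family"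
  is "\<lambda>A f F B W Z.
    if proper_objects B W Z
    then if B = A \<and> f \<in> Arr A \<and> Z = Cod A f then f \<cdot>\<^bsub>A\<^esub> F A W (Dom A f) else Zero B W Z
    else undefined"
proof goal_cases
  case (1 A f F B W Z)
  note F = this
  have "f \<cdot>\<^bsub>A\<^esub> F A W (Dom A f) \<in> Hom A W Z"
    if "proper_objects A W Z" "f \<in> Arr A" "Z = Cod A f"
  proof -
    interpret preadditive_category A using that by (simp add: proper_objects_def)
    have "F A W (Dom A f) \<in> Hom A W (Dom A f)"
      using F[of A W "Dom A f"] that Dom_in_Obj[of f] by (simp add: proper_objects_def)
    then show ?thesis using that by (rule_tac Comp_in_Hom[of _ W "Dom A f"]) (simp_all add: Hom_def)
  qed
  then show ?case
    by (auto simp: Zero_in_Hom)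
qed

lemma member_postcomp:
  "proper_objects B W Z \<Longrightarrow> member (postcomp A f F) B W Z =
    (if B = A \<and> f \<in> Arr A \<and> Z = Cod A f then f \<cdot>\<^bsub>A\<^esub> member F A W (Dom A f) else Zero B W Z)"
  by transfer simp

lemma postcomp_add: "postcomp A f (F + G) = postcomp A f F + postcomp A f G"
proof (rule member_eqI)
  fix B :: "('a, 'b, 'c) preadditive_scheme" and W Z
  assume B: "proper_objects B W Z"
  show "member (postcomp A f (F + G)) B W Z = member (postcomp A f F + postcomp A f G) B W Z"
  proof (cases "B = A \<and> f \<in> Arr A \<and> Z = Cod A f")
    case True
    interpret preadditive_category A using B True by (simp add: proper_objects_def)
    have W: "proper_objects A W (Dom A f)"
      using B True Dom_in_Obj by (simp add: proper_objects_def)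
    have "f \<in> Hom A (Dom A f) Z" using True by (simp add: Hom_def)
    then show ?thesis
      using B True W by (simp add: member_postcomp member_add Comp_Plus[OF member_in_Hom member_in_Hom])
  next
    case False
    then show ?thesis using B
      by (simp add: member_postcomp member_add Zero_Plus Zero_in_Hom del: de_Morgan_conj)
  qed
qed

lift_definition emb :: "('o, 'm, 'z) preadditive_scheme \<Rightarrow> 'm \<Rightarrow> ('o, 'm, 'z) arrow_ring"
  is "\<lambda>A f x. (postcomp A f (fst x), 0)"
  by (simp add: postcomp_add)

lemma app_emb: "app (emb A f) (F, k) = (postcomp A f F, 0)"
  by transfer simp

lemma emb_eq_iff: "emb A f = r \<longleftrightarrow> (\<forall>F k. app r (F, k) = (postcomp A f F, 0))"
  by (auto simp: app_emb app_inject[symmetric] fun_eq_iff)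

text \<open>The typing judgement for ring elements. It is a relation: in a preadditive category
  \<open>0\<close> lies in every \<open>mor A X Y\<close> with objects \<open>X\<close> and
  \<open>Y\<close>, so source and target cannot be read off an element.\<close>

definition mor :: "('o, 'm, 'z) preadditive_scheme \<Rightarrow> 'o \<Rightarrow> 'o \<Rightarrow> ('o, 'm, 'z) arrow_ring set"
  where "mor A X Y = emb A ` Hom A X Y"

context category
begin

lemma Hom_Obj: "f \<in> Hom A X Y \<Longrightarrow> X \<in> Obj A" "f \<in> Hom A X Y \<Longrightarrow> Y \<in> Obj A"
  using Dom_in_Obj Cod_in_Obj by (auto simp: Hom_def)

end

context preadditive_category
begin

abbreviation em :: "'b \<Rightarrow> ('a, 'b, 'c) arrow_ring"
  where "em \<equiv> emb A"

lemma proper_objectsI: "X \<in> Obj A \<Longrightarrow> Y \<in> Obj A \<Longrightarrow> proper_objects A X Y"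
  using preadditive_category_axioms by (simp add: proper_objects_def)

lemma emb_Comp: "f \<in> Hom A X Y \<Longrightarrow> g \<in> Hom A Y Z \<Longrightarrow> em (g \<cdot> f) = em g * em f"
proof -
  assume f: "f \<in> Hom A X Y" and g: "g \<in> Hom A Y Z"
  have gf: "g \<cdot> f \<in> Hom A X Z" by (rule Comp_in_Hom[OF f g])
  have "postcomp A g (postcomp A f F) = postcomp A (g \<cdot> f) F" for F
  proof (rule member_eqI)
    fix B :: "('a, 'b, 'c) preadditive_scheme" and W V
    assume B: "proper_objects B W V"
    show "member (postcomp A g (postcomp A f F)) B W V = member (postcomp A (g \<cdot> f) F) B W V"
    proof (cases "B = A \<and> V = Z")
      case True
      then have p: "proper_objects A W Y" "proper_objects A W X"
        using B Hom_Obj[OF f] by (auto simp: proper_objects_def)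
      show ?thesis
        using B True f g gf p Comp_assoc[OF member_in_Hom[OF p(2)] f g]
        by (simp add: member_postcomp Hom_def)
    next
      case False
      then show ?thesis
        using B f g gf by (auto simp add: member_postcomp Hom_def)
    qed
  qed
  then show ?thesis
    unfolding emb_eq_iff by (simp add: times_additive_op.rep_eq app_emb)
qed

lemma emb_Plus: "f \<in> Hom A X Y \<Longrightarrow> g \<in> Hom A X Y \<Longrightarrow> em (f \<boxplus> g) = em f + em g"
proof -
  assume f: "f \<in> Hom A X Y" and g: "g \<in> Hom A X Y"
  note pXY = proper_objectsI[OF Hom_Obj[OF f]]
  have fg: "f \<boxplus> g \<in> Hom A X Y" by (rule Plus_in_Hom[OF pXY f g])
  have "postcomp A f F + postcomp A g F = postcomp A (f \<boxplus> g) F" for F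
  proof (rule member_eqI)
    fix B :: "('a, 'b, 'c) preadditive_scheme" and W V
    assume B: "proper_objects B W V"
    show "member (postcomp A f F + postcomp A g F) B W V = member (postcomp A (f \<boxplus> g) F) B W V"
    proof (cases "B = A \<and> V = Y")
      case True
      then have p: "proper_objects A W X"
        using B Hom_Obj[OF f] by (auto simp: proper_objects_def)
      show ?thesis
        using B True f g fg p Plus_Comp[OF member_in_Hom[OF p] f g]
        by (simp add: member_postcomp member_add Hom_def)
    next
      case False
      then show ?thesis
        using B f g fg Zero_Plus[OF B Zero_in_Hom[OF B]]
        by (auto simp add: member_postcomp member_add Hom_def)
    qed
  qed
  then show ?thesis
    unfolding emb_eq_iff by (simp add: plus_additive_op.rep_eq app_emb)
qed

lemma emb_Zero: "X \<in> Obj A \<Longrightarrow> Y \<in> Obj A \<Longrightarrow> em (Zero A X Y) = 0"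
  using emb_Plus[of "Zero A X Y" X Y "Zero A X Y"] Zero_Plus Zero_in_Hom proper_objectsI by force

lemma emb_m_inv: "f \<in> Hom A X Y \<Longrightarrow> em (m_inv (hom_group A X Y) f) = - em f"
  using emb_Plus[of "m_inv (hom_group A X Y) f" X Y f] m_inv_Plus[of A X Y f]
    m_inv_in_Hom[of A X Y f] proper_objectsI[of X Y] Hom_Obj[of f X Y] emb_Zero[of X Y]
  by (simp add: eq_neg_iff_add_eq_0)

lemma emb_neg: "f \<in> Hom A X Y \<Longrightarrow> em (arr_neg A f) = - em f"
  by (simp add: arr_neg_def emb_m_inv Hom_def)

lemma neg_in_Hom: "f \<in> Hom A X Y \<Longrightarrow> arr_neg A f \<in> Hom A X Y"
  using m_inv_in_Hom[of A X Y f] proper_objectsI[of X Y] Hom_Obj[of f X Y]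
  by (simp add: arr_neg_def Hom_def)

lemma emb_signed: "f \<in> Hom A X Y \<Longrightarrow> em (arr_signed A n f) = (- 1) ^ n * em f"
  by (auto simp add: arr_signed_def emb_neg)

lemma signed_in_Hom: "f \<in> Hom A X Y \<Longrightarrow> arr_signed A n f \<in> Hom A X Y"
  by (auto simp add: arr_signed_def neg_in_Hom)

text \<open>As in the Yoneda lemma, \<open>f\<close> is recovered by applying its operator to the
  family \<open>F\<close> whose entry at \<open>X\<close>, \<open>X\<close> is the identity and
  whose other entries are zero.\<close>

lemma emb_inj:
  assumes f: "f \<in> Hom A X Y" and g: "g \<in> Hom A X Y" and eq: "em f = em g"
  shows "f = g"
proof -
  define F where "F = Abs_arrow_family (\<lambda>B U V. if proper_objects B U V
    then if B = A \<and> U = X \<and> V = X then Ident A X else Zero B U V else undefined)"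
  have X: "X \<in> Obj A" "Y \<in> Obj A" using Hom_Obj[OF f] by auto
  have "member F = (\<lambda>B U V. if proper_objects B U V
    then if B = A \<and> U = X \<and> V = X then Ident A X else Zero B U V else undefined)"
    unfolding F_def
  proof (rule Abs_arrow_family_inverse, rule CollectI, intro allI)
    fix B :: "('a, 'b, 'c) preadditive_scheme" and U V
    show "if proper_objects B U V
      then (if proper_objects B U V then if B = A \<and> U = X \<and> V = X then Ident A X
        else Zero B U V else undefined) \<in> Hom B U V
      else (if proper_objects B U V then if B = A \<and> U = X \<and> V = X then Ident A X
        else Zero B U V else undefined) = undefined"
      using Ident_in_Hom[OF X(1)] Zero_in_Hom[of B U V] by auto
  qed
  then have F: "member F A X X = Ident A X"
    using proper_objectsI[OF X(1) X(1)] by simp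
  have *: "member (postcomp A h F) A X Y = h" if h: "h \<in> Hom A X Y" for h
  proof -
    have "h \<in> Arr A" "Dom A h = X" "Cod A h = Y" using h by (simp_all add: Hom_def)
    then show ?thesis
      using F Comp_Ident[OF h] member_postcomp[OF proper_objectsI[OF X], of A h F] by simp
  qed
  have "(postcomp A f F, 0 :: int) = (postcomp A g F, 0)"
    by (metis app_emb eq)
  then have "member (postcomp A f F) A X Y = member (postcomp A g F) A X Y"
    by simp
  then show ?thesis unfolding *[OF f] *[OF g] .
qed

lemma emb_eq_conv: "f \<in> Hom A X Y \<Longrightarrow> g \<in> Hom A X Y \<Longrightarrow> em f = em g \<longleftrightarrow> f = g"
  using emb_inj by blast

lemma arr_sum_in_Hom_emb:
  assumes "X \<in> Obj A" "Y \<in> Obj A" "\<And>j. j \<in> J \<Longrightarrow> f j \<in> Hom A X Y" "finite J"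
  shows "arr_sum A X Y f J \<in> Hom A X Y \<and> em (arr_sum A X Y f J) = (\<Sum>j\<in>J. em (f j))"
proof -
  interpret G: comm_group "hom_group A X Y"
    using assms by (intro hom_group_comm_group)
  have [simp]: "carrier (hom_group A X Y) = Hom A X Y" "monoid.mult (hom_group A X Y) = Plus A"
    "one (hom_group A X Y) = Zero A X Y"
    by (simp_all add: hom_group_def)
  show ?thesis
    using assms(4,3) unfolding arr_sum_def
  proof induction
    case empty
    then show ?case using assms by (simp add: emb_Zero Zero_in_Hom proper_objectsI)
  next
    case (insert j J)
    then have "f \<in> J \<rightarrow> Hom A X Y" "f j \<in> Hom A X Y" by auto
    with insert show ?case using assms(1,2)
      by (simp add: emb_Plus[of "f j" X Y] Plus_in_Hom proper_objectsI)
  qed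
qed

lemma arr_sum_in_Hom:
  "\<lbrakk>X \<in> Obj A; Y \<in> Obj A; \<And>j. j \<in> J \<Longrightarrow> f j \<in> Hom A X Y; finite J\<rbrakk> \<Longrightarrow> arr_sum A X Y f J \<in> Hom A X Y"
  using arr_sum_in_Hom_emb[of X Y J f] by blast

lemma emb_sum:
  "\<lbrakk>X \<in> Obj A; Y \<in> Obj A; \<And>j. j \<in> J \<Longrightarrow> f j \<in> Hom A X Y; finite J\<rbrakk>
    \<Longrightarrow> em (arr_sum A X Y f J) = (\<Sum>j\<in>J. em (f j))"
  using arr_sum_in_Hom_emb[of X Y J f] by blast

section \<open>Closure of the typing relation under the ring operations\<close>

abbreviation idm :: "'a \<Rightarrow> ('a, 'b, 'c) arrow_ring"
  where "idm X \<equiv> em (Ident A X)"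

lemma emb_mor: "f \<in> Hom A X Y \<Longrightarrow> em f \<in> mor A X Y"
  by (simp add: mor_def)

lemma mor_Obj: assumes "a \<in> mor A X Y" shows "X \<in> Obj A" "Y \<in> Obj A"
  using assms Hom_Obj by (auto simp: mor_def)

lemma mor_0: "X \<in> Obj A \<Longrightarrow> Y \<in> Obj A \<Longrightarrow> 0 \<in> mor A X Y"
  using emb_Zero[of X Y] Zero_in_Hom[OF proper_objectsI, of X Y] by (metis emb_mor)

lemma mor_add: "a \<in> mor A X Y \<Longrightarrow> b \<in> mor A X Y \<Longrightarrow> a + b \<in> mor A X Y"
  using Plus_in_Hom[of A X Y] proper_objectsI[of X Y] Hom_Obj by (auto simp: mor_def emb_Plus[symmetric])

lemma mor_minus: "a \<in> mor A X Y \<Longrightarrow> - a \<in> mor A X Y"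
  using neg_in_Hom by (auto simp: mor_def emb_neg[symmetric])

lemma mor_diff: "a \<in> mor A X Y \<Longrightarrow> b \<in> mor A X Y \<Longrightarrow> a - b \<in> mor A X Y"
  using mor_add[of a X Y "- b"] mor_minus[of b] by simp

lemma mor_mult: "b \<in> mor A Y Z \<Longrightarrow> a \<in> mor A X Y \<Longrightarrow> b * a \<in> mor A X Z"
  using Comp_in_Hom[of _ X Y _ Z] by (auto simp: mor_def emb_Comp[symmetric])

lemma mor_sum: "X \<in> Obj A \<Longrightarrow> Y \<in> Obj A \<Longrightarrow> (\<And>j. j \<in> J \<Longrightarrow> a j \<in> mor A X Y) \<Longrightarrow> (\<Sum>j\<in>J. a j) \<in> mor A X Y"
  by (induction J rule: infinite_finite_induct) (simp_all add: mor_0 mor_add)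

lemma idm_mor: "X \<in> Obj A \<Longrightarrow> idm X \<in> mor A X X"
  by (simp add: Ident_in_Hom emb_mor)

lemma mor_idm: "a \<in> mor A X Y \<Longrightarrow> a * idm X = a"
proof -
  assume "a \<in> mor A X Y"
  then obtain f where f: "f \<in> Hom A X Y" "a = em f" by (auto simp: mor_def)
  show ?thesis
    using Comp_Ident[OF f(1)] emb_Comp[OF Ident_in_Hom[OF Hom_Obj(1)[OF f(1)]] f(1)] f(2) by simp
qed

lemma idm_mor_left: "a \<in> mor A X Y \<Longrightarrow> idm Y * a = a"
proof -
  assume "a \<in> mor A X Y"
  then obtain f where f: "f \<in> Hom A X Y" "a = em f" by (auto simp: mor_def)
  show ?thesis
    using Ident_Comp[OF f(1)] emb_Comp[OF f(1) Ident_in_Hom[OF Hom_Obj(2)[OF f(1)]]] f(2) by simp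
qed

end

section \<open>Epimorphisms and exactness in abelian categories\<close>

context preadditive_category
begin

text \<open>Cancellation is tested against \<open>0\<close> only, which suffices because arrows can
  be subtracted (\<open>epic_cancel\<close>).\<close>

definition epic :: "('a, 'b, 'c) arrow_ring \<Rightarrow> 'a \<Rightarrow> 'a \<Rightarrow> bool"
  where "epic f X Y \<longleftrightarrow> f \<in> mor A X Y \<and> (\<forall>Z. \<forall>b \<in> mor A Y Z. b * f = 0 \<longrightarrow> b = 0)"

definition monic :: "('a, 'b, 'c) arrow_ring \<Rightarrow> 'a \<Rightarrow> 'a \<Rightarrow> bool"
  where "monic f X Y \<longleftrightarrow> f \<in> mor A X Y \<and> (\<forall>W. \<forall>b \<in> mor A W X. f * b = 0 \<longrightarrow> b = 0)"

text \<open>Monicity of \<open>k\<close> stands in for the uniqueness of factorizations in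
  \<open>is_kernel\<close>, leaving a plain existence statement.\<close>

definition kern :: "('a, 'b, 'c) arrow_ring \<Rightarrow> 'a \<Rightarrow> ('a, 'b, 'c) arrow_ring \<Rightarrow> 'a \<Rightarrow> 'a \<Rightarrow> bool"
  where "kern k K f X Y \<longleftrightarrow> monic k K X \<and> f \<in> mor A X Y \<and> f * k = 0 \<and>
    (\<forall>W. \<forall>g \<in> mor A W X. f * g = 0 \<longrightarrow> (\<exists>h \<in> mor A W K. k * h = g))"

definition cokern :: "('a, 'b, 'c) arrow_ring \<Rightarrow> 'a \<Rightarrow> ('a, 'b, 'c) arrow_ring \<Rightarrow> 'a \<Rightarrow> 'a \<Rightarrow> bool"
  where "cokern q Q f X Y \<longleftrightarrow> epic q Y Q \<and> f \<in> mor A X Y \<and> q * f = 0 \<and>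
    (\<forall>W. \<forall>g \<in> mor A Y W. g * f = 0 \<longrightarrow> (\<exists>h \<in> mor A Q W. h * q = g))"

lemma epicD: "epic f X Y \<Longrightarrow> f \<in> mor A X Y"
  "\<lbrakk>epic f X Y; b \<in> mor A Y Z; b * f = 0\<rbrakk> \<Longrightarrow> b = 0"
  by (auto simp: epic_def)

lemma monicD: "monic f X Y \<Longrightarrow> f \<in> mor A X Y"
  "\<lbrakk>monic f X Y; b \<in> mor A W X; f * b = 0\<rbrakk> \<Longrightarrow> b = 0"
  by (auto simp: monic_def)

lemma kernD:
  assumes "kern k K f X Y"
  shows "monic k K X" "k \<in> mor A K X" "f \<in> mor A X Y" "f * k = 0"
    "\<lbrakk>g \<in> mor A W X; f * g = 0\<rbrakk> \<Longrightarrow> \<exists>h \<in> mor A W K. k * h = g"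
  using assms by (auto simp: kern_def monic_def)

lemma cokernD:
  assumes "cokern q Q f X Y"
  shows "epic q Y Q" "q \<in> mor A Y Q" "f \<in> mor A X Y" "q * f = 0"
    "\<lbrakk>g \<in> mor A Y W; g * f = 0\<rbrakk> \<Longrightarrow> \<exists>h \<in> mor A Q W. h * q = g"
  using assms by (auto simp: cokern_def epic_def)

lemma epic_comp: "\<lbrakk>epic f X Y; epic g Y Z\<rbrakk> \<Longrightarrow> epic (g * f) X Z"
proof -
  assume f: "epic f X Y" and g: "epic g Y Z"
  have "b = 0" if b: "b \<in> mor A Z W" "b * (g * f) = 0" for W b
  proof -
    have "b * g * f = 0" using b(2) by (simp add: mult.assoc)
    then have "b * g = 0" by (rule epicD(2)[OF f mor_mult[OF b(1) epicD(1)[OF g]]])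
    then show ?thesis by (rule epicD(2)[OF g b(1)])
  qed
  then show ?thesis using mor_mult[OF epicD(1)[OF g] epicD(1)[OF f]] by (auto simp: epic_def)
qed

lemma monic_comp: "\<lbrakk>monic f X Y; monic g Y Z\<rbrakk> \<Longrightarrow> monic (g * f) X Z"
proof -
  assume f: "monic f X Y" and g: "monic g Y Z"
  have "b = 0" if b: "b \<in> mor A W X" "g * f * b = 0" for W b
  proof -
    have "g * (f * b) = 0" using b(2) by (simp add: mult.assoc)
    then have "f * b = 0" by (rule monicD(2)[OF g mor_mult[OF monicD(1)[OF f] b(1)]])
    then show ?thesis by (rule monicD(2)[OF f b(1)])
  qed
  then show ?thesis using mor_mult[OF monicD(1)[OF g] monicD(1)[OF f]] by (auto simp: monic_def)
qed

lemma epic_cancel: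
  assumes "epic f X Y" "a \<in> mor A Y Z" "b \<in> mor A Y Z" "a * f = b * f"
  shows "a = b"
proof -
  have "(a - b) * f = 0" using assms(4) by (simp add: left_diff_distrib)
  from epicD(2)[OF assms(1) mor_diff[OF assms(2,3)] this] show ?thesis by simp
qed

lemma monic_cancel:
  assumes "monic f X Y" "a \<in> mor A W X" "b \<in> mor A W X" "f * a = f * b"
  shows "a = b"
proof -
  have "f * (a - b) = 0" using assms(4) by (simp add: right_diff_distrib)
  from monicD(2)[OF assms(1) mor_diff[OF assms(2,3)] this] show ?thesis by simp
qed

lemma eq_Zero_iff:
  assumes "f \<in> Hom A X Y"
  shows "f = Zero A X Y \<longleftrightarrow> em f = 0"
proof -
  note ob = Hom_Obj[OF assms]
  show ?thesis
    unfolding emb_Zero[OF ob, symmetric]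
    by (rule emb_eq_conv[symmetric, OF assms Zero_in_Hom[OF proper_objectsI[OF ob]]])
qed

lemma Comp_eq_Zero_iff:
  assumes "f \<in> Hom A X Y" "g \<in> Hom A Y Z"
  shows "g \<cdot> f = Zero A X Z \<longleftrightarrow> em g * em f = 0"
  unfolding eq_Zero_iff[OF Comp_in_Hom[OF assms]] emb_Comp[OF assms] ..

lemma morE:
  assumes "a \<in> mor A X Y" obtains f where "f \<in> Hom A X Y" "a = em f"
  using assms by (auto simp: mor_def)

lemma is_mono_iff:
  assumes f: "f \<in> Hom A X Y"
  shows "is_mono A f \<longleftrightarrow> monic (em f) X Y"
proof
  have D: "f \<in> Arr A" "Dom A f = X" "Cod A f = Y" using f by (auto simp: Hom_def)
  show "monic (em f) X Y" if mono: "is_mono A f"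
    unfolding monic_def
  proof (intro conjI allI ballI impI)
    show "em f \<in> mor A X Y" using f by (rule emb_mor)
    fix W b assume "b \<in> mor A W X" "em f * b = 0"
    then obtain g where g: "g \<in> Hom A W X" "b = em g" "em f * em g = 0" by (auto elim: morE)
    have Z: "Zero A W X \<in> Hom A W X" by (rule Zero_in_Hom[OF proper_objectsI[OF Hom_Obj[OF g(1)]]])
    have "em (f \<cdot> g) = em (f \<cdot> Zero A W X)"
      using g(3) emb_Zero[OF Hom_Obj[OF g(1)]] by (simp add: emb_Comp[OF g(1) f] emb_Comp[OF Z f])
    then have "f \<cdot> g = f \<cdot> Zero A W X"
      by (rule emb_inj[OF Comp_in_Hom[OF g(1) f] Comp_in_Hom[OF Z f]])
    then have "g = Zero A W X"
      using mono g Z D by (auto simp: is_mono_def)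
    then show "b = 0" using g(2) emb_Zero[OF Hom_Obj[OF g(1)]] by simp
  qed
  show "is_mono A f" if mono: "monic (em f) X Y"
    unfolding is_mono_def D
  proof (intro conjI ballI allI impI)
    show "f \<in> Arr A" by (fact D)
    fix W g h assume g: "g \<in> Hom A W X" and h: "h \<in> Hom A W X" and "f \<cdot> g = f \<cdot> h"
    then have "em f * em g = em f * em h"
      using emb_Comp[OF g f] emb_Comp[OF h f] by simp
    then show "g = h"
      by (rule emb_inj[OF g h monic_cancel[OF mono emb_mor[OF g] emb_mor[OF h]]])
  qed
qed

lemma is_epi_iff:
  assumes f: "f \<in> Hom A X Y"
  shows "is_epi A f \<longleftrightarrow> epic (em f) X Y"
proof
  have D: "f \<in> Arr A" "Dom A f = X" "Cod A f = Y" using f by (auto simp: Hom_def)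
  show "epic (em f) X Y" if epi: "is_epi A f"
    unfolding epic_def
  proof (intro conjI allI ballI impI)
    show "em f \<in> mor A X Y" using f by (rule emb_mor)
    fix W b assume "b \<in> mor A Y W" "b * em f = 0"
    then obtain g where g: "g \<in> Hom A Y W" "b = em g" "em g * em f = 0" by (auto elim: morE)
    have Z: "Zero A Y W \<in> Hom A Y W" by (rule Zero_in_Hom[OF proper_objectsI[OF Hom_Obj[OF g(1)]]])
    have "em (g \<cdot> f) = em (Zero A Y W \<cdot> f)"
      using g(3) emb_Zero[OF Hom_Obj[OF g(1)]] by (simp add: emb_Comp[OF f g(1)] emb_Comp[OF f Z])
    then have "g \<cdot> f = Zero A Y W \<cdot> f"
      by (rule emb_inj[OF Comp_in_Hom[OF f g(1)] Comp_in_Hom[OF f Z]])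
    then have "g = Zero A Y W"
      using epi g Z D by (auto simp: is_epi_def)
    then show "b = 0" using g(2) emb_Zero[OF Hom_Obj[OF g(1)]] by simp
  qed
  show "is_epi A f" if epi: "epic (em f) X Y"
    unfolding is_epi_def D
  proof (intro conjI ballI allI impI)
    show "f \<in> Arr A" by (fact D)
    fix W g h assume g: "g \<in> Hom A Y W" and h: "h \<in> Hom A Y W" and "g \<cdot> f = h \<cdot> f"
    then have "em g * em f = em h * em f"
      using emb_Comp[OF f g] emb_Comp[OF f h] by simp
    then show "g = h"
      by (rule emb_inj[OF g h epic_cancel[OF epi emb_mor[OF g] emb_mor[OF h]]])
  qed
qed

lemma is_kernel_iff:
  assumes k: "k \<in> Hom A K X" and f: "f \<in> Hom A X Y"
  shows "is_kernel A k f \<longleftrightarrow> kern (em k) K (em f) X Y"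
proof
  have D: "f \<in> Arr A" "Dom A f = X" "Cod A f = Y" "k \<in> Arr A" "Dom A k = K" "Cod A k = X"
    using f k by (auto simp: Hom_def)
  show "kern (em k) K (em f) X Y" if ker: "is_kernel A k f"
    unfolding kern_def
  proof (intro conjI allI ballI impI)
    show fk: "em f * em k = 0"
      using ker Comp_eq_Zero_iff[OF k f] D by (simp add: is_kernel_def)
    show "monic (em k) K X"
    proof (subst is_mono_iff[OF k, symmetric], unfold is_mono_def D, intro conjI allI ballI impI)
      show "k \<in> Arr A" by (fact D)
      fix W g h assume g: "g \<in> Hom A W K" and h: "h \<in> Hom A W K" and eq: "k \<cdot> g = k \<cdot> h"
      have kg: "k \<cdot> g \<in> Hom A W X" by (rule Comp_in_Hom[OF g k])
      have "f \<cdot> (k \<cdot> g) = Zero A W Y"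
        using Comp_eq_Zero_iff[OF kg f] emb_Comp[OF g k] fk by (simp add: mult.assoc[symmetric])
      then have "\<exists>!h. h \<in> Hom A W K \<and> k \<cdot> h = k \<cdot> g"
        using ker kg D by (auto simp: is_kernel_def)
      then show "g = h" using g h eq by metis
    qed
    show "em f \<in> mor A X Y" using f by (rule emb_mor)
    fix W b assume "b \<in> mor A W X" "em f * b = 0"
    then obtain g where g: "g \<in> Hom A W X" "b = em g" "em f * em g = 0" by (auto elim: morE)
    then have "f \<cdot> g = Zero A W Y" using Comp_eq_Zero_iff[OF g(1) f] by simp
    then obtain h where "h \<in> Hom A W K" "k \<cdot> h = g"
      using ker g(1) D unfolding is_kernel_def by metis
    then show "\<exists>h\<in>mor A W K. em k * h = b"
      using g emb_Comp[of h W K k X] k emb_mor by metis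
  qed
  show "is_kernel A k f" if ker: "kern (em k) K (em f) X Y"
    unfolding is_kernel_def D
  proof (intro conjI allI ballI impI)
    show "f \<cdot> k = Zero A K Y" using kernD(4)[OF ker] Comp_eq_Zero_iff[OF k f] by simp
    fix W g assume g: "g \<in> Hom A W X" and "f \<cdot> g = Zero A W Y"
    then have "em f * em g = 0" using Comp_eq_Zero_iff[OF g f] by simp
    then obtain b where "b \<in> mor A W K" "em k * b = em g" using kernD(5)[OF ker emb_mor[OF g]] by auto
    then obtain h where h: "h \<in> Hom A W K" "em k * em h = em g" by (auto elim: morE)
    then have "em (k \<cdot> h) = em g" by (simp add: emb_Comp[OF h(1) k])
    then have "k \<cdot> h = g" by (rule emb_inj[OF Comp_in_Hom[OF h(1) k] g])
    moreover have "is_mono A k" using is_mono_iff[OF k] kernD(1)[OF ker] by simp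
    ultimately show "\<exists>!h. h \<in> Hom A W K \<and> k \<cdot> h = g"
      using h(1) D unfolding is_mono_def by metis
  qed (use D in auto)
qed

lemma is_cokernel_iff:
  assumes q: "q \<in> Hom A Y Q" and f: "f \<in> Hom A X Y"
  shows "is_cokernel A q f \<longleftrightarrow> cokern (em q) Q (em f) X Y"
proof
  have D: "f \<in> Arr A" "Dom A f = X" "Cod A f = Y" "q \<in> Arr A" "Dom A q = Y" "Cod A q = Q"
    using f q by (auto simp: Hom_def)
  show "cokern (em q) Q (em f) X Y" if coker: "is_cokernel A q f"
    unfolding cokern_def
  proof (intro conjI allI ballI impI)
    show qf: "em q * em f = 0"
      using coker Comp_eq_Zero_iff[OF f q] D by (simp add: is_cokernel_def)
    show "epic (em q) Y Q"
    proof (subst is_epi_iff[OF q, symmetric], unfold is_epi_def D, intro conjI allI ballI impI)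
      show "q \<in> Arr A" by (fact D)
      fix W g h assume g: "g \<in> Hom A Q W" and h: "h \<in> Hom A Q W" and eq: "g \<cdot> q = h \<cdot> q"
      have gq: "g \<cdot> q \<in> Hom A Y W" by (rule Comp_in_Hom[OF q g])
      have "(g \<cdot> q) \<cdot> f = Zero A X W"
        using Comp_eq_Zero_iff[OF f gq] emb_Comp[OF q g] qf by (simp add: mult.assoc)
      then have "\<exists>!h. h \<in> Hom A Q W \<and> h \<cdot> q = g \<cdot> q"
        using coker gq D by (auto simp: is_cokernel_def)
      then show "g = h" using g h eq by metis
    qed
    show "em f \<in> mor A X Y" using f by (rule emb_mor)
    fix W b assume "b \<in> mor A Y W" "b * em f = 0"
    then obtain g where g: "g \<in> Hom A Y W" "b = em g" "em g * em f = 0" by (auto elim: morE)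
    then have "g \<cdot> f = Zero A X W" using Comp_eq_Zero_iff[OF f g(1)] by simp
    then obtain h where "h \<in> Hom A Q W" "h \<cdot> q = g"
      using coker g(1) D unfolding is_cokernel_def by metis
    then show "\<exists>h\<in>mor A Q W. h * em q = b"
      using g emb_Comp[of q Y Q h W] q emb_mor by metis
  qed
  show "is_cokernel A q f" if coker: "cokern (em q) Q (em f) X Y"
    unfolding is_cokernel_def D
  proof (intro conjI allI ballI impI)
    show "q \<cdot> f = Zero A X Q" using cokernD(4)[OF coker] Comp_eq_Zero_iff[OF f q] by simp
    fix W g assume g: "g \<in> Hom A Y W" and "g \<cdot> f = Zero A X W"
    then have "em g * em f = 0" using Comp_eq_Zero_iff[OF f g] by simp
    then obtain b where "b \<in> mor A Q W" "b * em q = em g" using cokernD(5)[OF coker emb_mor[OF g]] by auto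
    then obtain h where h: "h \<in> Hom A Q W" "em h * em q = em g" by (auto elim: morE)
    then have "em (h \<cdot> q) = em g" by (simp add: emb_Comp[OF q h(1)])
    then have "h \<cdot> q = g" by (rule emb_inj[OF Comp_in_Hom[OF q h(1)] g])
    moreover have "is_epi A q" using is_epi_iff[OF q] cokernD(1)[OF coker] by simp
    ultimately show "\<exists>!h. h \<in> Hom A Q W \<and> h \<cdot> q = g"
      using h(1) D unfolding is_epi_def by metis
  qed (use D in auto)
qed

end

section \<open>Images, pullbacks of epimorphisms and a criterion for exactness\<close>

context abelian_category
begin

lemma ker_arr:
  assumes f: "f \<in> Hom A X Y"
  shows "ker_arr A f \<in> Hom A (Dom A (ker_arr A f)) X"
    and "kern (em (ker_arr A f)) (Dom A (ker_arr A f)) (em f) X Y"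
proof -
  have "is_kernel A (ker_arr A f) f"
    using ex_kernel[of f] f unfolding ker_arr_def Hom_def by (auto intro: someI_ex)
  moreover from this f show h: "ker_arr A f \<in> Hom A (Dom A (ker_arr A f)) X"
    by (auto simp: is_kernel_def Hom_def)
  ultimately show "kern (em (ker_arr A f)) (Dom A (ker_arr A f)) (em f) X Y"
    using is_kernel_iff[OF h f] by simp
qed

lemma coker_arr:
  assumes f: "f \<in> Hom A X Y"
  shows "coker_arr A f \<in> Hom A Y (Cod A (coker_arr A f))"
    and "cokern (em (coker_arr A f)) (Cod A (coker_arr A f)) (em f) X Y"
proof -
  have "is_cokernel A (coker_arr A f) f"
    using ex_cokernel[of f] f unfolding coker_arr_def Hom_def by (auto intro: someI_ex)
  moreover from this f show h: "coker_arr A f \<in> Hom A Y (Cod A (coker_arr A f))"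
    by (auto simp: is_cokernel_def Hom_def)
  ultimately show "cokern (em (coker_arr A f)) (Cod A (coker_arr A f)) (em f) X Y"
    using is_cokernel_iff[OF h f] by simp
qed

lemma kern_exists: "f \<in> mor A X Y \<Longrightarrow> \<exists>k K. kern k K f X Y"
  using ker_arr(2) by (metis morE)

lemma cokern_exists: "f \<in> mor A X Y \<Longrightarrow> \<exists>q Q. cokern q Q f X Y"
  using coker_arr(2) by (metis morE)

text \<open>\<open>m\<close> is a kernel of some \<open>g\<close>. As \<open>g\<close> kills
  \<open>m\<close>, it factors through the cokernel \<open>q\<close>; so whatever \<open>q\<close>
  kills is killed by \<open>g\<close> and factors through \<open>m\<close>.\<close>

lemma monic_kern_cokern:
  assumes m: "monic m X Y" and q: "cokern q Q m X Y"
  shows "kern m X q Y Q"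
proof -
  obtain f where f: "f \<in> Hom A X Y" "m = em f" using monicD(1)[OF m] by (auto elim: morE)
  then obtain g where g: "is_kernel A f g" using mono_is_kernel is_mono_iff m by blast
  then have gH: "g \<in> Hom A Y (Cod A g)" using f by (auto simp: is_kernel_def Hom_def)
  have ker: "kern m X (em g) Y (Cod A g)" using is_kernel_iff[OF f(1) gH] g f(2) by simp
  obtain g' where g': "g' \<in> mor A Q (Cod A g)" "g' * q = em g"
    using cokernD(5)[OF q kernD(3,4)[OF ker]] by blast
  show ?thesis unfolding kern_def
  proof (intro conjI allI ballI impI)
    fix W b assume b: "b \<in> mor A W Y" "q * b = 0"
    then have "em g * b = 0" using g'(2) by (metis mult.assoc mult_zero_right)
    then show "\<exists>h\<in>mor A W X. m * h = b" using kernD(5)[OF ker b(1)] by simp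
  qed (use m cokernD[OF q] in auto)
qed

lemma epic_cokern_kern:
  assumes e: "epic e X Y" and k: "kern k K e X Y"
  shows "cokern e Y k K X"
proof -
  obtain f where f: "f \<in> Hom A X Y" "e = em f" using epicD(1)[OF e] by (auto elim: morE)
  then obtain g where g: "is_cokernel A f g" using epi_is_cokernel is_epi_iff e by blast
  then have gH: "g \<in> Hom A (Dom A g) X" using f by (auto simp: is_cokernel_def Hom_def)
  have coker: "cokern e Y (em g) (Dom A g) X" using is_cokernel_iff[OF f(1) gH] g f(2) by simp
  obtain g' where g': "g' \<in> mor A (Dom A g) K" "k * g' = em g"
    using kernD(5)[OF k cokernD(3,4)[OF coker]] by blast
  show ?thesis unfolding cokern_def
  proof (intro conjI allI ballI impI)
    fix W b assume b: "b \<in> mor A X W" "b * k = 0"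
    then have "b * em g = 0" using g'(2) by (metis mult.assoc mult_zero_left)
    then show "\<exists>h\<in>mor A Y W. h * e = b" using cokernD(5)[OF coker b(1)] by simp
  qed (use e kernD[OF k] in auto)
qed

text \<open>If \<open>a\<close> kills \<open>f'\<close>, then \<open>f\<close> factors through the
  subobject \<open>m * k\<close> with \<open>k\<close> the kernel of \<open>a\<close>. This
  subobject is the kernel of its cokernel \<open>d\<close>. Since \<open>d\<close> kills
  \<open>f\<close>, it factors through \<open>c\<close> and kills \<open>m\<close>; so
  \<open>m\<close> factors through \<open>m * k\<close>, and \<open>k\<close> gets a right inverse,
  which forces \<open>a = 0\<close>.\<close>

lemma image_factorization:
  assumes f: "f \<in> mor A X Y" and c: "cokern c Q f X Y" and m: "kern m I c Y Q"
  shows "\<exists>f'. epic f' X I \<and> m * f' = f"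
proof -
  obtain f' where f': "f' \<in> mor A X I" "m * f' = f"
    using kernD(5)[OF m f cokernD(4)[OF c]] by blast
  have "a = 0" if a: "a \<in> mor A I W" "a * f' = 0" for W a
  proof -
    obtain k K where k: "kern k K a I W" using kern_exists a(1) by blast
    obtain f'' where f'': "f'' \<in> mor A X K" "k * f'' = f'" using kernD(5)[OF k f'(1) a(2)] by blast
    have mk: "monic (m * k) K Y"
      by (rule monic_comp[OF kernD(1)[OF k] kernD(1)[OF m]])
    obtain d R where d: "cokern d R (m * k) K Y" using cokern_exists monicD(1)[OF mk] by blast
    have "d * f = d * (m * k) * f''" using f''(2) f'(2) by (simp add: mult.assoc)
    then have "d * f = 0" using cokernD(4)[OF d] by simp
    then obtain d' where "d' * c = d" using cokernD(5)[OF c cokernD(2)[OF d]] by blast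
    then have "d * m = 0" using kernD(4)[OF m] by (metis mult.assoc mult_zero_right)
    then obtain l where l: "l \<in> mor A I K" "m * k * l = m"
      using kernD(5)[OF monic_kern_cokern[OF mk d] kernD(2)[OF m]] by blast
    have I: "I \<in> Obj A" using mor_Obj l(1) by blast
    have "m * (k * l) = m * idm I"
      using l mor_idm[OF kernD(2)[OF m]] by (simp add: mult.assoc)
    then have "k * l = idm I"
      by (rule monic_cancel[OF kernD(1)[OF m] mor_mult[OF kernD(2)[OF k] l(1)] idm_mor[OF I]])
    then have "a = a * k * l" using mor_idm[OF a(1)] by (simp add: mult.assoc)
    then show ?thesis using kernD(4)[OF k] by simp
  qed
  then show ?thesis using f' unfolding epic_def by blast
qed

lemma biproduct_exists:
  assumes "X \<in> Obj A" "Y \<in> Obj A"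
  shows "\<exists>P i j p q. i \<in> mor A X P \<and> j \<in> mor A Y P \<and> p \<in> mor A P X \<and> q \<in> mor A P Y \<and>
    p * i = idm X \<and> q * j = idm Y \<and> p * j = 0 \<and> q * i = 0 \<and> i * p + j * q = idm P"
proof -
  define F where "F = (\<lambda>i::nat. if i = 0 then X else Y)"
  have F: "F i \<in> Obj A" for i using assms by (simp add: F_def)
  obtain P \<iota> \<pi> where "is_direct_sum A 2 F P \<iota> \<pi>" using ex_direct_sum[of 2 F] F by blast
  then have P: "P \<in> Obj A" and H: "\<And>i. i < 2 \<Longrightarrow> \<iota> i \<in> Hom A (F i) P"
    "\<And>i. i < 2 \<Longrightarrow> \<pi> i \<in> Hom A P (F i)"
    and eq: "\<And>i j. i < 2 \<Longrightarrow> j < 2 \<Longrightarrow>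
      \<pi> j \<cdot> \<iota> i = (if i = j then Ident A (F i) else Zero A (F i) (F j))"
    and s: "arr_sum A P P (\<lambda>i. \<iota> i \<cdot> \<pi> i) {..<2} = Ident A P"
    by (auto simp: is_direct_sum_def)
  have "em (\<pi> j) * em (\<iota> i) = (if i = j then idm (F i) else 0)" if "i < 2" "j < 2" for i j
    using eq[OF that] emb_Comp[OF H(1)[OF that(1)] H(2)[OF that(2)]] emb_Zero[OF F F]
    by (auto split: if_splits)
  from this[of 0 0] this[of 1 1] this[of 1 0] this[of 0 1]
  have "em (\<pi> 0) * em (\<iota> 0) = idm X" "em (\<pi> 1) * em (\<iota> 1) = idm Y"
    "em (\<pi> 0) * em (\<iota> 1) = 0" "em (\<pi> 1) * em (\<iota> 0) = 0"
    by (simp_all add: F_def)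
  moreover have "em (\<iota> 0) * em (\<pi> 0) + em (\<iota> 1) * em (\<pi> 1) = idm P"
  proof -
    have "em (\<iota> i \<cdot> \<pi> i) = em (\<iota> i) * em (\<pi> i)" if "i < 2" for i
      by (rule emb_Comp[OF H(2) H(1)]) fact+
    then show ?thesis
      unfolding s[symmetric] using P Comp_in_Hom[OF H(2) H(1)]
      by (subst emb_sum) (auto simp: numeral_2_eq_2)
  qed
  moreover have "em (\<iota> 0) \<in> mor A X P" "em (\<pi> 0) \<in> mor A P X"
    "em (\<iota> 1) \<in> mor A Y P" "em (\<pi> 1) \<in> mor A P Y"
    using emb_mor[OF H(1), of 0] emb_mor[OF H(1), of 1] emb_mor[OF H(2), of 0] emb_mor[OF H(2), of 1]
    by (simp_all add: F_def)
  ultimately show ?thesis by blast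
qed

text \<open>The pullback is the kernel \<open>K\<close> of \<open>u = f * p - g * q\<close> on the
  biproduct. As \<open>u\<close> restricts to \<open>f\<close> on \<open>X\<close>, it is epic and
  hence the cokernel of \<open>k\<close>. If \<open>a\<close> kills \<open>q * k\<close>, then
  \<open>a * q = b * u\<close>; restricting to \<open>X\<close> gives \<open>b * f = 0\<close>, so
  \<open>b = 0\<close>, and restricting to \<open>Y\<close> gives \<open>a = 0\<close>.\<close>

lemma pullback_epic:
  assumes f: "epic f X Z" and g: "g \<in> mor A Y Z"
  shows "\<exists>W p e. p \<in> mor A W X \<and> epic e W Y \<and> f * p = g * e"
proof -
  have ob: "X \<in> Obj A" "Y \<in> Obj A" using mor_Obj epicD(1)[OF f] g by blast+
  obtain P i j p q where m: "i \<in> mor A X P" "j \<in> mor A Y P" "p \<in> mor A P X" "q \<in> mor A P Y"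
    and eq: "p * i = idm X" "q * j = idm Y" "p * j = 0" "q * i = 0"
    using biproduct_exists[OF ob] by metis
  define u where "u = f * p - g * q"
  have fX: "f * idm X = f" by (rule mor_idm[OF epicD(1)[OF f]])
  have ui: "u * i = f" using eq fX by (simp add: u_def algebra_simps)
  have um: "u \<in> mor A P Z" unfolding u_def by (intro mor_diff mor_mult[OF _ m(3)] mor_mult[OF _ m(4)] g epicD(1)[OF f])
  have u: "epic u P Z" unfolding epic_def
  proof (intro conjI allI ballI impI um)
    fix W b assume b: "b \<in> mor A Z W" "b * u = 0"
    then have "b * f = 0" using ui by (metis mult.assoc mult_zero_left)
    then show "b = 0" by (rule epicD(2)[OF f b(1)])
  qed
  obtain k K where k: "kern k K u P Z" using kern_exists[OF um] by blast
  have c: "cokern u Z k K P" by (rule epic_cokern_kern[OF u k])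
  have "epic (q * k) K Y" unfolding epic_def
  proof (intro conjI allI ballI impI)
    show "q * k \<in> mor A K Y" by (rule mor_mult[OF m(4) kernD(2)[OF k]])
    fix W a assume a: "a \<in> mor A Y W" "a * (q * k) = 0"
    then obtain b where b: "b \<in> mor A Z W" "b * u = a * q"
      using cokernD(5)[OF c mor_mult[OF a(1) m(4)]] by (auto simp: mult.assoc)
    have "b * f = a * q * i" using b(2) ui by (metis mult.assoc)
    then have "b * f = 0" using eq(4) by (simp add: mult.assoc)
    then have "b = 0" by (rule epicD(2)[OF f b(1)])
    then have "a * q * j = 0" using b(2) by simp
    then show "a = 0" using eq(2) mor_idm[OF a(1)] by (simp add: mult.assoc)
  qed
  moreover have "f * (p * k) = g * (q * k)"
    using kernD(4)[OF k] by (simp add: u_def algebra_simps)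
  ultimately show ?thesis using mor_mult[OF m(3) kernD(2)[OF k]] by blast
qed

lemma im_arr:
  assumes f: "f \<in> Hom A X Y"
  shows "im_arr A f \<in> Hom A (Dom A (im_arr A f)) Y"
    and "\<exists>f' c Q. cokern c Q (em f) X Y \<and> kern (em (im_arr A f)) (Dom A (im_arr A f)) c Y Q \<and>
      epic f' X (Dom A (im_arr A f)) \<and> em (im_arr A f) * f' = em f"
proof -
  note c = coker_arr[OF f]
  note k = ker_arr[OF c(1)]
  show "im_arr A f \<in> Hom A (Dom A (im_arr A f)) Y"
    unfolding im_arr_def by (rule k(1))
  show "\<exists>f' c Q. cokern c Q (em f) X Y \<and> kern (em (im_arr A f)) (Dom A (im_arr A f)) c Y Q \<and>
      epic f' X (Dom A (im_arr A f)) \<and> em (im_arr A f) * f' = em f"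
    using image_factorization[OF emb_mor[OF f] c(2) k(2)] c(2) k(2) unfolding im_arr_def by blast
qed

text \<open>A preimage that exists only after an epimorphism \<open>e\<close> is enough: the
  cokernel \<open>c\<close> of \<open>f\<close> kills \<open>x * e\<close>, hence kills
  \<open>x\<close>, and so \<open>x\<close> factors through the image, which is the kernel of
  \<open>c\<close>.\<close>

lemma exact_atI:
  assumes f: "f \<in> Hom A X Y" and g: "g \<in> Hom A Y Z" and gf: "em g * em f = 0"
    and lift: "\<And>W x. \<lbrakk>x \<in> mor A W Y; em g * x = 0\<rbrakk>
      \<Longrightarrow> \<exists>W' e. epic e W' W \<and> (\<exists>y \<in> mor A W' X. em f * y = x * e)"
  shows "exact_at A f g"
proof -
  define m where "m = im_arr A f"
  define I where "I = Dom A m"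
  have mH: "m \<in> Hom A I Y" unfolding m_def I_def by (rule im_arr(1)[OF f])
  obtain f' c Q where c: "cokern c Q (em f) X Y" and k: "kern (em m) I c Y Q"
    and f': "epic f' X I" "em m * f' = em f"
    using im_arr(2)[OF f] unfolding m_def I_def by blast
  have "kern (em m) I (em g) Y Z" unfolding kern_def
  proof (intro conjI allI ballI impI)
    show "monic (em m) I Y" by (rule kernD(1)[OF k])
    show "em g \<in> mor A Y Z" by (rule emb_mor[OF g])
    have "em g * em m * f' = 0"
      using gf f'(2) by (simp add: mult.assoc)
    then show "em g * em m = 0"
      by (rule epicD(2)[OF f'(1) mor_mult[OF emb_mor[OF g] emb_mor[OF mH]]])
    fix W x assume x: "x \<in> mor A W Y" "em g * x = 0"
    then obtain W' e y where e: "epic e W' W" and y: "em f * y = x * e" using lift by blast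
    have "c * x * e = c * em f * y" using y by (simp add: mult.assoc)
    then have "c * x * e = 0" using cokernD(4)[OF c] by simp
    then have "c * x = 0" by (rule epicD(2)[OF e mor_mult[OF cokernD(2)[OF c] x(1)]])
    then show "\<exists>h\<in>mor A W I. em m * h = x" using kernD(5)[OF k x(1)] by simp
  qed
  then have "is_kernel A m g" using is_kernel_iff[OF mH g] by simp
  then show ?thesis using f g by (auto simp: exact_at_def m_def Hom_def)
qed

end

section \<open>Maps induced on homology\<close>

text \<open>Turns an equation for \<open>a * b\<close> into a rewrite rule for right-nested
  products, in which \<open>a * b\<close> does not occur as a subterm.\<close>

lemma mult_left_assoc:
  fixes a :: "'r::semigroup_mult"
  assumes "a * b = c"
  shows "a * (b * x) = c * x"
  by (simp add: assms mult.assoc[symmetric])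

context abelian_category
begin

abbreviation bd :: "('a, 'b) chain_complex \<Rightarrow> int \<Rightarrow> ('a, 'b, 'c) arrow_ring"
  where "bd K n \<equiv> em (Bd K n)"

abbreviation cyc_obj :: "('a, 'b) chain_complex \<Rightarrow> int \<Rightarrow> 'a"
  where "cyc_obj K n \<equiv> Dom A (cycles A K n)"

abbreviation cyc :: "('a, 'b) chain_complex \<Rightarrow> int \<Rightarrow> ('a, 'b, 'c) arrow_ring"
  where "cyc K n \<equiv> em (cycles A K n)"

abbreviation prj :: "('a, 'b) chain_complex \<Rightarrow> int \<Rightarrow> ('a, 'b, 'c) arrow_ring"
  where "prj K n \<equiv> em (homology_prj A K n)"

definition is_complex :: "('a, 'b) chain_complex \<Rightarrow> bool"
  where "is_complex K \<longleftrightarrow>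
    (\<forall>n. Bd K n \<in> Hom A (Ch K n) (Ch K (n - 1)) \<and> bd K n * bd K (n + 1) = 0)"

lemma is_complexD:
  assumes "is_complex K"
  shows "Bd K n \<in> Hom A (Ch K n) (Ch K (n - 1))" "Bd K (n + 1) \<in> Hom A (Ch K (n + 1)) (Ch K n)"
    "bd K n * bd K (n + 1) = 0"
  using assms unfolding is_complex_def by (auto dest: spec[of _ "n + 1"])

lemma cycles:
  assumes "is_complex K"
  shows "cycles A K n \<in> Hom A (cyc_obj K n) (Ch K n)"
    and "kern (cyc K n) (cyc_obj K n) (bd K n) (Ch K n) (Ch K (n - 1))"
  using ker_arr[OF is_complexD(1)[OF assms, of n]] by (simp_all add: cycles_def)

text \<open>The cover \<open>e\<close> in the last part arises because the differential reaches the
  boundaries only through an epimorphism \<open>f'\<close>, along which an arrow may fail to lift;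
  \<open>pullback_epic\<close> lifts it over a cover.\<close>

lemma homology_prj:
  assumes K: "is_complex K"
  shows homology_prj_in_Hom: "homology_prj A K n \<in> Hom A (cyc_obj K n) (homology A K n)"
    and prj_epic: "epic (prj K n) (cyc_obj K n) (homology A K n)"
    and prj_eq_0_iff: "z \<in> mor A W (cyc_obj K n) \<Longrightarrow> prj K n * z = 0 \<longleftrightarrow>
      (\<exists>W' e. epic e W' W \<and> (\<exists>y \<in> mor A W' (Ch K (n + 1)). cyc K n * z * e = bd K (n + 1) * y))"
proof -
  note d = is_complexD[OF K, of n]
  note c = cycles[OF K, of n]
  define I where "I = Dom A (boundaries A K n)"
  have im: "boundaries A K n \<in> Hom A I (Ch K n)"
    unfolding I_def boundaries_def by (rule im_arr(1)[OF d(2)])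
  obtain f' q Q where q: "cokern q Q (bd K (n + 1)) (Ch K (n + 1)) (Ch K n)"
    and m: "kern (em (boundaries A K n)) I q (Ch K n) Q"
    and f': "epic f' (Ch K (n + 1)) I" "em (boundaries A K n) * f' = bd K (n + 1)"
    using im_arr(2)[OF d(2)] unfolding I_def boundaries_def by blast
  have "bd K n * em (boundaries A K n) * f' = 0"
    using f'(2) d(3) by (simp add: mult.assoc)
  then have "bd K n * em (boundaries A K n) = 0"
    by (rule epicD(2)[OF f'(1) mor_mult[OF emb_mor[OF d(1)] emb_mor[OF im]]])
  from kernD(5)[OF c(2) emb_mor[OF im] this]
  obtain j where j: "j \<in> Hom A I (cyc_obj K n)" "cyc K n * em j = em (boundaries A K n)"
    by (auto elim!: morE)
  have jj: "boundaries_to_cycles A K n = j"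
    unfolding boundaries_to_cycles_def
  proof (rule the_equality)
    have "cycles A K n \<cdot> j = boundaries A K n"
      by (rule emb_inj[OF Comp_in_Hom[OF j(1) c(1)] im]) (simp add: emb_Comp[OF j(1) c(1)] j(2))
    then show "j \<in> Hom A (Dom A (boundaries A K n)) (cyc_obj K n) \<and> cycles A K n \<cdot> j = boundaries A K n"
      using j(1) by (simp add: I_def)
    fix i assume "i \<in> Hom A (Dom A (boundaries A K n)) (cyc_obj K n) \<and> cycles A K n \<cdot> i = boundaries A K n"
    then have i: "i \<in> Hom A I (cyc_obj K n)" "cyc K n * em i = em (boundaries A K n)"
      using emb_Comp[OF _ c(1), symmetric] by (auto simp: I_def)
    show "i = j"
      by (rule emb_inj[OF i(1) j(1)], rule monic_cancel[OF kernD(1)[OF c(2)] emb_mor[OF i(1)] emb_mor[OF j(1)]])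
        (simp add: i j)
  qed
  have p: "homology_prj A K n \<in> Hom A (cyc_obj K n) (homology A K n)"
    "cokern (prj K n) (homology A K n) (em j) I (cyc_obj K n)"
    using coker_arr[OF j(1)] by (simp_all add: homology_prj_def homology_def jj)
  show "homology_prj A K n \<in> Hom A (cyc_obj K n) (homology A K n)" by (rule p)
  show "epic (prj K n) (cyc_obj K n) (homology A K n)" by (rule cokernD(1)[OF p(2)])
  \<comment> \<open>A monic arrow is the kernel of its cokernel, here \<open>prj K n\<close>; so a
    cycle that vanishes in homology factors through the boundaries.\<close>
  have jmonic: "monic (em j) I (cyc_obj K n)"
    unfolding monic_def
  proof (intro conjI allI ballI impI)
    show "em j \<in> mor A I (cyc_obj K n)" by (rule emb_mor[OF j(1)])
    fix W b assume b: "b \<in> mor A W I" "em j * b = 0"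
    have "em (boundaries A K n) * b = 0" using b(2) j(2) by (metis mult.assoc mult_zero_right)
    then show "b = 0" by (rule monicD(2)[OF kernD(1)[OF m] b(1)])
  qed
  note kj = monic_kern_cokern[OF jmonic p(2)]
  show "prj K n * z = 0 \<longleftrightarrow>
      (\<exists>W' e. epic e W' W \<and> (\<exists>y \<in> mor A W' (Ch K (n + 1)). cyc K n * z * e = bd K (n + 1) * y))"
    if z: "z \<in> mor A W (cyc_obj K n)"
  proof
    assume "prj K n * z = 0"
    then obtain x where x: "x \<in> mor A W I" "em j * x = z" using kernD(5)[OF kj z] by blast
    obtain W' y e where y: "y \<in> mor A W' (Ch K (n + 1))" "epic e W' W" "f' * y = x * e"
      using pullback_epic[OF f'(1) x(1)] by blast
    have "cyc K n * z * e = cyc K n * em j * (x * e)" by (simp add: x(2)[symmetric] mult.assoc)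
    also have "\<dots> = bd K (n + 1) * y" by (simp only: j(2) y(3)[symmetric] f'(2)[symmetric] mult.assoc)
    finally show "\<exists>W' e. epic e W' W \<and> (\<exists>y \<in> mor A W' (Ch K (n + 1)). cyc K n * z * e = bd K (n + 1) * y)"
      using y by blast
  next
    assume "\<exists>W' e. epic e W' W \<and> (\<exists>y \<in> mor A W' (Ch K (n + 1)). cyc K n * z * e = bd K (n + 1) * y)"
    then obtain W' e y where e: "epic e W' W" and y: "y \<in> mor A W' (Ch K (n + 1))"
      and eq: "cyc K n * z * e = bd K (n + 1) * y" by blast
    have "cyc K n * (z * e) = cyc K n * (em j * (f' * y))"
      using eq by (simp only: j(2) f'(2)[symmetric] mult.assoc[symmetric])
    then have "z * e = em j * (f' * y)"
      by (rule monic_cancel[OF kernD(1)[OF c(2)] mor_mult[OF z epicD(1)[OF e]]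
        mor_mult[OF emb_mor[OF j(1)] mor_mult[OF epicD(1)[OF f'(1)] y]]])
    then have "prj K n * z * e = prj K n * em j * (f' * y)" by (simp add: mult.assoc)
    then have "prj K n * z * e = 0" using cokernD(4)[OF p(2)] by simp
    then show "prj K n * z = 0" by (rule epicD(2)[OF e mor_mult[OF emb_mor[OF p(1)] z]])
  qed
qed

text \<open>A condition in one degree instead of a chain map: cycles go to cycles and boundaries to
  boundaries. It admits a change of degree and operators that commute with the differentials only up
  to sign, such as \<open>connes\<close>.\<close>

definition preserves_homology ::
    "('a, 'b) chain_complex \<Rightarrow> int \<Rightarrow> ('a, 'b) chain_complex \<Rightarrow> int \<Rightarrow> ('a, 'b, 'c) arrow_ring \<Rightarrow> bool"
  where "preserves_homology K n L m a \<longleftrightarrow> is_complex K \<and> is_complex L \<and>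
    a \<in> mor A (Ch K n) (Ch L m) \<and> bd L m * a * cyc K n = 0 \<and>
    (\<exists>b \<in> mor A (Ch K (n + 1)) (Ch L (m + 1)). a * bd K (n + 1) = bd L (m + 1) * b)"

definition induced ::
    "('a, 'b) chain_complex \<Rightarrow> int \<Rightarrow> ('a, 'b) chain_complex \<Rightarrow> int \<Rightarrow> ('a, 'b, 'c) arrow_ring \<Rightarrow> 'b \<Rightarrow> bool"
  where "induced K n L m a h \<longleftrightarrow> h \<in> Hom A (homology A K n) (homology A L m) \<and>
    (\<exists>z \<in> mor A (cyc_obj K n) (cyc_obj L m). cyc L m * z = a * cyc K n \<and>
      em h * prj K n = prj L m * z)"

definition hmap ::
    "('a, 'b) chain_complex \<Rightarrow> int \<Rightarrow> ('a, 'b) chain_complex \<Rightarrow> int \<Rightarrow> ('a, 'b, 'c) arrow_ring \<Rightarrow> 'b"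
  where "hmap K n L m a = (THE h. induced K n L m a h)"

lemma preserves_homologyD:
  assumes "preserves_homology K n L m a"
  shows "is_complex K" "is_complex L" "a \<in> mor A (Ch K n) (Ch L m)" "bd L m * a * cyc K n = 0"
    "\<exists>b \<in> mor A (Ch K (n + 1)) (Ch L (m + 1)). a * bd K (n + 1) = bd L (m + 1) * b"
  using assms by (auto simp: preserves_homology_def)

lemma preserves_homologyI:
  assumes "is_complex K" "is_complex L" "a \<in> mor A (Ch K n) (Ch L m)"
    and "bd L m * a = c * bd K n" "a * bd K (n + 1) = bd L (m + 1) * b"
    and "b \<in> mor A (Ch K (n + 1)) (Ch L (m + 1))"
  shows "preserves_homology K n L m a"
  using assms kernD(4)[OF cycles(2)[OF assms(1)]] unfolding preserves_homology_def
  by (auto simp: mult.assoc)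

lemma induced_unique:
  assumes "is_complex K" "is_complex L" "induced K n L m a h" "induced K n L m a h'"
  shows "h = h'"
proof -
  obtain z where z: "h \<in> Hom A (homology A K n) (homology A L m)"
    "z \<in> mor A (cyc_obj K n) (cyc_obj L m)" "cyc L m * z = a * cyc K n" "em h * prj K n = prj L m * z"
    using assms(3) unfolding induced_def by blast
  obtain z' where z': "h' \<in> Hom A (homology A K n) (homology A L m)"
    "z' \<in> mor A (cyc_obj K n) (cyc_obj L m)" "cyc L m * z' = a * cyc K n" "em h' * prj K n = prj L m * z'"
    using assms(4) unfolding induced_def by blast
  have "z = z'"
    by (rule monic_cancel[OF kernD(1)[OF cycles(2)[OF assms(2)]] z(2) z'(2)]) (simp add: z z')
  then have "em h * prj K n = em h' * prj K n" using z z' by simp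
  then show ?thesis
    by (intro emb_inj[OF z(1) z'(1)] epic_cancel[OF prj_epic[OF assms(1)] emb_mor[OF z(1)] emb_mor[OF z'(1)]])
qed

text \<open>On the kernel \<open>k\<close> of \<open>prj K n\<close> cycles become boundaries over a
  cover, and \<open>a\<close> takes these to boundaries, so \<open>prj L m * z\<close> kills
  \<open>k\<close>. It descends to homology because the epimorphism \<open>prj K n\<close> is the
  cokernel of \<open>k\<close>.\<close>

lemma induced_hmap:
  assumes a: "preserves_homology K n L m a"
  shows "induced K n L m a (hmap K n L m a)"
proof -
  note aD = preserves_homologyD[OF a]
  note cK = cycles[OF aD(1), of n] and cL = cycles[OF aD(2), of m]
  have ac: "a * cyc K n \<in> mor A (cyc_obj K n) (Ch L m)"
    by (rule mor_mult[OF aD(3) emb_mor[OF cK(1)]])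
  have "bd L m * (a * cyc K n) = 0" using aD(4) by (simp add: mult.assoc)
  then obtain z where z: "z \<in> mor A (cyc_obj K n) (cyc_obj L m)" "cyc L m * z = a * cyc K n"
    using kernD(5)[OF cL(2) ac] by blast
  obtain b where b: "b \<in> mor A (Ch K (n + 1)) (Ch L (m + 1))" "a * bd K (n + 1) = bd L (m + 1) * b"
    using aD(5) by blast
  obtain N k where k: "kern k N (prj K n) (cyc_obj K n) (homology A K n)"
    using kern_exists[OF epicD(1)[OF prj_epic[OF aD(1), of n]]] by blast
  obtain W e y where e: "epic e W N" "y \<in> mor A W (Ch K (n + 1))" "cyc K n * k * e = bd K (n + 1) * y"
    using prj_eq_0_iff[OF aD(1) kernD(2)[OF k]] kernD(4)[OF k] by blast
  have "cyc L m * (z * k) * e = a * (cyc K n * k * e)"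
    using z(2) by (simp add: mult.assoc[symmetric])
  also have "\<dots> = bd L (m + 1) * (b * y)" unfolding e(3) by (simp add: mult.assoc mult_left_assoc[OF b(2)])
  finally have "prj L m * (z * k) = 0"
    using prj_eq_0_iff[OF aD(2) mor_mult[OF z(1) kernD(2)[OF k]]] e(1) mor_mult[OF b(1) e(2)] by blast
  then have "prj L m * z * k = 0" by (simp add: mult.assoc)
  then obtain h where "h \<in> mor A (homology A K n) (homology A L m)" "h * prj K n = prj L m * z"
    using cokernD(5)[OF epic_cokern_kern[OF prj_epic[OF aD(1)] k]
      mor_mult[OF epicD(1)[OF prj_epic[OF aD(2)]] z(1)]] by blast
  then obtain h where h: "induced K n L m a h"
    unfolding induced_def using z by (blast elim: morE)
  then show ?thesis
    unfolding hmap_def by (rule theI) (rule induced_unique[OF aD(1,2) _ h])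
qed

lemma hmap_in_Hom:
  "preserves_homology K n L m a \<Longrightarrow> hmap K n L m a \<in> Hom A (homology A K n) (homology A L m)"
  using induced_hmap by (auto simp: induced_def)

text \<open>Phrased with the relation \<open>induced\<close>, so that two composites can be compared
  by \<open>induced_unique\<close> without establishing \<open>preserves_homology\<close> for
  \<open>b * a\<close>.\<close>

lemma hmap_comp:
  assumes a: "preserves_homology K n L m a" and b: "preserves_homology L m M k b"
  shows "induced K n M k (b * a) (hmap L m M k b \<cdot> hmap K n L m a)"
proof -
  obtain z where z: "z \<in> mor A (cyc_obj K n) (cyc_obj L m)" "cyc L m * z = a * cyc K n"
    "em (hmap K n L m a) * prj K n = prj L m * z"
    using induced_hmap[OF a] by (auto simp: induced_def)
  obtain w where w: "w \<in> mor A (cyc_obj L m) (cyc_obj M k)" "cyc M k * w = b * cyc L m"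
    "em (hmap L m M k b) * prj L m = prj M k * w"
    using induced_hmap[OF b] by (auto simp: induced_def)
  have "cyc M k * (w * z) = b * a * cyc K n"
    by (metis mult.assoc z(2) w(2))
  moreover have "em (hmap L m M k b \<cdot> hmap K n L m a) * prj K n = prj M k * (w * z)"
    by (simp only: emb_Comp[OF hmap_in_Hom[OF a] hmap_in_Hom[OF b]] mult.assoc z(3))
      (simp only: w(3) mult.assoc[symmetric])
  ultimately show ?thesis
    unfolding induced_def using mor_mult[OF w(1) z(1)] Comp_in_Hom[OF hmap_in_Hom[OF a] hmap_in_Hom[OF b]]
    by blast
qed

lemma hmap_square:
  assumes "preserves_homology K n L m a" "preserves_homology L m M k b"
    and "preserves_homology K n L' m' a'" "preserves_homology L' m' M k b'" and "b * a = b' * a'"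
  shows "hmap L m M k b \<cdot> hmap K n L m a = hmap L' m' M k b' \<cdot> hmap K n L' m' a'"
  using induced_unique[OF _ _ hmap_comp[OF assms(1,2)]] hmap_comp[OF assms(3,4)] assms(5)
    preserves_homologyD(1)[OF assms(1)] preserves_homologyD(2)[OF assms(2)] by simp

lemma homology_map_eq_hmap:
  assumes \<phi>: "\<phi> n \<in> Hom A (Ch K n) (Ch L n)" and pres: "preserves_homology K n L n (em (\<phi> n))"
  shows "homology_map A K L \<phi> n = hmap K n L n (em (\<phi> n))"
proof -
  note D = preserves_homologyD[OF pres]
  note cK = cycles[OF D(1), of n] and cL = cycles[OF D(2), of n]
  have ind: "induced K n L n (em (\<phi> n)) (hmap K n L n (em (\<phi> n)))" by (rule induced_hmap[OF pres])
  then obtain z where z: "z \<in> Hom A (cyc_obj K n) (cyc_obj L n)"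
    "cyc L n * em z = em (\<phi> n) * cyc K n"
    "em (hmap K n L n (em (\<phi> n))) * prj K n = prj L n * em z"
    unfolding induced_def by (blast elim: morE)
  have iff: "cycles A L n \<cdot> w = \<phi> n \<cdot> cycles A K n \<longleftrightarrow> w = z"
    if w: "w \<in> Hom A (cyc_obj K n) (cyc_obj L n)" for w
  proof -
    have "cycles A L n \<cdot> w = \<phi> n \<cdot> cycles A K n \<longleftrightarrow> cyc L n * em w = cyc L n * em z"
      using emb_eq_conv[OF Comp_in_Hom[OF w cL(1)] Comp_in_Hom[OF cK(1) \<phi>]]
      by (simp add: emb_Comp[OF w cL(1)] emb_Comp[OF cK(1) \<phi>] z(2))
    also have "\<dots> \<longleftrightarrow> w = z"
      using monic_cancel[OF kernD(1)[OF cL(2)] emb_mor[OF w] emb_mor[OF z(1)]] emb_inj[OF w z(1)] by blast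
    finally show ?thesis .
  qed
  have cm: "cycles_map A K L \<phi> n = z"
    unfolding cycles_map_def
    by (rule the_equality) (use z(1) iff in auto)
  have "homology_map A K L \<phi> n = (THE h. h \<in> Hom A (homology A K n) (homology A L n) \<and>
      em h * prj K n = prj L n * em z)"
    unfolding homology_map_def cm
  proof (rule arg_cong[where f = The], rule ext, rule conj_cong[OF refl])
    fix h assume h: "h \<in> Hom A (homology A K n) (homology A L n)"
    note pK = homology_prj_in_Hom[OF D(1), of n] and pL = homology_prj_in_Hom[OF D(2), of n]
    show "h \<cdot> homology_prj A K n = homology_prj A L n \<cdot> z \<longleftrightarrow> em h * prj K n = prj L n * em z"
      using emb_eq_conv[OF Comp_in_Hom[OF pK h] Comp_in_Hom[OF z(1) pL]]
      by (simp add: emb_Comp[OF pK h] emb_Comp[OF z(1) pL])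
  qed
  also have "\<dots> = hmap K n L n (em (\<phi> n))"
  proof (rule the_equality)
    show "hmap K n L n (em (\<phi> n)) \<in> Hom A (homology A K n) (homology A L n) \<and>
      em (hmap K n L n (em (\<phi> n))) * prj K n = prj L n * em z"
      using z(3) hmap_in_Hom[OF pres] by blast
    fix h assume h: "h \<in> Hom A (homology A K n) (homology A L n) \<and> em h * prj K n = prj L n * em z"
    then have "induced K n L n (em (\<phi> n)) h"
      unfolding induced_def using z(1,2) emb_mor by blast
    then show "h = hmap K n L n (em (\<phi> n))" using ind by (rule induced_unique[OF D(1,2)])
  qed
  finally show ?thesis .
qed

text \<open>All covers are consumed here: one lifts \<open>x\<close> to a cycle, a second turns the
  vanishing of its image in homology into a bounding \<open>v\<close>. The hypotheses then ask for
  witnesses over the same \<open>W\<close>, which explicit formulas can supply.\<close>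

lemma exact_hmap:
  assumes a: "preserves_homology K n L m a" and b: "preserves_homology L m M k b"
    and zero: "\<And>W z. \<lbrakk>z \<in> mor A W (Ch K n); bd K n * z = 0\<rbrakk>
      \<Longrightarrow> \<exists>y \<in> mor A W (Ch M (k + 1)). b * a * z = bd M (k + 1) * y"
    and lift: "\<And>W z v. \<lbrakk>z \<in> mor A W (Ch L m); bd L m * z = 0; v \<in> mor A W (Ch M (k + 1));
        b * z = bd M (k + 1) * v\<rbrakk>
      \<Longrightarrow> \<exists>x \<in> mor A W (Ch K n). \<exists>y \<in> mor A W (Ch L (m + 1)).
        bd K n * x = 0 \<and> z = a * x + bd L (m + 1) * y"
  shows "exact_at A (hmap K n L m a) (hmap L m M k b)"
proof (rule exact_atI)
  note K = preserves_homologyD(1)[OF a] and L = preserves_homologyD(2)[OF a]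
    and M = preserves_homologyD(2)[OF b]
  show ha: "hmap K n L m a \<in> Hom A (homology A K n) (homology A L m)" by (rule hmap_in_Hom[OF a])
  show hb: "hmap L m M k b \<in> Hom A (homology A L m) (homology A M k)" by (rule hmap_in_Hom[OF b])
  note cK = cycles[OF K, of n] and cL = cycles[OF L, of m] and cM = cycles[OF M, of k]
  have ZK: "cyc_obj K n \<in> Obj A" using Hom_Obj[OF cK(1)] by blast
  show "em (hmap L m M k b) * em (hmap K n L m a) = 0"
  proof -
    obtain z where z: "z \<in> mor A (cyc_obj K n) (cyc_obj M k)" "cyc M k * z = b * a * cyc K n"
      "em (hmap L m M k b) * em (hmap K n L m a) * prj K n = prj M k * z"
      using hmap_comp[OF a b] unfolding induced_def emb_Comp[OF ha hb] by blast
    obtain y where y: "y \<in> mor A (cyc_obj K n) (Ch M (k + 1))" "b * a * cyc K n = bd M (k + 1) * y"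
      using zero[OF kernD(2)[OF cK(2)] kernD(4)[OF cK(2)]] by blast
    \<comment> \<open>The identity serves as the cover in \<open>prj_eq_0_iff\<close>.\<close>
    have "epic (idm (cyc_obj K n)) (cyc_obj K n) (cyc_obj K n)"
      unfolding epic_def using idm_mor[OF ZK] by (auto simp: mor_idm)
    moreover have "cyc M k * z * idm (cyc_obj K n) = bd M (k + 1) * y"
      using mor_idm[OF mor_mult[OF kernD(2)[OF cM(2)] z(1)]] z(2) y(2) by simp
    ultimately have "prj M k * z = 0"
      using prj_eq_0_iff[OF M z(1)] y(1) by blast
    then have "em (hmap L m M k b) * em (hmap K n L m a) * prj K n = 0" using z(3) by simp
    then show ?thesis by (rule epicD(2)[OF prj_epic[OF K] mor_mult[OF emb_mor[OF hb] emb_mor[OF ha]]])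
  qed
  fix W x assume x: "x \<in> mor A W (homology A L m)" "em (hmap L m M k b) * x = 0"
  obtain W1 z e1 where z: "z \<in> mor A W1 (cyc_obj L m)" and e1: "epic e1 W1 W"
    and xe: "prj L m * z = x * e1"
    using pullback_epic[OF prj_epic[OF L] x(1)] by blast
  obtain w where w: "w \<in> mor A (cyc_obj L m) (cyc_obj M k)" "cyc M k * w = b * cyc L m"
    "em (hmap L m M k b) * prj L m = prj M k * w"
    using induced_hmap[OF b] by (auto simp: induced_def)
  have "prj M k * (w * z) = em (hmap L m M k b) * (x * e1)"
    using w(3) xe by (metis mult.assoc)
  also have "\<dots> = 0" using x(2) by (simp add: mult.assoc[symmetric])
  finally obtain W2 e2 v where e2: "epic e2 W2 W1" and v: "v \<in> mor A W2 (Ch M (k + 1))"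
    "cyc M k * (w * z) * e2 = bd M (k + 1) * v"
    using prj_eq_0_iff[OF M mor_mult[OF w(1) z]] by blast
  define u where "u = z * e2"
  have u: "u \<in> mor A W2 (cyc_obj L m)" unfolding u_def by (rule mor_mult[OF z epicD(1)[OF e2]])
  have cu: "cyc L m * u \<in> mor A W2 (Ch L m)" by (rule mor_mult[OF kernD(2)[OF cL(2)] u])
  have bcu: "bd L m * (cyc L m * u) = 0" using kernD(4)[OF cL(2)] by (simp add: mult.assoc[symmetric])
  have "b * (cyc L m * u) = bd M (k + 1) * v"
    using v(2) unfolding u_def by (simp add: mult.assoc mult_left_assoc[OF w(2)])
  from lift[OF cu bcu v(1) this]
  obtain s y where s: "s \<in> mor A W2 (Ch K n)" "bd K n * s = 0" and y: "y \<in> mor A W2 (Ch L (m + 1))"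
    and eq: "cyc L m * u = a * s + bd L (m + 1) * y" by blast
  obtain t where t: "t \<in> mor A W2 (cyc_obj K n)" "cyc K n * t = s"
    using kernD(5)[OF cK(2) s] by blast
  obtain r where r: "r \<in> mor A (cyc_obj K n) (cyc_obj L m)" "cyc L m * r = a * cyc K n"
    "em (hmap K n L m a) * prj K n = prj L m * r"
    using induced_hmap[OF a] by (auto simp: induced_def)
  have rt: "r * t \<in> mor A W2 (cyc_obj L m)" by (rule mor_mult[OF r(1) t(1)])
  have "cyc L m * (r * t) = a * s" using r(2) t(2) by (metis mult.assoc)
  then have "cyc L m * (u - r * t) = bd L (m + 1) * y"
    using eq by (simp add: right_diff_distrib)
  moreover have W2: "W2 \<in> Obj A" using mor_Obj[OF y] by blast
  have "epic (idm W2) W2 W2"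
    unfolding epic_def using idm_mor[OF W2] by (auto simp: mor_idm)
  moreover have urt: "u - r * t \<in> mor A W2 (cyc_obj L m)" by (rule mor_diff[OF u rt])
  ultimately have "prj L m * (u - r * t) = 0"
    using prj_eq_0_iff[OF L urt] y mor_idm[OF mor_mult[OF kernD(2)[OF cL(2)] urt]] by metis
  then have "prj L m * u = prj L m * r * t"
    by (simp add: right_diff_distrib mult.assoc)
  then have "em (hmap K n L m a) * (prj K n * t) = x * (e1 * e2)"
    using r(3) xe unfolding u_def by (metis mult.assoc)
  moreover have "prj K n * t \<in> mor A W2 (homology A K n)"
    by (rule mor_mult[OF epicD(1)[OF prj_epic[OF K]] t(1)])
  ultimately show "\<exists>W' e. epic e W' W \<and> (\<exists>y\<in>mor A W' (homology A K n). em (hmap K n L m a) * y = x * e)"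
    using epic_comp[OF e2 e1] by blast
qed

end

section \<open>Identities for faces, rotations and the last degeneracy\<close>

text \<open>The signs are absorbed into \<open>\<delta>\<close>, \<open>\<tau>\<close> and
  \<open>\<eta>\<close>; alternating sums become plain sums, and every exchange rule carries at most
  a uniform minus sign. \<open>e n\<close> plays the identity of \<open>C_n\<close>; it need not be
  \<open>1\<close>, so its unit laws are listed.\<close>

locale signed_precyclic =
  fixes e :: "nat \<Rightarrow> 'r::ring_1" and \<delta> :: "nat \<Rightarrow> nat \<Rightarrow> 'r" and \<tau> \<eta> :: "nat \<Rightarrow> 'r"
  assumes e_e: "e n * e n = e n"
    and e_\<delta>: "i \<le> Suc n \<Longrightarrow> e n * \<delta> (Suc n) i = \<delta> (Suc n) i"
    and \<delta>_e: "i \<le> Suc n \<Longrightarrow> \<delta> (Suc n) i * e (Suc n) = \<delta> (Suc n) i"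
    and e_\<tau>: "e n * \<tau> n = \<tau> n"
    and \<tau>_e: "\<tau> n * e n = \<tau> n"
    and \<delta>_\<delta>: "\<lbrakk>i \<le> j; j \<le> Suc n\<rbrakk> \<Longrightarrow>
      \<delta> (Suc n) i * \<delta> (Suc (Suc n)) (Suc j) = - (\<delta> (Suc n) j * \<delta> (Suc (Suc n)) i)"
    and \<delta>_0_\<tau>: "\<delta> (Suc n) 0 * \<tau> (Suc n) = \<delta> (Suc n) (Suc n)"
    and \<delta>_\<tau>: "i \<le> n \<Longrightarrow> \<delta> (Suc n) (Suc i) * \<tau> (Suc n) = \<tau> n * \<delta> (Suc n) i"
    and \<tau>_pow: "\<tau> n ^ Suc n * e n = e n"
    and \<delta>_\<eta>: "i \<le> n \<Longrightarrow> \<delta> (Suc (Suc n)) i * \<eta> (Suc n) = - (\<eta> n * \<delta> (Suc n) i)"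
    and \<delta>_last_\<eta>: "\<delta> (Suc n) n * \<eta> n = e n"
begin

definition b :: "nat \<Rightarrow> 'r" where "b n = (\<Sum>i\<le>n. \<delta> n i)"
definition b' :: "nat \<Rightarrow> 'r" where "b' n = (\<Sum>i<n. \<delta> n i)"
text \<open>The factor \<open>e n\<close> matters for \<open>k = 0\<close>, where the power is
  \<open>1\<close> and not the identity of \<open>C_n\<close>.\<close>

definition N :: "nat \<Rightarrow> 'r" where "N n = (\<Sum>k\<le>n. \<tau> n ^ k * e n)"

text \<open>Truncated sums serve both differentials: \<open>m = Suc n\<close> gives \<open>b\<close>
  and \<open>m = n\<close> gives \<open>b'\<close>. In the induction the products with the new right
  factor cancel those with the new left factor, leaving the product for the previous
  \<open>m\<close>.\<close>

lemma sum_\<delta>_sum_\<delta>: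
  "m \<le> Suc n \<Longrightarrow> (\<Sum>i\<le>m. \<delta> (Suc n) i) * (\<Sum>j\<le>Suc m. \<delta> (Suc (Suc n)) j) = 0"
proof (induction m)
  case 0
  have "\<delta> (Suc n) 0 * \<delta> (Suc (Suc n)) (Suc 0) = - (\<delta> (Suc n) 0 * \<delta> (Suc (Suc n)) 0)"
    by (rule \<delta>_\<delta>) simp_all
  then show ?case by (simp add: distrib_left)
next
  case (Suc m)
  have "\<delta> (Suc n) i * \<delta> (Suc (Suc n)) (Suc (Suc m)) = - (\<delta> (Suc n) (Suc m) * \<delta> (Suc (Suc n)) i)"
    if "i \<le> Suc m" for i
    using that Suc.prems by (intro \<delta>_\<delta>) simp_all
  then have "(\<Sum>i\<le>Suc m. \<delta> (Suc n) i) * \<delta> (Suc (Suc n)) (Suc (Suc m)) =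
      - (\<delta> (Suc n) (Suc m) * (\<Sum>i\<le>Suc m. \<delta> (Suc (Suc n)) i))"
    by (simp only: sum_distrib_right sum_distrib_left sum_negf[symmetric]) (rule sum.cong, simp_all)
  then have "(\<Sum>i\<le>Suc m. \<delta> (Suc n) i) * (\<Sum>j\<le>Suc (Suc m). \<delta> (Suc (Suc n)) j) =
      (\<Sum>i\<le>m. \<delta> (Suc n) i) * (\<Sum>j\<le>Suc m. \<delta> (Suc (Suc n)) j)"
    unfolding sum.atMost_Suc[of _ "Suc m"] distrib_left
    unfolding sum.atMost_Suc[of "\<delta> (Suc n)" m] distrib_right by simp
  then show ?case using Suc by simp
qed

lemma b_b: "b (Suc n) * b (Suc (Suc n)) = 0"
  unfolding b_def by (rule sum_\<delta>_sum_\<delta>) simp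

lemma b'_b': "b' (Suc n) * b' (Suc (Suc n)) = 0"
  unfolding b'_def lessThan_Suc_atMost by (rule sum_\<delta>_sum_\<delta>) simp

lemma b_b'_eq: "b (Suc n) = b' (Suc n) + \<delta> (Suc n) (Suc n)"
  by (simp add: b_def b'_def lessThan_Suc_atMost)

lemma b_\<tau>: "b (Suc n) * \<tau> (Suc n) = \<delta> (Suc n) (Suc n) + \<tau> n * b' (Suc n)"
  unfolding b_def b'_def sum.atMost_Suc_shift lessThan_Suc_atMost
  by (simp add: distrib_right sum_distrib_right sum_distrib_left \<delta>_0_\<tau> \<delta>_\<tau>)

lemma b_e: "b (Suc n) * e (Suc n) = b (Suc n)"
  by (simp add: b_def sum_distrib_right \<delta>_e del: sum.atMost_Suc)

lemma e_b': "e n * b' (Suc n) = b' (Suc n)"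
  by (simp add: b'_def sum_distrib_left e_\<delta> del: sum.lessThan_Suc)

text \<open>The last face occurs in \<open>b\<close> and, as the rotated face \<open>0\<close>, in
  \<open>b * \<tau>\<close>; the two occurrences cancel.\<close>

lemma b_one_minus_\<tau>: "b (Suc n) * (e (Suc n) - \<tau> (Suc n)) = (e n - \<tau> n) * b' (Suc n)"
  by (simp add: right_diff_distrib left_diff_distrib b_\<tau> b_e e_b') (simp add: b_b'_eq)

lemma \<delta>_\<tau>_pow: "\<lbrakk>k \<le> i; i \<le> Suc n\<rbrakk> \<Longrightarrow> \<delta> (Suc n) i * \<tau> (Suc n) ^ k = \<tau> n ^ k * \<delta> (Suc n) (i - k)"
proof (induction k arbitrary: i)
  case (Suc k)
  then obtain j where i: "i = Suc j" by (cases i) auto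
  have "\<delta> (Suc n) i * \<tau> (Suc n) ^ Suc k = \<tau> n * (\<delta> (Suc n) j * \<tau> (Suc n) ^ k)"
    using Suc.prems by (simp add: i mult_left_assoc[OF \<delta>_\<tau>] mult.assoc)
  also have "\<dots> = \<tau> n ^ Suc k * \<delta> (Suc n) (i - Suc k)"
    using Suc.prems Suc.IH[of j] by (simp add: i mult.assoc)
  finally show ?case .
qed simp

text \<open>After \<open>i\<close> rotations the face index is \<open>0\<close>; the next one turns
  face \<open>0\<close> into the last face without releasing a factor \<open>\<tau>\<close>, and the
  remaining \<open>k - i\<close> lower the index again. So \<open>Suc k\<close> rotations release
  only \<open>k\<close> factors.\<close>

lemma \<delta>_\<tau>_pow_wrap:
  assumes "i \<le> k" "k \<le> n"
  shows "\<delta> (Suc n) i * \<tau> (Suc n) ^ Suc k = \<tau> n ^ k * \<delta> (Suc n) (Suc n + i - k)"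
proof -
  have k: "Suc k = i + Suc (k - i)" using assms by simp
  have "\<delta> (Suc n) i * \<tau> (Suc n) ^ Suc k = \<delta> (Suc n) i * \<tau> (Suc n) ^ i * (\<tau> (Suc n) * \<tau> (Suc n) ^ (k - i))"
    by (subst k, simp only: power_add power_Suc mult.assoc)
  also have "\<dots> = \<tau> n ^ i * (\<delta> (Suc n) 0 * \<tau> (Suc n) * \<tau> (Suc n) ^ (k - i))"
    using assms by (simp add: \<delta>_\<tau>_pow mult.assoc)
  also have "\<dots> = \<tau> n ^ i * (\<tau> n ^ (k - i) * \<delta> (Suc n) (Suc n - (k - i)))"
    using assms by (simp add: \<delta>_0_\<tau> \<delta>_\<tau>_pow)
  also have "\<dots> = \<tau> n ^ k * \<delta> (Suc n) (Suc n + i - k)"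
    using assms by (simp add: mult.assoc[symmetric] power_add[symmetric])
  finally show ?thesis .
qed

text \<open>
  Expanding \<open>b' N\<close>, the exponent \<open>a\<close> of \<open>\<tau>\<close> on the left arises from \<open>\<delta>\<^sub>i \<tau>\<^sup>a\<close> with \<open>a \<le> i\<close>, giving
  the faces of index \<open>0, \<dots>, n - a\<close>, and from \<open>\<delta>\<^sub>i \<tau>\<^sup>a\<^sup>+\<^sup>1\<close> with \<open>i \<le> a\<close>, giving the remaining ones.
\<close>

lemma b'_N: "b' (Suc n) * N (Suc n) = N n * b (Suc n)"
proof -
  define f where "f i k = \<delta> (Suc n) i * \<tau> (Suc n) ^ k * e (Suc n)" for i k
  have "b' (Suc n) * N (Suc n) = (\<Sum>k\<le>Suc n. \<Sum>i\<le>n. f i k)"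
    unfolding b'_def N_def f_def lessThan_Suc_atMost sum_product
    by (subst sum.swap) (simp add: mult.assoc)
  also have "\<dots> = (\<Sum>k\<le>Suc n. (\<Sum>i\<in>{k..n}. f i k) + (\<Sum>i\<in>{..<min k (Suc n)}. f i k))"
  proof (rule sum.cong[OF refl])
    fix k assume "k \<in> {..Suc n}"
    then have "{..n} = {k..n} \<union> {..<min k (Suc n)}" by auto
    then show "(\<Sum>i\<le>n. f i k) = (\<Sum>i\<in>{k..n}. f i k) + (\<Sum>i\<in>{..<min k (Suc n)}. f i k)"
      by (simp only:) (rule sum.union_disjoint, auto)
  qed
  also have "\<dots> = (\<Sum>k\<le>Suc n. \<Sum>i\<in>{k..n}. f i k) + (\<Sum>k\<le>Suc n. \<Sum>i\<in>{..<min k (Suc n)}. f i k)"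
    by (rule sum.distrib)
  \<comment> \<open>The first range is empty for \<open>k = Suc n\<close> and the second for
    \<open>k = 0\<close>. Without these terms both sums run over \<open>k \<le> n\<close>, the
    second with its exponent raised by one.\<close>
  also have "(\<Sum>k\<le>Suc n. \<Sum>i\<in>{k..n}. f i k) = (\<Sum>k\<le>n. \<Sum>i\<in>{k..n}. f i k)"
    by simp
  also have "(\<Sum>k\<le>Suc n. \<Sum>i\<in>{..<min k (Suc n)}. f i k) = (\<Sum>k\<le>n. \<Sum>i\<le>k. f i (Suc k))"
    unfolding sum.atMost_Suc_shift by (simp add: lessThan_Suc_atMost min_absorb1)
  also have "(\<Sum>k\<le>n. \<Sum>i\<in>{k..n}. f i k) + (\<Sum>k\<le>n. \<Sum>i\<le>k. f i (Suc k)) =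
      (\<Sum>k\<le>n. (\<Sum>i\<in>{k..n}. f i k) + (\<Sum>i\<le>k. f i (Suc k)))"
    by (simp add: sum.distrib)
  also have "\<dots> = (\<Sum>k\<le>n. \<tau> n ^ k * b (Suc n))"
  proof (rule sum.cong[OF refl])
    fix k assume "k \<in> {..n}"
    then have k: "k \<le> n" by simp
    have "(\<Sum>i\<in>{k..n}. f i k) = (\<Sum>j\<in>{..n - k}. \<tau> n ^ k * \<delta> (Suc n) j)"
      by (rule sum.reindex_bij_witness[of _ "\<lambda>j. j + k" "\<lambda>i. i - k"])
        (use k in \<open>auto simp: f_def \<delta>_\<tau>_pow mult.assoc \<delta>_e\<close>)
    moreover have "(\<Sum>i\<le>k. f i (Suc k)) = (\<Sum>j\<in>{Suc n - k..Suc n}. \<tau> n ^ k * \<delta> (Suc n) j)"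
      by (rule sum.reindex_bij_witness[of _ "\<lambda>j. j + k - Suc n" "\<lambda>i. Suc n + i - k"])
        (use k in \<open>auto simp: f_def \<delta>_\<tau>_pow_wrap mult.assoc \<delta>_e simp del: power_Suc\<close>)
    moreover have "{..Suc n} = {..n - k} \<union> {Suc n - k..Suc n}" using k by auto
    then have "b (Suc n) = (\<Sum>j\<in>{..n - k}. \<delta> (Suc n) j) + (\<Sum>j\<in>{Suc n - k..Suc n}. \<delta> (Suc n) j)"
      unfolding b_def by (simp only:) (rule sum.union_disjoint, use k in auto)
    ultimately show "(\<Sum>i\<in>{k..n}. f i k) + (\<Sum>i\<le>k. f i (Suc k)) = \<tau> n ^ k * b (Suc n)"
      by (simp add: distrib_left sum_distrib_left del: sum.cl_ivl_Suc)
  qed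
  also have "\<dots> = N n * b (Suc n)"
    unfolding N_def b_def sum_distrib_right
    by (simp add: sum_distrib_left mult.assoc e_\<delta> del: sum.atMost_Suc)
  finally show ?thesis .
qed

text \<open>Multiplication by \<open>\<tau>\<close> permutes the summands of \<open>N\<close>
  cyclically, because \<open>\<tau> n ^ Suc n\<close> acts as the identity.\<close>

lemma telescope: "(\<Sum>k\<le>n. \<tau> n ^ k * e n) = (\<Sum>k\<le>n. \<tau> n ^ Suc k * e n)"
proof -
  have "(\<Sum>k\<le>n. \<tau> n ^ Suc k * e n) - (\<Sum>k\<le>n. \<tau> n ^ k * e n) = \<tau> n ^ Suc n * e n - \<tau> n ^ 0 * e n"
    unfolding sum_subtractf[symmetric] atLeast0AtMost[symmetric] by (rule sum_Suc_diff) simp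
  then show ?thesis using \<tau>_pow[of n] by simp
qed

lemma one_minus_\<tau>_N: "(e n - \<tau> n) * N n = 0"
proof -
  have "e n * (\<tau> n ^ k * e n) = \<tau> n ^ k * e n" for k
    by (cases k) (simp_all add: e_e mult.assoc[symmetric] e_\<tau>)
  then have "(e n - \<tau> n) * N n = (\<Sum>k\<le>n. \<tau> n ^ k * e n) - (\<Sum>k\<le>n. \<tau> n ^ Suc k * e n)"
    by (simp add: N_def left_diff_distrib sum_distrib_left sum_subtractf mult.assoc)
  then show ?thesis using telescope[of n] by simp
qed

lemma N_one_minus_\<tau>: "N n * (e n - \<tau> n) = 0"
proof -
  have "\<tau> n ^ k * e n * e n = \<tau> n ^ k * e n" "\<tau> n ^ k * e n * \<tau> n = \<tau> n ^ Suc k * e n" for k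
    by (simp_all add: e_e mult.assoc e_\<tau> \<tau>_e power_Suc2 del: power_Suc)
  then have "N n * (e n - \<tau> n) = (\<Sum>k\<le>n. \<tau> n ^ k * e n) - (\<Sum>k\<le>n. \<tau> n ^ Suc k * e n)"
    by (simp add: N_def right_diff_distrib sum_distrib_right del: power_Suc)
  then show ?thesis using telescope[of n] by simp
qed

text \<open>All faces in \<open>b'\<close> except the last one anticommute with
  \<open>\<eta>\<close> and cancel; the last one contributes the identity. The sign built into
  \<open>\<eta>\<close> is what makes the exchange rule an anticommutation.\<close>

lemma b'_\<eta>: "b' (Suc (Suc n)) * \<eta> (Suc n) + \<eta> n * b' (Suc n) = e (Suc n)"
  using \<delta>_last_\<eta>[of "Suc n"]
  by (simp add: b'_def distrib_left distrib_right sum_distrib_left sum_distrib_right \<delta>_\<eta> sum_negf)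

lemma b'_one_\<eta>: "b' (Suc 0) * \<eta> 0 = e 0"
  using \<delta>_last_\<eta>[of 0] by (simp add: b'_def)

end

section \<open>The differentials of the cyclic bicomplex\<close>

lemma minus_one_power_mult:
  "((- 1) ^ i * x) * ((- 1) ^ j * y) = (- 1) ^ (i + j) * (x * y :: 'r::ring_1)"
  by (simp add: minus_one_power_iff)

lemma minus_one_power_power: "((- 1) ^ n * x) ^ k = (- 1) ^ (n * k) * (x ^ k :: 'r::ring_1)"
  by (auto simp add: minus_one_power_iff)

lemma nonneg_int_cases':
  fixes n :: int
  obtains "n < 0" | "n = 0" | m where "n = int (Suc m)"
  by (metis int_cases2 linorder_cases nonneg_int_cases not0_implies_Suc of_nat_0 less_imp_le)

lemma int_eq_Suc_Suc: "\<not> n \<le> 1 \<Longrightarrow> \<exists>m. n = int (Suc (Suc m))"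
  by (rule exI[of _ "nat (n - 2)"]) simp

context abelian_category
begin

definition hoch_bd :: "('a, 'b) precyclic \<Rightarrow> int \<Rightarrow> ('a, 'b, 'c) arrow_ring"
  where "hoch_bd C n = bd (hochschild A C) n"

text \<open>Like the components that follow, it is \<open>0\<close> in the degrees where the map
  does not exist, so that the relations of the bicomplex hold for all integers.\<close>

definition bar_bd :: "('a, 'b) precyclic \<Rightarrow> int \<Rightarrow> ('a, 'b, 'c) arrow_ring"
  where "bar_bd C n = (if n \<le> 0 then 0 else em (cyc_d' A C (nat n)))"

definition one_t :: "('a, 'b) precyclic \<Rightarrow> int \<Rightarrow> ('a, 'b, 'c) arrow_ring"
  where "one_t C n = (if n < 0 then 0 else em (Ident A (Cob C (nat n)) \<boxplus> arr_neg A (cyc_t A C (nat n))))"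

definition norm_t :: "('a, 'b) precyclic \<Rightarrow> int \<Rightarrow> ('a, 'b, 'c) arrow_ring"
  where "norm_t C n = (if n < 0 then 0 else em (cyc_N A C (nat n)))"

definition htpy :: "('a, 'b) precyclic \<Rightarrow> int \<Rightarrow> ('a, 'b, 'c) arrow_ring"
  where "htpy C n = (if n < 0 then 0 else (- 1) ^ nat n * em (degen C (nat n)))"

lemma zero_object: "is_zero_object A (zero_object A)"
  unfolding zero_object_def using ex_zero_object by (rule someI_ex)

lemma zero_object_Obj: "zero_object A \<in> Obj A"
  using zero_object by (simp add: is_zero_object_def)

lemma mor_zero_object:
  assumes "a \<in> mor A X Z \<or> a \<in> mor A Z X" "is_zero_object A Z"
  shows "a = 0"
proof -
  from assms(1) obtain f where f: "f \<in> Hom A X Z \<or> f \<in> Hom A Z X" "a = em f"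
    by (auto elim: morE)
  then have X: "X \<in> Obj A" using Hom_Obj by blast
  have Z: "Z \<in> Obj A" using assms(2) by (simp add: is_zero_object_def)
  note z = Zero_in_Hom[OF proper_objectsI[OF X Z]] Zero_in_Hom[OF proper_objectsI[OF Z X]]
  have "f = Zero A X Z \<or> f = Zero A Z X"
    using f(1) z assms(2) X unfolding is_zero_object_def by metis
  then show ?thesis using f(2) emb_Zero[OF X Z] emb_Zero[OF Z X] by auto
qed

text \<open>Makes identities such as \<open>bar_bd_htpy\<close> and \<open>tprj_tinj\<close> true in
  negative degrees, where their left-hand sides are \<open>0\<close>.\<close>

lemma idm_zero_object: "idm (zero_object A) = 0"
  using mor_zero_object[of "idm (zero_object A)" "zero_object A" "zero_object A"]
    idm_mor[OF zero_object_Obj] zero_object by simp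

text \<open>The factor \<open>idm X\<close> corrects the zeroth power, which is \<open>1\<close> in
  the ring but the identity of \<open>X\<close> among arrows.\<close>

lemma emb_arr_pow:
  assumes f: "f \<in> Hom A X X"
  shows "arr_pow A f k \<in> Hom A X X \<and> em (arr_pow A f k) = em f ^ k * idm X"
proof -
  have D: "Dom A f = X" using f by (simp add: Hom_def)
  show ?thesis
  proof (induction k)
    case 0
    then show ?case using Ident_in_Hom[of X] Hom_Obj[OF f] by (simp add: arr_pow_def D)
  next
    case (Suc k)
    have "arr_pow A f (Suc k) = f \<cdot> arr_pow A f k" by (simp add: arr_pow_def)
    then show ?case
      using Suc Comp_in_Hom[of "arr_pow A f k" X X f X] emb_Comp[of "arr_pow A f k" X X f X] f
      by (simp add: mult.assoc)
  qed
qed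

end

section \<open>The signed operators of a precyclic object\<close>

locale abelian_precyclic = abelian_category A + precyclic_object A C
  for A :: "('o, 'm, 'z) preadditive_scheme" (structure) and C
begin

abbreviation e :: "nat \<Rightarrow> ('o, 'm, 'z) arrow_ring"
  where "e n \<equiv> idm (Cob C n)"
abbreviation \<delta> :: "nat \<Rightarrow> nat \<Rightarrow> ('o, 'm, 'z) arrow_ring"
  where "\<delta> n i \<equiv> (- 1) ^ i * em (face C n i)"
abbreviation \<tau> :: "nat \<Rightarrow> ('o, 'm, 'z) arrow_ring"
  where "\<tau> n \<equiv> (- 1) ^ n * em (rot C n)"
abbreviation \<eta> :: "nat \<Rightarrow> ('o, 'm, 'z) arrow_ring"
  where "\<eta> n \<equiv> (- 1) ^ n * em (degen C n)"

lemma face_Suc_in_Hom: "i \<le> Suc n \<Longrightarrow> face C (Suc n) i \<in> Hom A (Cob C (Suc n)) (Cob C n)"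
  using face_in_Hom[of "Suc n" i] by simp

lemma degen_Suc_in_Hom: "degen C n \<in> Hom A (Cob C n) (Cob C (Suc n))"
  using degen_in_Hom[of n] by simp

sublocale signed: signed_precyclic e \<delta> \<tau> \<eta>
proof
  note F = face_Suc_in_Hom and R = rot_in_Hom and S = degen_Suc_in_Hom
  have e: "e n \<in> mor A (Cob C n) (Cob C n)" for n by (rule idm_mor[OF Cob_in_Obj])
  fix n
  show "e n * e n = e n" by (rule mor_idm[OF e])
  show "e n * \<tau> n = \<tau> n" "\<tau> n * e n = \<tau> n"
    using idm_mor_left[OF emb_mor[OF R[of n]]] mor_idm[OF emb_mor[OF R[of n]]]
    by (simp_all add: minus_one_power_iff)
  show "e n * \<delta> (Suc n) i = \<delta> (Suc n) i" "\<delta> (Suc n) i * e (Suc n) = \<delta> (Suc n) i" if "i \<le> Suc n" for i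
    using idm_mor_left[OF emb_mor[OF F[OF that]]] mor_idm[OF emb_mor[OF F[OF that]]]
    by (simp_all add: minus_one_power_iff)
  show "\<delta> (Suc n) i * \<delta> (Suc (Suc n)) (Suc j) = - (\<delta> (Suc n) j * \<delta> (Suc (Suc n)) i)"
    if ij: "i \<le> j" "j \<le> Suc n" for i j
  proof -
    have h: "i \<le> Suc n" "Suc j \<le> Suc (Suc n)" "j \<le> Suc n" "i \<le> Suc (Suc n)" using ij by auto
    have "em (face C (Suc n) i) * em (face C (Suc (Suc n)) (Suc j)) =
        em (face C (Suc n) j) * em (face C (Suc (Suc n)) i)"
      using face_face[of "Suc (Suc n)" i "Suc j"] ij
      by (simp add: emb_Comp[OF F[OF h(2)] F[OF h(1)], symmetric]
        emb_Comp[OF F[OF h(4)] F[OF h(3)], symmetric])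
    then show ?thesis unfolding minus_one_power_mult by (simp add: add.commute)
  qed
  show "\<delta> (Suc n) 0 * \<tau> (Suc n) = \<delta> (Suc n) (Suc n)"
    using face_0_rot[of "Suc n"] emb_Comp[OF R F[of 0 n]] unfolding minus_one_power_mult by simp
  show "\<delta> (Suc n) (Suc i) * \<tau> (Suc n) = \<tau> n * \<delta> (Suc n) i" if i: "i \<le> n" for i
  proof -
    have h: "Suc i \<le> Suc n" "i \<le> Suc n" using i by auto
    have "em (face C (Suc n) (Suc i)) * em (rot C (Suc n)) = em (rot C n) * em (face C (Suc n) i)"
      using face_rot[of "Suc i" "Suc n"] h
      by (simp add: emb_Comp[OF R F[OF h(1)], symmetric] emb_Comp[OF F[OF h(2)] R, symmetric])
    then show ?thesis unfolding minus_one_power_mult by (simp add: add.commute)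
  qed
  \<comment> \<open>The sign of the power is \<open>(- 1) ^ (n * Suc n)\<close>, and this exponent
    is even.\<close>
  show "\<tau> n ^ Suc n * e n = e n"
    using emb_arr_pow[OF R, of n "Suc n"] rot_pow[of n]
    unfolding minus_one_power_power mult.assoc by (simp add: minus_one_power_iff)
  show "\<delta> (Suc (Suc n)) i * \<eta> (Suc n) = - (\<eta> n * \<delta> (Suc n) i)" if i: "i \<le> n" for i
  proof -
    have h: "i \<le> Suc (Suc n)" "i \<le> Suc n" using i by auto
    have "em (face C (Suc (Suc n)) i) * em (degen C (Suc n)) = em (degen C n) * em (face C (Suc n) i)"
      using face_degen[of i "Suc n"] i
      by (simp add: emb_Comp[OF S F[OF h(1)], symmetric] emb_Comp[OF F[OF h(2)] S, symmetric])
    then show ?thesis unfolding minus_one_power_mult by (simp add: add.commute)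
  qed
  show "\<delta> (Suc n) n * \<eta> n = e n"
  proof -
    have "em (face C (Suc n) n) * em (degen C n) = e n"
      using face_n_degen[of n] emb_Comp[OF S F[of n n]] by simp
    then show ?thesis unfolding minus_one_power_mult by simp
  qed
qed

lemma cyc_t_in_Hom: "cyc_t A C n \<in> Hom A (Cob C n) (Cob C n)"
  unfolding cyc_t_def by (rule signed_in_Hom[OF rot_in_Hom])

lemma emb_cyc_t: "em (cyc_t A C n) = \<tau> n"
  unfolding cyc_t_def by (rule emb_signed[OF rot_in_Hom])

lemma cyc_d_in_Hom: "cyc_d A C (Suc n) \<in> Hom A (Cob C (Suc n)) (Cob C n)"
  unfolding cyc_d_def diff_Suc_1
  by (intro arr_sum_in_Hom Cob_in_Obj signed_in_Hom face_Suc_in_Hom) auto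

lemma emb_cyc_d: "em (cyc_d A C (Suc n)) = signed.b (Suc n)"
  unfolding cyc_d_def signed.b_def diff_Suc_1
  by (subst emb_sum) (auto simp: emb_signed[OF face_Suc_in_Hom] intro!: Cob_in_Obj signed_in_Hom
    face_Suc_in_Hom simp del: sum.atMost_Suc intro: sum.cong)

lemma cyc_d'_in_Hom: "cyc_d' A C (Suc n) \<in> Hom A (Cob C (Suc n)) (Cob C n)"
  unfolding cyc_d'_def diff_Suc_1
  by (intro arr_sum_in_Hom Cob_in_Obj signed_in_Hom face_Suc_in_Hom) auto

lemma emb_cyc_d': "em (cyc_d' A C (Suc n)) = signed.b' (Suc n)"
  unfolding cyc_d'_def signed.b'_def diff_Suc_1
  by (subst emb_sum) (auto simp: emb_signed[OF face_Suc_in_Hom] intro!: Cob_in_Obj signed_in_Hom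
    face_Suc_in_Hom simp del: sum.lessThan_Suc intro: sum.cong)

lemma cyc_N_in_Hom: "cyc_N A C n \<in> Hom A (Cob C n) (Cob C n)"
  unfolding cyc_N_def using emb_arr_pow[OF cyc_t_in_Hom] by (intro arr_sum_in_Hom Cob_in_Obj) auto

lemma emb_cyc_N: "em (cyc_N A C n) = signed.N n"
  unfolding cyc_N_def signed.N_def using emb_arr_pow[OF cyc_t_in_Hom, of n]
  by (subst emb_sum) (auto simp: emb_cyc_t intro!: Cob_in_Obj)

lemma one_minus_cyc_t_in_Hom:
  "Ident A (Cob C n) \<boxplus> arr_neg A (cyc_t A C n) \<in> Hom A (Cob C n) (Cob C n)"
  by (intro Plus_in_Hom proper_objectsI Cob_in_Obj Ident_in_Hom neg_in_Hom cyc_t_in_Hom)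

lemma emb_one_minus_cyc_t: "em (Ident A (Cob C n) \<boxplus> arr_neg A (cyc_t A C n)) = e n - \<tau> n"
  using emb_Plus[OF Ident_in_Hom[OF Cob_in_Obj] neg_in_Hom[OF cyc_t_in_Hom], of n]
    emb_neg[OF cyc_t_in_Hom, of n] emb_cyc_t[of n] by simp

abbreviation E :: "int \<Rightarrow> 'o"
  where "E \<equiv> hoch_obj A C"

lemma hoch_obj_Obj: "E n \<in> Obj A"
  by (simp add: hoch_obj_def zero_object_Obj Cob_in_Obj)

lemma Bd_hochschild_in_Hom: "Bd (hochschild A C) n \<in> Hom A (E n) (E (n - 1))"
proof (cases n rule: nonneg_int_cases')
  case (3 m)
  then show ?thesis using cyc_d_in_Hom[of m] by (simp add: hochschild_def hoch_obj_def nat_add_distrib)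
qed (simp_all add: hochschild_def Zero_in_Hom proper_objectsI hoch_obj_Obj)

lemma component_simps:
  "n \<le> 0 \<Longrightarrow> hoch_bd C n = 0" "hoch_bd C (int (Suc m)) = signed.b (Suc m)"
  "n \<le> 0 \<Longrightarrow> bar_bd C n = 0" "bar_bd C (int (Suc m)) = signed.b' (Suc m)"
  "n < 0 \<Longrightarrow> one_t C n = 0" "one_t C (int m) = e m - \<tau> m"
  "n < 0 \<Longrightarrow> norm_t C n = 0" "norm_t C (int m) = signed.N m"
  "n < 0 \<Longrightarrow> htpy C n = 0" "htpy C (int m) = \<eta> m"
  by (simp_all add: hoch_bd_def bar_bd_def one_t_def norm_t_def htpy_def hochschild_def emb_Zero hoch_obj_Obj
    emb_cyc_d emb_cyc_d' emb_cyc_N emb_one_minus_cyc_t nat_add_distrib del: of_nat_Suc)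

lemma hoch_bd_mor: "hoch_bd C n \<in> mor A (E n) (E (n - 1))"
  unfolding hoch_bd_def by (rule emb_mor[OF Bd_hochschild_in_Hom])

lemma bar_bd_mor: "bar_bd C n \<in> mor A (E n) (E (n - 1))"
proof (cases n rule: nonneg_int_cases')
  case (3 m)
  then show ?thesis using emb_mor[OF cyc_d'_in_Hom[of m]] by (simp add: bar_bd_def hoch_obj_def nat_add_distrib)
qed (simp_all add: bar_bd_def mor_0 hoch_obj_Obj)

lemma one_t_mor: "one_t C n \<in> mor A (E n) (E n)"
  using emb_mor[OF one_minus_cyc_t_in_Hom[of "nat n"]] mor_0[OF hoch_obj_Obj hoch_obj_Obj, of n n]
  by (auto simp: one_t_def hoch_obj_def)

lemma norm_t_mor: "norm_t C n \<in> mor A (E n) (E n)"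
  using emb_mor[OF cyc_N_in_Hom[of "nat n"]] mor_0[OF hoch_obj_Obj hoch_obj_Obj, of n n]
  by (auto simp: norm_t_def hoch_obj_def)

lemma htpy_mor: "htpy C n \<in> mor A (E n) (E (n + 1))"
proof (cases "n < 0")
  case False
  then have "em (degen C (nat n)) \<in> mor A (E n) (E (n + 1))"
    using emb_mor[OF degen_Suc_in_Hom[of "nat n"]] by (simp add: hoch_obj_def nat_add_distrib)
  then show ?thesis using False by (simp add: htpy_def minus_one_power_iff mor_minus)
qed (simp add: htpy_def mor_0 hoch_obj_Obj)

lemma hoch_bd_hoch_bd: "hoch_bd C (n - 1) * hoch_bd C n = 0"
proof (cases "n \<le> 1")
  case False
  then obtain m where "n = int (Suc (Suc m))" using int_eq_Suc_Suc by blast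
  then show ?thesis using component_simps(2)[of m] component_simps(2)[of "Suc m"] signed.b_b[of m] by simp
qed (simp add: component_simps)

lemma bar_bd_bar_bd: "bar_bd C (n - 1) * bar_bd C n = 0"
proof (cases "n \<le> 1")
  case False
  then obtain m where "n = int (Suc (Suc m))" using int_eq_Suc_Suc by blast
  then show ?thesis using component_simps(4)[of m] component_simps(4)[of "Suc m"] signed.b'_b'[of m] by simp
qed (simp add: component_simps)

lemma hoch_bd_one_t: "hoch_bd C n * one_t C n = one_t C (n - 1) * bar_bd C n"
proof (cases n rule: nonneg_int_cases')
  case (3 m)
  then have "n - 1 = int m" by simp
  then show ?thesis unfolding 3 by (simp only: component_simps signed.b_one_minus_\<tau>)
qed (simp_all add: component_simps)

lemma bar_bd_norm_t: "bar_bd C n * norm_t C n = norm_t C (n - 1) * hoch_bd C n"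
proof (cases n rule: nonneg_int_cases')
  case (3 m)
  then have "n - 1 = int m" by simp
  then show ?thesis unfolding 3 by (simp only: component_simps signed.b'_N)
qed (simp_all add: component_simps)

lemma one_t_norm_t: "one_t C n * norm_t C n = 0"
proof (cases "n < 0")
  case False
  then obtain m where "n = int m" using nonneg_int_cases by (metis not_less)
  then show ?thesis by (simp only: component_simps signed.one_minus_\<tau>_N)
qed (simp_all add: component_simps)

lemma norm_t_one_t: "norm_t C n * one_t C n = 0"
proof (cases "n < 0")
  case False
  then obtain m where "n = int m" using nonneg_int_cases by (metis not_less)
  then show ?thesis by (simp only: component_simps signed.N_one_minus_\<tau>)
qed (simp_all add: component_simps)

text \<open>In negative degrees both sides are \<open>0\<close>; in degree \<open>0\<close> the
  second summand vanishes and \<open>d_0 s_0 = id\<close> remains.\<close>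

lemma bar_bd_htpy: "bar_bd C (n + 1) * htpy C n + htpy C (n - 1) * bar_bd C n = idm (E n)"
proof (cases n rule: nonneg_int_cases')
  case 1
  then show ?thesis by (simp add: component_simps hoch_obj_def idm_zero_object)
next
  case 2
  then show ?thesis
    using component_simps(4)[of 0] component_simps(10)[of 0] signed.b'_one_\<eta> by (simp add: component_simps hoch_obj_def)
next
  case (3 m)
  then have n: "n + 1 = int (Suc (Suc m))" "n - 1 = int m" "E n = Cob C (Suc m)"
    by (simp_all add: hoch_obj_def nat_add_distrib)
  show ?thesis unfolding n unfolding 3 component_simps by (rule signed.b'_\<eta>)
qed

end

section \<open>The total complex\<close>

lemma int_eq_Suc: "\<not> n \<le> 0 \<Longrightarrow> \<exists>m. n = int (Suc m)"
  by (rule exI[of _ "nat (n - 1)"]) simp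

lemma nat_cases_2:
  fixes q :: nat
  obtains "q = 0" | "q = 1" | r where "q = r + 2"
proof (cases q)
  case (Suc r)
  then show thesis using that by (cases r) auto
qed (use that in auto)

context abelian_category
begin

lemma direct_sum:
  assumes "\<And>i. i < n \<Longrightarrow> X i \<in> Obj A"
  shows "is_direct_sum A n X (ds_obj A n X) (ds_inj A n X) (ds_prj A n X)"
proof -
  obtain P \<iota> \<pi> where "is_direct_sum A n X P \<iota> \<pi>" using ex_direct_sum[of n X] assms by blast
  then have "(\<lambda>(P, \<iota>, \<pi>). is_direct_sum A n X P \<iota> \<pi>) (P, \<iota>, \<pi>)" by simp
  then have "(\<lambda>(P, \<iota>, \<pi>). is_direct_sum A n X P \<iota> \<pi>) (direct_sum A n X)"
    unfolding direct_sum_def by (rule someI)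
  then show ?thesis by (simp add: ds_obj_def ds_inj_def ds_prj_def case_prod_beta)
qed

text \<open>
  Injections and projections of the total complex are extended by zero to all column indices; the
  summand of index \<open>p\<close> in degree \<open>n\<close> is then \<open>hoch_obj A C (n - int p)\<close> for all \<open>n\<close> and \<open>p\<close>.
\<close>

definition tinj :: "('a, 'b) precyclic \<Rightarrow> int \<Rightarrow> nat \<Rightarrow> ('a, 'b, 'c) arrow_ring"
  where "tinj C n p = (if p < tot_size n then em (tot_inj A (CC A C) n p) else 0)"

definition tprj :: "('a, 'b) precyclic \<Rightarrow> int \<Rightarrow> nat \<Rightarrow> ('a, 'b, 'c) arrow_ring"
  where "tprj C n p = (if p < tot_size n then em (tot_prj A (CC A C) n p) else 0)"

definition vert :: "('a, 'b) precyclic \<Rightarrow> nat \<Rightarrow> int \<Rightarrow> ('a, 'b, 'c) arrow_ring"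
  where "vert C p m = (if even p then hoch_bd C m else - bar_bd C m)"

text \<open>\<open>horiz C p m\<close> maps column \<open>p + 1\<close> to column \<open>p\<close>.\<close>

definition horiz :: "('a, 'b) precyclic \<Rightarrow> nat \<Rightarrow> int \<Rightarrow> ('a, 'b, 'c) arrow_ring"
  where "horiz C p m = (if even p then one_t C m else norm_t C m)"

abbreviation tot :: "('a, 'b) precyclic \<Rightarrow> int \<Rightarrow> 'a"
  where "tot C n \<equiv> tot_obj A (CC A C) n"

definition tbd :: "('a, 'b) precyclic \<Rightarrow> int \<Rightarrow> ('a, 'b, 'c) arrow_ring"
  where "tbd C n = bd (Tot A (CC A C)) n"

text \<open>The surplus terms of the sum vanish, because \<open>tprj C n (p + 2)\<close> is
  \<open>0\<close> beyond the last column.\<close>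

definition shift :: "('a, 'b) precyclic \<Rightarrow> int \<Rightarrow> ('a, 'b, 'c) arrow_ring"
  where "shift C n = (\<Sum>p<tot_size n. tinj C (n - 2) p * tprj C n (p + 2))"

text \<open>A section of \<open>shift\<close> in each degree, but not a chain map; its failure to be
  one produces \<open>connes\<close>.\<close>

definition unshift :: "('a, 'b) precyclic \<Rightarrow> int \<Rightarrow> ('a, 'b, 'c) arrow_ring"
  where "unshift C n = (\<Sum>p<tot_size n. tinj C n (p + 2) * tprj C (n - 2) p)"

end

section \<open>The total differential in terms of columns\<close>

context abelian_precyclic
begin

lemma tot_summand_eq: "p < tot_size n \<Longrightarrow> tot_summand (CC A C) n p = E (n - int p)"
  by (auto simp: tot_summand_def CC_def hoch_obj_def tot_size_def nat_diff_distrib')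

lemma tot_direct_sum:
  "is_direct_sum A (tot_size n) (tot_summand (CC A C) n) (tot C n)
    (tot_inj A (CC A C) n) (tot_prj A (CC A C) n)"
  unfolding tot_obj_def tot_inj_def tot_prj_def
  by (rule direct_sum) (simp add: tot_summand_eq hoch_obj_Obj)

lemma tot_Obj: "tot C n \<in> Obj A"
  using tot_direct_sum by (simp add: is_direct_sum_def)

lemma tot_inj_in_Hom: "p < tot_size n \<Longrightarrow> tot_inj A (CC A C) n p \<in> Hom A (E (n - int p)) (tot C n)"
  using tot_direct_sum[of n] unfolding is_direct_sum_def by (metis tot_summand_eq)

lemma tot_prj_in_Hom: "p < tot_size n \<Longrightarrow> tot_prj A (CC A C) n p \<in> Hom A (tot C n) (E (n - int p))"
  using tot_direct_sum[of n] unfolding is_direct_sum_def by (metis tot_summand_eq)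

lemma tinj_mor: "tinj C n p \<in> mor A (E (n - int p)) (tot C n)"
  by (simp add: tinj_def emb_mor[OF tot_inj_in_Hom] mor_0 hoch_obj_Obj tot_Obj)

lemma tprj_mor: "tprj C n p \<in> mor A (tot C n) (E (n - int p))"
  by (simp add: tprj_def emb_mor[OF tot_prj_in_Hom] mor_0 hoch_obj_Obj tot_Obj)

lemma tprj_tinj: "tprj C n q * tinj C n p = (if p = q then idm (E (n - int p)) else 0)"
proof (cases "p < tot_size n \<and> q < tot_size n")
  case True
  then have "tot_prj A (CC A C) n q \<cdot> tot_inj A (CC A C) n p =
      (if p = q then Ident A (E (n - int p)) else Zero A (E (n - int p)) (E (n - int q)))"
    using tot_direct_sum[of n] unfolding is_direct_sum_def by (simp add: tot_summand_eq)
  moreover have "em (tot_prj A (CC A C) n q \<cdot> tot_inj A (CC A C) n p) =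
      em (tot_prj A (CC A C) n q) * em (tot_inj A (CC A C) n p)"
    if "p = q \<or> p \<noteq> q"
    using emb_Comp[OF tot_inj_in_Hom tot_prj_in_Hom, of p n q] True by simp
  ultimately show ?thesis
    using True emb_Zero[OF hoch_obj_Obj hoch_obj_Obj] by (auto simp: tinj_def tprj_def)
next
  case False
  \<comment> \<open>Outside the range the summand is the zero object, so the identity demanded on
    the right is \<open>0\<close> too.\<close>
  have "idm (E (n - int p)) = 0" if "\<not> p < tot_size n"
    using that idm_zero_object by (auto simp: tot_size_def hoch_obj_def)
  then show ?thesis using False by (auto simp: tinj_def tprj_def)
qed

lemma sum_tinj_tprj: "(\<Sum>p<tot_size n. tinj C n p * tprj C n p) = idm (tot C n)"
proof -
  have "Ident A (tot C n) = arr_sum A (tot C n) (tot C n)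
      (\<lambda>i. tot_inj A (CC A C) n i \<cdot> tot_prj A (CC A C) n i) {..<tot_size n}"
    using tot_direct_sum[of n] by (simp add: is_direct_sum_def)
  then have "idm (tot C n) =
      (\<Sum>p<tot_size n. em (tot_inj A (CC A C) n p \<cdot> tot_prj A (CC A C) n p))"
    by (simp only:) (rule emb_sum[OF tot_Obj tot_Obj], auto intro: Comp_in_Hom[OF tot_prj_in_Hom tot_inj_in_Hom])
  then show ?thesis
    using emb_Comp[OF tot_prj_in_Hom tot_inj_in_Hom] by (simp add: tinj_def tprj_def)
qed

text \<open>The identities for the total complex below are all checked column by column. The index
  \<open>q\<close> needs no bound, since projections out of range are \<open>0\<close>.\<close>

lemma tot_eqI:
  assumes "x \<in> mor A W (tot C n)" "y \<in> mor A W (tot C n)" "\<And>q. tprj C n q * x = tprj C n q * y"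
  shows "x = y"
proof -
  have *: "z = (\<Sum>p<tot_size n. tinj C n p * (tprj C n p * z))" if "z \<in> mor A W (tot C n)" for z
    using idm_mor_left[OF that] by (simp add: sum_tinj_tprj[symmetric] sum_distrib_right mult.assoc)
  show ?thesis using *[OF assms(1)] *[OF assms(2)] assms(3) by simp
qed

text \<open>Reading the differential at its target column \<open>q\<close> spares all later
  computations the two sums of \<open>tot_bd\<close>.\<close>

lemma Bd_Tot_in_Hom: "Bd (Tot A (CC A C)) n \<in> Hom A (tot C n) (tot C (n - 1))"
  and tprj_tbd: "tprj C (n - 1) q * tbd C n =
    vert C q (n - int q) * tprj C n q + horiz C q (n - 1 - int q) * tprj C n (q + 1)"
proof -
  let ?K = "CC A C"
  have "Bd (Tot A ?K) n \<in> Hom A (tot C n) (tot C (n - 1)) \<and> tprj C (n - 1) q * tbd C n =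
    vert C q (n - int q) * tprj C n q + horiz C q (n - 1 - int q) * tprj C n (q + 1)"
  proof (cases "n \<le> 0")
    case True
    then have "tprj C (n - 1) q = 0" "vert C q (n - int q) = 0" "tprj C n (q + 1) = 0"
      by (auto simp: tprj_def tot_size_def vert_def component_simps)
    then show ?thesis
      using True by (simp add: Tot_def tot_bd_def Zero_in_Hom proper_objectsI tot_Obj)
  next
    case False
    then obtain m where n: "n = int (Suc m)" using int_eq_Suc by blast
    have sz: "tot_size n = Suc (Suc m)" "tot_size (n - 1) = Suc m" "nat n = Suc m"
      by (simp_all add: n tot_size_def nat_add_distrib)
    have V: "Vert ?K p (Suc m - p) \<in> Hom A (E (n - int p)) (E (n - 1 - int p)) \<and>
        em (Vert ?K p (Suc m - p)) = vert C p (n - int p)" if p: "p \<le> m" for p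
    proof -
      have i: "Suc m - p = Suc (m - p)" "n - int p = int (Suc (m - p))" "n - 1 - int p = int (m - p)"
        using p by (simp_all add: n of_nat_diff)
      show ?thesis unfolding i vert_def component_simps
        using cyc_d_in_Hom[of "m - p"] neg_in_Hom[OF cyc_d'_in_Hom[of "m - p"]]
          emb_neg[OF cyc_d'_in_Hom[of "m - p"]]
        by (simp add: CC_def hoch_obj_def emb_cyc_d emb_cyc_d' nat_add_distrib)
    qed
    have H: "Horiz ?K (Suc p) (Suc m - Suc p) \<in> Hom A (E (n - 1 - int p)) (E (n - 1 - int p)) \<and>
        em (Horiz ?K (Suc p) (Suc m - Suc p)) = horiz C p (n - 1 - int p)" if p: "p \<le> m" for p
    proof -
      have i: "Suc m - Suc p = m - p" "n - 1 - int p = int (m - p)"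
        using p by (simp_all add: n of_nat_diff)
      show ?thesis unfolding i horiz_def component_simps
        using one_minus_cyc_t_in_Hom[of "m - p"] cyc_N_in_Hom[of "m - p"]
        by (simp add: CC_def hoch_obj_def emb_one_minus_cyc_t emb_cyc_N)
    qed
    define f where "f p = tot_inj A ?K (n - 1) p \<cdot> Vert ?K p (Suc m - p) \<cdot> tot_prj A ?K n p" for p
    \<comment> \<open>Indexed by the target column, whereas \<open>tot_bd\<close> indexes the
      horizontal summands by their source column.\<close>
    define g where "g p = tot_inj A ?K (n - 1) p \<cdot> Horiz ?K (Suc p) (Suc m - Suc p) \<cdot> tot_prj A ?K n (Suc p)" for p
    have f: "f p \<in> Hom A (tot C n) (tot C (n - 1)) \<and>
        em (f p) = tinj C (n - 1) p * vert C p (n - int p) * tprj C n p" if p: "p \<le> m" for p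
    proof -
      have P: "tot_prj A ?K n p \<in> Hom A (tot C n) (E (n - int p))"
        "tot_inj A ?K (n - 1) p \<in> Hom A (E (n - 1 - int p)) (tot C (n - 1))"
        using tot_prj_in_Hom[of p n] tot_inj_in_Hom[of p "n - 1"] p by (simp_all add: sz)
      note v = V[OF p, THEN conjunct1]
      note vp = Comp_in_Hom[OF P(1) v]
      show ?thesis
        using Comp_in_Hom[OF vp P(2)] p
        unfolding f_def emb_Comp[OF vp P(2)] emb_Comp[OF P(1) v] V[OF p, THEN conjunct2]
        by (simp add: tinj_def tprj_def sz mult.assoc)
    qed
    have g: "g p \<in> Hom A (tot C n) (tot C (n - 1)) \<and>
        em (g p) = tinj C (n - 1) p * horiz C p (n - 1 - int p) * tprj C n (p + 1)" if p: "p \<le> m" for p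
    proof -
      have i: "n - int (Suc p) = n - 1 - int p" by simp
      have P: "tot_prj A ?K n (Suc p) \<in> Hom A (tot C n) (E (n - 1 - int p))"
        "tot_inj A ?K (n - 1) p \<in> Hom A (E (n - 1 - int p)) (tot C (n - 1))"
        using tot_prj_in_Hom[of "Suc p" n, unfolded i] tot_inj_in_Hom[of p "n - 1"] p by (simp_all add: sz)
      note h = H[OF p, THEN conjunct1]
      note hp = Comp_in_Hom[OF P(1) h]
      show ?thesis
        using Comp_in_Hom[OF hp P(2)] p
        unfolding g_def emb_Comp[OF hp P(2)] emb_Comp[OF P(1) h] H[OF p, THEN conjunct2]
        by (simp add: tinj_def tprj_def sz mult.assoc)
    qed
    let ?g = "\<lambda>p. tot_inj A ?K (n - 1) (p - 1) \<cdot> Horiz ?K p (nat n - p) \<cdot> tot_prj A ?K n p"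
    have g1: "?g p = g (p - 1)" "p - 1 \<le> m" if "p \<in> {1..Suc m}" for p
      using that by (auto simp: g_def sz simp del: diff_Suc_Suc)
    have s1: "arr_sum A (tot C n) (tot C (n - 1)) f {..<Suc m} \<in> Hom A (tot C n) (tot C (n - 1))"
      "em (arr_sum A (tot C n) (tot C (n - 1)) f {..<Suc m}) = (\<Sum>p<Suc m. em (f p))"
      using arr_sum_in_Hom_emb[OF tot_Obj tot_Obj, of "{..<Suc m}" f n "n - 1"] f by auto
    have gg: "?g p \<in> Hom A (tot C n) (tot C (n - 1))" if "p \<in> {1..Suc m}" for p
      unfolding g1(1)[OF that] using g[OF g1(2)[OF that]] by blast
    have s2: "arr_sum A (tot C n) (tot C (n - 1)) ?g {1..Suc m} \<in> Hom A (tot C n) (tot C (n - 1))"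
      "em (arr_sum A (tot C n) (tot C (n - 1)) ?g {1..Suc m}) = (\<Sum>p\<in>{1..Suc m}. em (?g p))"
      by (rule arr_sum_in_Hom[OF tot_Obj tot_Obj gg finite_atLeastAtMost], assumption)
        (rule emb_sum[OF tot_Obj tot_Obj gg finite_atLeastAtMost], assumption)
    have "(\<Sum>p\<in>{1..Suc m}. em (?g p)) = (\<Sum>p\<in>{1..Suc m}. em (g (p - 1)))"
      by (rule sum.cong[OF refl]) (simp only: g1)
    also have "\<dots> = (\<Sum>p<Suc m. em (g p))"
      by (rule sum.reindex_bij_witness[of _ Suc "\<lambda>p. p - 1"]) auto
    finally have "(\<Sum>p\<in>{1..Suc m}. em (?g p)) = (\<Sum>p<Suc m. em (g p))" .
    note s2 = s2(1) s2(2)[unfolded this]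
    have B: "Bd (Tot A ?K) n = arr_sum A (tot C n) (tot C (n - 1)) f {..<Suc m} \<boxplus>
        arr_sum A (tot C n) (tot C (n - 1)) ?g {1..Suc m}"
      using False by (simp add: Tot_def tot_bd_def sz f_def[abs_def])
    have "tbd C n = (\<Sum>p<Suc m. em (f p)) + (\<Sum>p<Suc m. em (g p))"
      unfolding tbd_def B emb_Plus[OF s1(1) s2(1)] s1(2) s2(2) ..
    also have "\<dots> = (\<Sum>p<Suc m. tinj C (n - 1) p *
        (vert C p (n - int p) * tprj C n p + horiz C p (n - 1 - int p) * tprj C n (p + 1)))"
      unfolding sum.distrib[symmetric]
      by (rule sum.cong[OF refl]) (use f g in \<open>simp add: distrib_left mult.assoc\<close>)
    finally have "tprj C (n - 1) q * tbd C n = (\<Sum>p<Suc m. (if p = q then idm (E (n - 1 - int p)) else 0) *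
        (vert C p (n - int p) * tprj C n p + horiz C p (n - 1 - int p) * tprj C n (p + 1)))"
      by (simp add: sum_distrib_left mult_left_assoc[OF tprj_tinj] del: sum.lessThan_Suc)
    also have "\<dots> = (if q \<le> m then idm (E (n - 1 - int q)) *
        (vert C q (n - int q) * tprj C n q + horiz C q (n - 1 - int q) * tprj C n (q + 1)) else 0)"
      by (simp add: if_distrib[of "\<lambda>x. x * _"] less_Suc_eq_le del: sum.lessThan_Suc cong: if_cong)
    also have "\<dots> = vert C q (n - int q) * tprj C n q + horiz C q (n - 1 - int q) * tprj C n (q + 1)"
    proof (cases "q \<le> m")
      case True
      then have P: "tprj C n q \<in> mor A (tot C n) (E (n - int q))"
        "tprj C n (q + 1) \<in> mor A (tot C n) (E (n - 1 - int q))"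
        using tprj_mor[of n q] tprj_mor[of n "q + 1"] by (simp_all add: algebra_simps)
      have VH: "vert C q (n - int q) \<in> mor A (E (n - int q)) (E (n - 1 - int q))"
        "horiz C q (n - 1 - int q) \<in> mor A (E (n - 1 - int q)) (E (n - 1 - int q))"
        using V[OF True] H[OF True] emb_mor by metis+
      show ?thesis using True idm_mor_left[OF mor_add[OF mor_mult[OF VH(1) P(1)] mor_mult[OF VH(2) P(2)]]]
        by simp
    next
      case False
      \<comment> \<open>Column \<open>m + 1\<close> is still present in degree \<open>n\<close>, but
        it holds \<open>C_0\<close> there and has no vertical differential; projections to later
        columns vanish.\<close>
      then have "n - int q \<le> 0 \<or> tprj C n q = 0" "tprj C n (q + 1) = 0"
        by (auto simp: tprj_def tot_size_def n)
      then show ?thesis using False by (auto simp: vert_def component_simps)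
    qed
    finally have "tprj C (n - 1) q * tbd C n =
      vert C q (n - int q) * tprj C n q + horiz C q (n - 1 - int q) * tprj C n (q + 1)" .
    then show ?thesis
      unfolding B using Plus_in_Hom[OF proper_objectsI[OF tot_Obj tot_Obj] s1(1) s2(1)] by blast
  qed
  then show "Bd (Tot A (CC A C)) n \<in> Hom A (tot C n) (tot C (n - 1))"
    "tprj C (n - 1) q * tbd C n =
      vert C q (n - int q) * tprj C n q + horiz C q (n - 1 - int q) * tprj C n (q + 1)" by auto
qed

lemma tbd_mor: "tbd C n \<in> mor A (tot C n) (tot C (n - 1))"
  unfolding tbd_def by (rule emb_mor[OF Bd_Tot_in_Hom])

lemma shift_mor: "shift C n \<in> mor A (tot C n) (tot C (n - 2))"
  unfolding shift_def
proof (intro mor_sum tot_Obj)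
  fix p
  have "n - int (p + 2) = n - 2 - int p" by simp
  then show "tinj C (n - 2) p * tprj C n (p + 2) \<in> mor A (tot C n) (tot C (n - 2))"
    using mor_mult[OF tinj_mor] tprj_mor[of n "p + 2"] by metis
qed

lemma unshift_mor: "unshift C n \<in> mor A (tot C (n - 2)) (tot C n)"
  unfolding unshift_def
proof (intro mor_sum tot_Obj)
  fix p
  have "n - int (p + 2) = n - 2 - int p" by simp
  then show "tinj C n (p + 2) * tprj C (n - 2) p \<in> mor A (tot C (n - 2)) (tot C n)"
    using mor_mult[OF tinj_mor[of n "p + 2"]] tprj_mor[of "n - 2" p] by metis
qed

lemma tprj_shift: "tprj C (n - 2) q * shift C n = tprj C n (q + 2)"
proof -
  have "n - int (q + 2) = n - 2 - int q" by simp
  then have P: "tprj C n (q + 2) \<in> mor A (tot C n) (E (n - 2 - int q))"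
    using tprj_mor[of n "q + 2"] by metis
  have "tprj C (n - 2) q * shift C n =
      (\<Sum>p<tot_size n. if p = q then idm (E (n - 2 - int p)) * tprj C n (p + 2) else 0)"
    unfolding shift_def sum_distrib_left
    by (rule sum.cong[OF refl]) (simp add: mult_left_assoc[OF tprj_tinj])
  also have "\<dots> = tprj C n (q + 2)"
    using idm_mor_left[OF P] by (auto simp: tprj_def)
  finally show ?thesis .
qed

lemma tprj_unshift: "tprj C n q * unshift C n = (if q < 2 then 0 else tprj C (n - 2) (q - 2))"
proof -
  have "tprj C n q * unshift C n =
      (\<Sum>p<tot_size n. if p + 2 = q then idm (E (n - 2 - int p)) * tprj C (n - 2) p else 0)"
    unfolding unshift_def sum_distrib_left
  proof (rule sum.cong[OF refl])
    fix p
    have "n - int (p + 2) = n - 2 - int p" by simp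
    then show "tprj C n q * (tinj C n (p + 2) * tprj C (n - 2) p) =
        (if p + 2 = q then idm (E (n - 2 - int p)) * tprj C (n - 2) p else 0)"
      unfolding mult_left_assoc[OF tprj_tinj] by (simp only:) simp
  qed
  also have "\<dots> = (\<Sum>p<tot_size n. if p + 2 = q then tprj C (n - 2) p else 0)"
    by (rule sum.cong[OF refl]) (simp add: idm_mor_left[OF tprj_mor])
  also have "\<dots> = (if q < 2 then 0 else tprj C (n - 2) (q - 2))"
  proof (cases "q < 2")
    case False
    then obtain r where q: "q = r + 2" by (metis add.commute le_Suc_ex not_less)
    show ?thesis unfolding q by (auto simp: tprj_def tot_size_def)
  qed auto
  finally show ?thesis .
qed

lemma tbd_tbd: "tbd C (n - 1) * tbd C n = 0"
proof (rule tot_eqI)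
  show "tbd C (n - 1) * tbd C n \<in> mor A (tot C n) (tot C (n - 2))"
    using mor_mult[OF tbd_mor[of "n - 1"] tbd_mor[of n]] by simp
  show "0 \<in> mor A (tot C n) (tot C (n - 2))" by (rule mor_0[OF tot_Obj tot_Obj])
  fix q
  have "tprj C (n - 2) q * (tbd C (n - 1) * tbd C n) =
      (vert C q (n - 1 - int q) * vert C q (n - int q)) * tprj C n q +
      (vert C q (n - 1 - int q) * horiz C q (n - 1 - int q) + 
       horiz C q (n - 2 - int q) * vert C (q + 1) (n - 1 - int q)) * tprj C n (q + 1) +
      (horiz C q (n - 2 - int q) * horiz C (q + 1) (n - 2 - int q)) * tprj C n (q + 2)"
    using tprj_tbd[of "n - 1" q] tprj_tbd[of n q] tprj_tbd[of n "q + 1"]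
    by (simp add: mult.assoc[symmetric] distrib_right)
      (simp add: mult.assoc distrib_left distrib_right algebra_simps)
  moreover have "vert C q (n - 1 - int q) * vert C q (n - int q) = 0"
    using hoch_bd_hoch_bd[of "n - int q"] bar_bd_bar_bd[of "n - int q"]
    by (simp add: vert_def algebra_simps)
  moreover have "horiz C q m * horiz C (q + 1) m = 0" for m
    by (simp add: horiz_def one_t_norm_t norm_t_one_t)
  moreover have "vert C q m * horiz C q m + horiz C q (m - 1) * vert C (q + 1) m = 0" for m
    using hoch_bd_one_t[of m] bar_bd_norm_t[of m] by (simp add: vert_def horiz_def)
  from this[of "n - 1 - int q"] have "vert C q (n - 1 - int q) * horiz C q (n - 1 - int q) + 
       horiz C q (n - 2 - int q) * vert C (q + 1) (n - 1 - int q) = 0"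
    by (simp add: algebra_simps)
  ultimately show "tprj C (n - 2) q * (tbd C (n - 1) * tbd C n) = tprj C (n - 2) q * 0" by simp
qed

text \<open>A move by two columns preserves the parity that decides which differential
  \<open>vert\<close> and \<open>horiz\<close> use.\<close>

lemma shift_tbd: "shift C (n - 1) * tbd C n = tbd C (n - 2) * shift C n"
proof (rule tot_eqI)
  show "shift C (n - 1) * tbd C n \<in> mor A (tot C n) (tot C (n - 3))"
    using mor_mult[OF shift_mor[of "n - 1"] tbd_mor[of n]] by simp
  show "tbd C (n - 2) * shift C n \<in> mor A (tot C n) (tot C (n - 3))"
    using mor_mult[OF tbd_mor[of "n - 2"] shift_mor[of n]] by simp
  fix q
  have "tprj C (n - 3) q * (shift C (n - 1) * tbd C n) = tprj C (n - 1) (q + 2) * tbd C n"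
    using tprj_shift[of "n - 1" q] by (simp add: mult.assoc[symmetric])
  also have "\<dots> = vert C q (n - 2 - int q) * tprj C n (q + 2) + horiz C q (n - 3 - int q) * tprj C n (q + 3)"
    using tprj_tbd[of n "q + 2"] by (simp add: vert_def horiz_def algebra_simps numeral_3_eq_3)
  also have "\<dots> = tprj C (n - 3) q * (tbd C (n - 2) * shift C n)"
    using tprj_tbd[of "n - 2" q] tprj_shift[of n q] tprj_shift[of n "q + 1"]
    by (simp add: mult.assoc[symmetric]) (simp add: distrib_right mult.assoc numeral_3_eq_3)
  finally show "tprj C (n - 3) q * (shift C (n - 1) * tbd C n) = tprj C (n - 3) q * (tbd C (n - 2) * shift C n)" .
qed

text \<open>No horizontal arrow leaves column \<open>0\<close>, so it is a subcomplex.\<close>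

lemma tbd_tinj_0: "tbd C n * tinj C n 0 = tinj C (n - 1) 0 * hoch_bd C n"
proof (rule tot_eqI)
  have I: "tinj C n 0 \<in> mor A (E n) (tot C n)" for n using tinj_mor[of n 0] by simp
  show "tbd C n * tinj C n 0 \<in> mor A (E n) (tot C (n - 1))" by (rule mor_mult[OF tbd_mor I])
  show "tinj C (n - 1) 0 * hoch_bd C n \<in> mor A (E n) (tot C (n - 1))" by (rule mor_mult[OF I hoch_bd_mor])
  fix q
  show "tprj C (n - 1) q * (tbd C n * tinj C n 0) = tprj C (n - 1) q * (tinj C (n - 1) 0 * hoch_bd C n)"
    using idm_mor_left[OF hoch_bd_mor[of n]] mor_idm[OF hoch_bd_mor[of n]]
    by (simp add: mult_left_assoc[OF tprj_tinj] mult_left_assoc[OF tprj_tbd] distrib_right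
      mult.assoc tprj_tinj vert_def)
qed

lemma tbd_tinj_1:
  "tbd C n * tinj C n 1 = tinj C (n - 1) 0 * one_t C (n - 1) - tinj C (n - 1) 1 * bar_bd C (n - 1)"
proof (rule tot_eqI)
  have I: "tinj C n 1 \<in> mor A (E (n - 1)) (tot C n)" "tinj C n 0 \<in> mor A (E n) (tot C n)" for n
    using tinj_mor[of n 1] tinj_mor[of n 0] by simp_all
  show "tbd C n * tinj C n 1 \<in> mor A (E (n - 1)) (tot C (n - 1))" by (rule mor_mult[OF tbd_mor I(1)])
  show "tinj C (n - 1) 0 * one_t C (n - 1) - tinj C (n - 1) 1 * bar_bd C (n - 1)
      \<in> mor A (E (n - 1)) (tot C (n - 1))"
    by (rule mor_diff[OF mor_mult[OF I(2) one_t_mor] mor_mult[OF I(1) bar_bd_mor]])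
  fix q
  show "tprj C (n - 1) q * (tbd C n * tinj C n 1) =
      tprj C (n - 1) q * (tinj C (n - 1) 0 * one_t C (n - 1) - tinj C (n - 1) 1 * bar_bd C (n - 1))"
    using idm_mor_left[OF bar_bd_mor[of "n - 1"]] mor_idm[OF bar_bd_mor[of "n - 1"]]
      idm_mor_left[OF one_t_mor[of "n - 1"]] mor_idm[OF one_t_mor[of "n - 1"]]
    by (cases q rule: nat_cases_2) (simp_all add: mult_left_assoc[OF tprj_tinj] mult_left_assoc[OF tprj_tbd] distrib_right
      right_diff_distrib left_diff_distrib mult.assoc tprj_tinj vert_def horiz_def)
qed

text \<open>The defect is the arrow \<open>N\<close> from column \<open>2\<close> to column
  \<open>1\<close>: column \<open>0\<close> of the argument is moved to column \<open>2\<close>,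
  where it acquires a horizontal differential that it did not have before.\<close>

lemma tbd_unshift:
  "tbd C n * unshift C n =
    unshift C (n - 1) * tbd C (n - 2) + tinj C (n - 1) 1 * norm_t C (n - 2) * tprj C (n - 2) 0"
proof (rule tot_eqI)
  show "tbd C n * unshift C n \<in> mor A (tot C (n - 2)) (tot C (n - 1))"
    by (rule mor_mult[OF tbd_mor unshift_mor])
  have I: "tinj C (n - 1) 1 \<in> mor A (E (n - 2)) (tot C (n - 1))"
    and P: "tprj C (n - 2) 0 \<in> mor A (tot C (n - 2)) (E (n - 2))"
    and b: "tbd C (n - 2) \<in> mor A (tot C (n - 2)) (tot C (n - 3))"
    and U: "unshift C (n - 1) \<in> mor A (tot C (n - 3)) (tot C (n - 1))"
    using tinj_mor[of "n - 1" 1] tprj_mor[of "n - 2" 0] tbd_mor[of "n - 2"] unshift_mor[of "n - 1"]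
    by simp_all
  show "unshift C (n - 1) * tbd C (n - 2) + tinj C (n - 1) 1 * norm_t C (n - 2) * tprj C (n - 2) 0
      \<in> mor A (tot C (n - 2)) (tot C (n - 1))"
    by (rule mor_add[OF mor_mult[OF U b] mor_mult[OF mor_mult[OF I norm_t_mor] P]])
  have N: "idm (E (n - 2)) * (norm_t C (n - 2) * tprj C (n - 2) 0) = norm_t C (n - 2) * tprj C (n - 2) 0"
    by (rule idm_mor_left[OF mor_mult[OF norm_t_mor P]])
  fix q :: nat
  consider "q = 0" | "q = 1" | r where "q = r + 2" by (rule nat_cases_2[of q])
  then show "tprj C (n - 1) q * (tbd C n * unshift C n) = tprj C (n - 1) q *
      (unshift C (n - 1) * tbd C (n - 2) + tinj C (n - 1) 1 * norm_t C (n - 2) * tprj C (n - 2) 0)"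
  proof cases
    case 1
    then show ?thesis
      by (simp add: distrib_left mult_left_assoc[OF tprj_tinj] mult_left_assoc[OF tprj_tbd]
        mult_left_assoc[OF tprj_unshift] distrib_right mult.assoc tprj_unshift)
  next
    case 2
    then show ?thesis using N
      by (simp add: distrib_left mult_left_assoc[OF tprj_tinj] mult_left_assoc[OF tprj_tbd]
        mult_left_assoc[OF tprj_unshift] distrib_right mult.assoc tprj_unshift horiz_def)
  next
    case 3
    have i: "n - int (r + 2) = n - 2 - int r" "n - 1 - int (r + 2) = n - 3 - int r"
      "vert C (r + 2) = vert C r" "horiz C (r + 2) = horiz C r"
      by (simp_all add: vert_def[abs_def] horiz_def[abs_def])
    from tprj_tbd[of n "r + 2"] have t: "tprj C (n - 1) (r + 2) * tbd C n =
      vert C r (n - 2 - int r) * tprj C n (r + 2) + horiz C r (n - 3 - int r) * tprj C n (r + 2 + 1)"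
      by (simp only: i)
    have "tprj C (n - 1) (r + 2) * (tbd C n * unshift C n) =
        vert C r (n - 2 - int r) * (tprj C n (r + 2) * unshift C n) +
        horiz C r (n - 3 - int r) * (tprj C n (r + 2 + 1) * unshift C n)"
      by (simp only: mult_left_assoc[OF t] distrib_right mult.assoc)
    also have "\<dots> = vert C r (n - 2 - int r) * tprj C (n - 2) r +
        horiz C r (n - 3 - int r) * tprj C (n - 2) (r + 1)"
      by (simp add: tprj_unshift)
    also have "\<dots> = tprj C (n - 3) r * tbd C (n - 2)"
      using tprj_tbd[of "n - 2" r] by simp
    also have "\<dots> = tprj C (n - 1) (r + 2) *
        (unshift C (n - 1) * tbd C (n - 2) + tinj C (n - 1) 1 * norm_t C (n - 2) * tprj C (n - 2) 0)"
      by (simp add: distrib_left mult_left_assoc[OF tprj_tinj] mult_left_assoc[OF tprj_unshift] mult.assoc)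
    finally show ?thesis unfolding 3 .
  qed
qed

lemma shift_tinj: "p < 2 \<Longrightarrow> shift C n * tinj C n p = 0"
proof (rule tot_eqI[OF mor_mult[OF shift_mor tinj_mor] mor_0[OF hoch_obj_Obj tot_Obj]])
  fix q assume "p < 2"
  then show "tprj C (n - 2) q * (shift C n * tinj C n p) = tprj C (n - 2) q * 0"
    by (simp add: mult_left_assoc[OF tprj_shift] tprj_tinj)
qed

lemma shift_unshift: "shift C n * unshift C n = idm (tot C (n - 2))"
proof (rule tot_eqI[OF mor_mult[OF shift_mor unshift_mor] idm_mor[OF tot_Obj]])
  fix q
  show "tprj C (n - 2) q * (shift C n * unshift C n) = tprj C (n - 2) q * idm (tot C (n - 2))"
    by (simp add: mult_left_assoc[OF tprj_shift] tprj_unshift mor_idm[OF tprj_mor])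
qed

lemma tot_decomposition:
  "tinj C n 0 * tprj C n 0 + tinj C n 1 * tprj C n 1 + unshift C n * shift C n = idm (tot C n)"
proof (rule tot_eqI[OF _ idm_mor[OF tot_Obj]])
  show "tinj C n 0 * tprj C n 0 + tinj C n 1 * tprj C n 1 + unshift C n * shift C n \<in> mor A (tot C n) (tot C n)"
    by (rule mor_add[OF mor_add[OF mor_mult[OF tinj_mor tprj_mor] mor_mult[OF tinj_mor tprj_mor]]
      mor_mult[OF unshift_mor shift_mor]])
  fix q :: nat
  consider "q = 0" | "q = 1" | r where "q = r + 2" by (rule nat_cases_2[of q])
  then show "tprj C n q * (tinj C n 0 * tprj C n 0 + tinj C n 1 * tprj C n 1 + unshift C n * shift C n) =
      tprj C n q * idm (tot C n)"
    using idm_mor_left[OF tprj_mor[of n 0]] idm_mor_left[OF tprj_mor[of n 1]]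
    by cases (simp_all add: distrib_left mult_left_assoc[OF tprj_tinj] mult_left_assoc[OF tprj_unshift]
      tprj_shift mor_idm[OF tprj_mor])
qed

end

section \<open>Exactness\<close>

context abelian_category
begin

text \<open>
  Connes' operator on total complexes: the boundary of the lift \<open>unshift\<close> lands in the second column,
  and \<open>htpy\<close> contracts that column to the first one.
\<close>

definition connes :: "('a, 'b) precyclic \<Rightarrow> int \<Rightarrow> ('a, 'b, 'c) arrow_ring"
  where "connes C n = one_t C (n - 1) * htpy C (n - 2) * norm_t C (n - 2) * tprj C (n - 2) 0"

definition incl_map :: "('a, 'b) precyclic \<Rightarrow> int \<Rightarrow> 'b"
  where "incl_map C n = hmap (hochschild A C) n (Tot A (CC A C)) n (tinj C n 0)"

definition shift_map :: "('a, 'b) precyclic \<Rightarrow> int \<Rightarrow> 'b"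
  where "shift_map C n = hmap (Tot A (CC A C)) n (Tot A (CC A C)) (n - 2) (shift C n)"

definition connes_map :: "('a, 'b) precyclic \<Rightarrow> int \<Rightarrow> 'b"
  where "connes_map C n = hmap (Tot A (CC A C)) (n - 2) (hochschild A C) (n - 1) (connes C n)"

end

context abelian_precyclic
begin

lemma Ch_simps: "Ch (hochschild A C) n = E n" "Ch (Tot A (CC A C)) n = tot C n"
  by (simp_all add: hochschild_def Tot_def)

lemma is_complex_hochschild: "is_complex (hochschild A C)"
  unfolding is_complex_def Ch_simps
  using Bd_hochschild_in_Hom hoch_bd_hoch_bd[of "n + 1" for n] by (simp add: hoch_bd_def)

lemma is_complex_Tot: "is_complex (Tot A (CC A C))"
  unfolding is_complex_def Ch_simps
  using Bd_Tot_in_Hom tbd_tbd[of "n + 1" for n] by (simp add: tbd_def)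

lemma tinj_0_mor: "tinj C n 0 \<in> mor A (E n) (tot C n)"
  using tinj_mor[of n 0] by simp

lemma tinj_1_mor: "tinj C n 1 \<in> mor A (E (n - 1)) (tot C n)"
  using tinj_mor[of n 1] by simp

lemma tprj_0_mor: "tprj C n 0 \<in> mor A (tot C n) (E n)"
  using tprj_mor[of n 0] by simp

lemma tprj_1_mor: "tprj C n 1 \<in> mor A (tot C n) (E (n - 1))"
  using tprj_mor[of n 1] by simp

lemma htpy_pred_mor: "htpy C (n - 1) \<in> mor A (E (n - 1)) (E n)"
  using htpy_mor[of "n - 1"] by simp

lemma connes_mor: "connes C n \<in> mor A (tot C (n - 2)) (E (n - 1))"
proof -
  have h: "htpy C (n - 2) \<in> mor A (E (n - 2)) (E (n - 1))"
    using htpy_mor[of "n - 2"] by simp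
  show ?thesis unfolding connes_def
    by (rule mor_mult[OF mor_mult[OF mor_mult[OF one_t_mor h] norm_t_mor] tprj_0_mor])
qed

section \<open>The identities evaluated on generalized elements\<close>

lemma bar_bd_htpy_app:
  assumes "x \<in> mor A W (E n)"
  shows "bar_bd C (n + 1) * (htpy C n * x) = x - htpy C (n - 1) * (bar_bd C n * x)"
proof -
  have "bar_bd C (n + 1) * (htpy C n * x) + htpy C (n - 1) * (bar_bd C n * x) = idm (E n) * x"
    unfolding bar_bd_htpy[symmetric] by (simp add: distrib_right mult.assoc)
  then show ?thesis unfolding idm_mor_left[OF assms] by (simp add: eq_diff_eq)
qed

lemma tprj_0_tbd_app:
  "tprj C (n - 1) 0 * (tbd C n * z) = hoch_bd C n * (tprj C n 0 * z) + one_t C (n - 1) * (tprj C n 1 * z)"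
  using tprj_tbd[of n 0] by (simp add: mult.assoc[symmetric] vert_def horiz_def distrib_right)

lemma tprj_1_tbd_app:
  "tprj C (n - 1) 1 * (tbd C n * z) =
    norm_t C (n - 2) * (tprj C (n - 2) 0 * (shift C n * z)) - bar_bd C (n - 1) * (tprj C n 1 * z)"
  using tprj_tbd[of n 1] tprj_shift[of n 0]
  by (simp add: mult.assoc[symmetric] vert_def horiz_def distrib_right)
    (simp add: mult.assoc left_diff_distrib numeral_2_eq_2)

lemma hoch_bd_one_t_app: "hoch_bd C n * (one_t C n * x) = one_t C (n - 1) * (bar_bd C n * x)"
  by (simp add: mult.assoc[symmetric] hoch_bd_one_t)

lemma bar_bd_norm_t_app: "bar_bd C n * (norm_t C n * x) = norm_t C (n - 1) * (hoch_bd C n * x)"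
  by (simp add: mult.assoc[symmetric] bar_bd_norm_t)

lemma one_t_norm_t_app: "one_t C n * (norm_t C n * x) = 0"
  by (simp add: mult.assoc[symmetric] one_t_norm_t)

lemma norm_t_one_t_app: "norm_t C n * (one_t C n * x) = 0"
  by (simp add: mult.assoc[symmetric] norm_t_one_t)

lemma connes_app:
  "connes C n * z = one_t C (n - 1) * (htpy C (n - 2) * (norm_t C (n - 2) * (tprj C (n - 2) 0 * z)))"
  by (simp add: connes_def mult.assoc)

lemma tbd_unshift_app:
  "tbd C n * (unshift C n * z) = unshift C (n - 1) * (tbd C (n - 2) * z) +
    tinj C (n - 1) 1 * (norm_t C (n - 2) * (tprj C (n - 2) 0 * z))"
  by (simp add: mult_left_assoc[OF tbd_unshift] distrib_right mult.assoc)

lemma tbd_tinj_1_app: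
  "tbd C n * (tinj C n 1 * x) =
    tinj C (n - 1) 0 * (one_t C (n - 1) * x) - tinj C (n - 1) 1 * (bar_bd C (n - 1) * x)"
  unfolding mult_left_assoc[OF tbd_tinj_1] left_diff_distrib mult.assoc ..

lemma shift_tinj_app: "p < 2 \<Longrightarrow> shift C n * (tinj C n p * x) = 0"
  by (simp add: mult.assoc[symmetric] shift_tinj)

text \<open>Moving \<open>\<partial>\<close> past \<open>1 - t\<close> turns it into
  \<open>\<partial>'\<close>, and \<open>\<partial>' \<eta> = 1 - \<eta> \<partial>'\<close> leaves
  two terms. The first dies by \<open>(1 - t) N = 0\<close>. The second contains
  \<open>\<partial>' N = N \<partial>\<close>, where \<open>\<partial>\<close> may be replaced by
  column \<open>0\<close> of the total differential because \<open>N (1 - t) = 0\<close>.\<close>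

lemma hoch_bd_connes: "hoch_bd C (n - 1) * connes C n = - (connes C (n - 1) * tbd C (n - 2))"
proof -
  define x where "x = norm_t C (n - 2) * tprj C (n - 2) 0"
  have x: "x \<in> mor A (tot C (n - 2)) (E (n - 2))"
    unfolding x_def by (rule mor_mult[OF norm_t_mor tprj_0_mor])
  have "tprj C (n - 3) 0 * tbd C (n - 2) =
      hoch_bd C (n - 2) * tprj C (n - 2) 0 + one_t C (n - 3) * tprj C (n - 2) 1"
    using tprj_0_tbd_app[of "n - 2" 1] by simp
  then have bx: "bar_bd C (n - 2) * x = norm_t C (n - 3) * (tprj C (n - 3) 0 * tbd C (n - 2))"
    using bar_bd_norm_t_app[of "n - 2" "tprj C (n - 2) 0"]
    by (simp add: x_def distrib_left norm_t_one_t_app)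
  have "hoch_bd C (n - 1) * connes C n = one_t C (n - 2) * (bar_bd C (n - 1) * (htpy C (n - 2) * x))"
    using hoch_bd_one_t_app[of "n - 1"] by (simp add: connes_def x_def mult.assoc)
  also have "bar_bd C (n - 1) * (htpy C (n - 2) * x) = x - htpy C (n - 3) * (bar_bd C (n - 2) * x)"
    using bar_bd_htpy_app[OF x] by simp
  also have "one_t C (n - 2) * \<dots> = - (connes C (n - 1) * tbd C (n - 2))"
    unfolding bx using one_t_norm_t_app[of "n - 2"]
    by (simp add: x_def right_diff_distrib connes_def mult.assoc)
  finally show ?thesis .
qed

lemma preserves_homology_tinj: "preserves_homology (hochschild A C) n (Tot A (CC A C)) n (tinj C n 0)"
  using tbd_tinj_0[of n] tbd_tinj_0[of "n + 1"] tinj_0_mor[of n] tinj_0_mor[of "n + 1"]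
  by (intro preserves_homologyI[OF is_complex_hochschild is_complex_Tot,
      where b = "tinj C (n + 1) 0" and c = "tinj C (n - 1) 0"])
    (simp_all add: Ch_simps hoch_bd_def tbd_def)

lemma preserves_homology_shift:
  "preserves_homology (Tot A (CC A C)) n (Tot A (CC A C)) (n - 2) (shift C n)"
  using shift_tbd[of n] shift_tbd[of "n + 1"] shift_mor[of n] shift_mor[of "n + 1"]
  by (intro preserves_homologyI[OF is_complex_Tot is_complex_Tot,
      where b = "shift C (n + 1)" and c = "shift C (n - 1)"])
    (simp_all add: Ch_simps tbd_def)

lemma preserves_homology_connes:
  "preserves_homology (Tot A (CC A C)) (n - 2) (hochschild A C) (n - 1) (connes C n)"
  using hoch_bd_connes[of n] hoch_bd_connes[of "n + 1"] connes_mor[of n] mor_minus[OF connes_mor[of "n + 1"]]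
  by (intro preserves_homologyI[OF is_complex_Tot is_complex_hochschild,
      where b = "- connes C (n + 1)" and c = "- connes C (n - 1)"])
    (simp_all add: Ch_simps tbd_def hoch_bd_def)

text \<open>The hypothesis says that column \<open>1\<close> of \<open>tbd C n * v\<close> vanishes,
  that is, \<open>N v_2 = \<partial>' v_1\<close>. Here \<open>\<eta> \<partial>'\<close> is the
  identity up to \<open>\<partial>' \<eta>\<close>, and \<open>1 - t\<close> carries this error to a
  \<open>\<partial>\<close>-boundary. So \<open>connes\<close> after \<open>shift\<close> is
  \<open>1 - t\<close> on column \<open>1\<close>, up to a boundary.\<close>

lemma connes_shift:
  assumes v: "v \<in> mor A W (tot C n)"
    and "bar_bd C (n - 1) * (tprj C n 1 * v) = norm_t C (n - 2) * (tprj C (n - 2) 0 * (shift C n * v))"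
  shows "connes C n * (shift C n * v) = one_t C (n - 1) * (tprj C n 1 * v) -
    hoch_bd C n * (one_t C n * (htpy C (n - 1) * (tprj C n 1 * v)))"
proof -
  define y where "y = tprj C n 1 * v"
  have y: "y \<in> mor A W (E (n - 1))" unfolding y_def by (rule mor_mult[OF tprj_1_mor v])
  have "connes C n * (shift C n * v) = one_t C (n - 1) * (htpy C (n - 2) * (bar_bd C (n - 1) * y))"
    unfolding connes_app y_def assms(2) ..
  also have "htpy C (n - 2) * (bar_bd C (n - 1) * y) = y - bar_bd C n * (htpy C (n - 1) * y)"
    using bar_bd_htpy_app[OF y] by simp
  finally show ?thesis by (simp add: y_def right_diff_distrib hoch_bd_one_t_app)
qed

text \<open>The boundary of \<open>unshift C n * z\<close> is \<open>N z_0\<close> in column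
  \<open>1\<close>. This is a \<open>\<partial>'\<close>-cycle, as
  \<open>\<partial>' N z_0 = N \<partial> z_0 = - N (1 - t) z_1 = 0\<close>, so
  \<open>\<partial>' \<eta> N z_0 = N z_0\<close>. Adding \<open>\<eta> N z_0\<close> in column
  \<open>1\<close> therefore pushes the boundary into column \<open>0\<close>, which exhibits
  \<open>connes\<close> as the connecting map.\<close>

lemma tbd_lift:
  assumes z: "z \<in> mor A W (tot C (n - 2))" and dz: "tbd C (n - 2) * z = 0"
  shows "tbd C n * (unshift C n * z +
      tinj C n 1 * (htpy C (n - 2) * (norm_t C (n - 2) * (tprj C (n - 2) 0 * z)))) =
    tinj C (n - 1) 0 * (connes C n * z)"
proof -
  define x where "x = tprj C (n - 2) 0 * z"
  define y where "y = norm_t C (n - 2) * x"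
  have y: "y \<in> mor A W (E (n - 2))"
    unfolding y_def x_def by (rule mor_mult[OF norm_t_mor mor_mult[OF tprj_0_mor z]])
  have "hoch_bd C (n - 2) * x = - (one_t C (n - 3) * (tprj C (n - 2) 1 * z))"
    using tprj_0_tbd_app[of "n - 2" z] dz by (simp add: x_def eq_neg_iff_add_eq_0)
  then have "bar_bd C (n - 2) * y = 0"
    using bar_bd_norm_t_app[of "n - 2" x] by (simp add: y_def norm_t_one_t_app)
  then have "bar_bd C (n - 1) * (htpy C (n - 2) * y) = y"
    using bar_bd_htpy_app[OF y] by simp
  then show ?thesis
    unfolding distrib_left tbd_unshift_app tbd_tinj_1_app dz connes_app x_def[symmetric] y_def[symmetric]
    by simp
qed

section \<open>The three exactness statements\<close>

lemma exact_incl_shift: "exact_at A (incl_map C n) (shift_map C n)"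
  unfolding incl_map_def shift_map_def
proof (rule exact_hmap[OF preserves_homology_tinj preserves_homology_shift],
    unfold Ch_simps hoch_bd_def[symmetric] tbd_def[symmetric])
  fix W z
  assume z: "z \<in> mor A W (E n)"
  show "\<exists>y\<in>mor A W (tot C (n - 2 + 1)). shift C n * tinj C n 0 * z = tbd C (n - 2 + 1) * y"
    using mor_0[OF mor_Obj(1)[OF z] tot_Obj] shift_tinj[of 0 n] by (intro bexI[of _ 0]) simp_all
next
  fix W z v
  assume z: "z \<in> mor A W (tot C n)" and dz: "tbd C n * z = 0"
    and "v \<in> mor A W (tot C (n - 2 + 1))" and "shift C n * z = tbd C (n - 2 + 1) * v"
  then have v: "v \<in> mor A W (tot C (n - 1))" and eq: "shift C n * z = tbd C (n - 1) * v"
    by simp_all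
  \<comment> \<open>Subtracting the boundary of \<open>unshift C (n + 1) * v\<close> from
    \<open>z\<close> clears the columns from \<open>2\<close> on and leaves \<open>y\<close> in
    column \<open>1\<close>. As \<open>y\<close> is a \<open>\<partial>'\<close>-cycle,
    \<open>\<eta> y\<close> bounds it; removing it by the second term of \<open>u\<close> moves the
    rest into column \<open>0\<close>, where it is \<open>x\<close>.\<close>
  define y where "y = tprj C n 1 * z - norm_t C (n - 1) * (tprj C (n - 1) 0 * v)"
  define x where "x = tprj C n 0 * z + one_t C n * (htpy C (n - 1) * y)"
  define u where "u = unshift C (n + 1) * v - tinj C (n + 1) 1 * (htpy C (n - 1) * y)"
  have yM: "y \<in> mor A W (E (n - 1))"
    unfolding y_def
    by (rule mor_diff[OF mor_mult[OF tprj_1_mor z] mor_mult[OF norm_t_mor mor_mult[OF tprj_0_mor v]]])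
  have hy: "htpy C (n - 1) * y \<in> mor A W (E n)" by (rule mor_mult[OF htpy_pred_mor yM])
  have "bar_bd C (n - 1) * (tprj C n 1 * z) = norm_t C (n - 2) * (tprj C (n - 2) 0 * (tbd C (n - 1) * v))"
    using tprj_1_tbd_app[of n z] dz eq by simp
  also have "\<dots> = bar_bd C (n - 1) * (norm_t C (n - 1) * (tprj C (n - 1) 0 * v))"
    using tprj_0_tbd_app[of "n - 1" v] bar_bd_norm_t_app[of "n - 1"]
    by (simp add: distrib_left norm_t_one_t_app)
  finally have "bar_bd C (n - 1) * y = 0" by (simp add: y_def right_diff_distrib)
  then have bhy: "bar_bd C n * (htpy C (n - 1) * y) = y"
    using bar_bd_htpy_app[OF yM] by simp
  have xM: "x \<in> mor A W (E n)"
    unfolding x_def by (rule mor_add[OF mor_mult[OF tprj_0_mor z] mor_mult[OF one_t_mor hy]])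
  have U: "unshift C (n + 1) \<in> mor A (tot C (n - 1)) (tot C (n + 1))"
    and I: "tinj C (n + 1) 1 \<in> mor A (E n) (tot C (n + 1))"
    using unshift_mor[of "n + 1"] tinj_1_mor[of "n + 1"] by simp_all
  have uM: "u \<in> mor A W (tot C (n + 1))"
    unfolding u_def by (rule mor_diff[OF mor_mult[OF U v] mor_mult[OF I hy]])
  have "hoch_bd C n * x = hoch_bd C n * (tprj C n 0 * z) + one_t C (n - 1) * y"
    unfolding x_def distrib_left hoch_bd_one_t_app bhy ..
  also have "\<dots> = hoch_bd C n * (tprj C n 0 * z) + one_t C (n - 1) * (tprj C n 1 * z)"
    by (simp add: y_def right_diff_distrib one_t_norm_t_app)
  also have "\<dots> = 0" unfolding tprj_0_tbd_app[symmetric] dz by simp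
  finally have dx: "hoch_bd C n * x = 0" .
  have "tbd C (n + 1) * u = unshift C n * (shift C n * z) + tinj C n 1 * (norm_t C (n - 1) * (tprj C (n - 1) 0 * v))
      - (tinj C n 0 * (one_t C n * (htpy C (n - 1) * y)) - tinj C n 1 * y)"
    unfolding u_def right_diff_distrib using tbd_unshift_app[of "n + 1" v]
      tbd_tinj_1_app[of "n + 1" "htpy C (n - 1) * y"] eq bhy by simp
  then have "tinj C n 0 * x + tbd C (n + 1) * u =
      tinj C n 0 * (tprj C n 0 * z) + tinj C n 1 * (tprj C n 1 * z) + unshift C n * (shift C n * z)"
    by (simp add: x_def y_def distrib_left right_diff_distrib)
  also have "\<dots> = idm (tot C n) * z"
    unfolding tot_decomposition[symmetric] by (simp add: distrib_right mult.assoc)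
  finally have "z = tinj C n 0 * x + tbd C (n + 1) * u"
    unfolding idm_mor_left[OF z] by simp
  then show "\<exists>x\<in>mor A W (E n). \<exists>y\<in>mor A W (tot C (n + 1)).
      hoch_bd C n * x = 0 \<and> z = tinj C n 0 * x + tbd C (n + 1) * y"
    using dx xM uM by blast
qed

lemma exact_shift_connes: "exact_at A (shift_map C n) (connes_map C n)"
  unfolding connes_map_def shift_map_def
proof (rule exact_hmap[OF preserves_homology_shift preserves_homology_connes],
    unfold Ch_simps hoch_bd_def[symmetric] tbd_def[symmetric])
  fix W z
  assume z: "z \<in> mor A W (tot C n)" and dz: "tbd C n * z = 0"
  \<comment> \<open>\<open>connes_shift\<close> gives \<open>(1 - t) z_1\<close> minus the boundary
    of \<open>(1 - t) \<eta> z_1\<close>, and column \<open>0\<close> of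
    \<open>tbd C n * z = 0\<close> turns \<open>(1 - t) z_1\<close> into
    \<open>- \<partial> z_0\<close>.\<close>
  define y where "y = - (tprj C n 0 * z + one_t C n * (htpy C (n - 1) * (tprj C n 1 * z)))"
  have y: "y \<in> mor A W (E n)"
    unfolding y_def
    by (rule mor_minus[OF mor_add[OF mor_mult[OF tprj_0_mor z]
      mor_mult[OF one_t_mor mor_mult[OF htpy_pred_mor mor_mult[OF tprj_1_mor z]]]]])
  have "bar_bd C (n - 1) * (tprj C n 1 * z) = norm_t C (n - 2) * (tprj C (n - 2) 0 * (shift C n * z))"
    using tprj_1_tbd_app[of n z] dz by simp
  note connes_shift[OF z this]
  moreover have "one_t C (n - 1) * (tprj C n 1 * z) = - (hoch_bd C n * (tprj C n 0 * z))"
    using tprj_0_tbd_app[of n z] dz by (simp add: eq_neg_iff_add_eq_0 add.commute)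
  ultimately have "connes C n * shift C n * z = hoch_bd C n * y"
    by (simp add: y_def distrib_left right_diff_distrib mult.assoc)
  then show "\<exists>y\<in>mor A W (E (n - 1 + 1)). connes C n * shift C n * z = hoch_bd C (n - 1 + 1) * y"
    using y by auto
next
  fix W z v
  assume z: "z \<in> mor A W (tot C (n - 2))" and dz: "tbd C (n - 2) * z = 0"
    and "v \<in> mor A W (E (n - 1 + 1))" and "connes C n * z = hoch_bd C (n - 1 + 1) * v"
  then have v: "v \<in> mor A W (E n)" and eq: "connes C n * z = hoch_bd C n * v" by simp_all
  define h where "h = htpy C (n - 2) * (norm_t C (n - 2) * (tprj C (n - 2) 0 * z))"
  have "htpy C (n - 2) \<in> mor A (E (n - 2)) (E (n - 1))" using htpy_mor[of "n - 2"] by simp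
  then have h: "h \<in> mor A W (E (n - 1))"
    unfolding h_def by (rule mor_mult[OF _ mor_mult[OF norm_t_mor mor_mult[OF tprj_0_mor z]]])
  \<comment> \<open>By \<open>tbd_lift\<close> the first two terms have boundary
    \<open>connes C n * z\<close> in column \<open>0\<close>, which is also the boundary of
    \<open>v\<close> placed there; subtracting \<open>v\<close> gives a cycle. \<open>shift\<close>
    recovers \<open>z\<close> from it exactly, so the boundary term is \<open>0\<close>.\<close>
  define x where "x = unshift C n * z + tinj C n 1 * h - tinj C n 0 * v"
  have x: "x \<in> mor A W (tot C n)"
    unfolding x_def by (rule mor_diff[OF mor_add[OF mor_mult[OF unshift_mor z] mor_mult[OF tinj_1_mor h]]
      mor_mult[OF tinj_0_mor v]])
  have dx: "tbd C n * x = 0"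
    unfolding x_def right_diff_distrib h_def tbd_lift[OF z dz] eq
    by (simp add: mult_left_assoc[OF tbd_tinj_0] mult.assoc)
  have "shift C n * x = z"
    using idm_mor_left[OF z]
    by (simp add: x_def distrib_left right_diff_distrib shift_tinj_app mult_left_assoc[OF shift_unshift])
  then show "\<exists>x\<in>mor A W (tot C n). \<exists>y\<in>mor A W (tot C (n - 2 + 1)).
      tbd C n * x = 0 \<and> z = shift C n * x + tbd C (n - 2 + 1) * y"
    using x dx mor_0[OF mor_Obj(1)[OF z] tot_Obj] by (intro bexI[of _ x] bexI[of _ 0]) simp_all
qed

lemma exact_connes_incl: "exact_at A (connes_map C n) (incl_map C (n - 1))"
  unfolding connes_map_def incl_map_def
proof (rule exact_hmap[OF preserves_homology_connes preserves_homology_tinj],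
    unfold Ch_simps hoch_bd_def[symmetric] tbd_def[symmetric])
  fix W z
  assume z: "z \<in> mor A W (tot C (n - 2))" and dz: "tbd C (n - 2) * z = 0"
  define h where "h = htpy C (n - 2) * (norm_t C (n - 2) * (tprj C (n - 2) 0 * z))"
  have "htpy C (n - 2) \<in> mor A (E (n - 2)) (E (n - 1))" using htpy_mor[of "n - 2"] by simp
  then have h: "h \<in> mor A W (E (n - 1))"
    unfolding h_def by (rule mor_mult[OF _ mor_mult[OF norm_t_mor mor_mult[OF tprj_0_mor z]]])
  \<comment> \<open>This is the lift from \<open>tbd_lift\<close>; it bounds the inclusion of
    \<open>connes C n * z\<close>.\<close>
  have "unshift C n * z + tinj C n 1 * h \<in> mor A W (tot C n)"
    by (rule mor_add[OF mor_mult[OF unshift_mor z] mor_mult[OF tinj_1_mor h]])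
  then show "\<exists>y\<in>mor A W (tot C (n - 1 + 1)). tinj C (n - 1) 0 * connes C n * z = tbd C (n - 1 + 1) * y"
    using tbd_lift[OF z dz] unfolding h_def by (auto simp: mult.assoc intro!: bexI)
next
  fix W z v
  assume z: "z \<in> mor A W (E (n - 1))" and dz: "hoch_bd C (n - 1) * z = 0"
    and "v \<in> mor A W (tot C (n - 1 + 1))" and "tinj C (n - 1) 0 * z = tbd C (n - 1 + 1) * v"
  then have v: "v \<in> mor A W (tot C n)" and eq: "tinj C (n - 1) 0 * z = tbd C n * v" by simp_all
  \<comment> \<open>The preimage of \<open>z\<close> will be \<open>shift C n * v\<close>. It is a
    cycle because its boundary is the shift of \<open>tbd C n * v\<close>, which lies in column
    \<open>0\<close>.\<close>
  have dsv: "tbd C (n - 2) * (shift C n * v) = 0"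
    unfolding mult.assoc[symmetric] shift_tbd[symmetric]
    by (simp add: mult.assoc eq[symmetric] shift_tinj_app)
  have "z = tprj C (n - 1) 0 * (tinj C (n - 1) 0 * z)" "tprj C (n - 1) 1 * (tinj C (n - 1) 0 * z) = 0"
    using idm_mor_left[OF z] by (simp_all add: mult_left_assoc[OF tprj_tinj])
  then have z_eq: "z = hoch_bd C n * (tprj C n 0 * v) + one_t C (n - 1) * (tprj C n 1 * v)"
    and "norm_t C (n - 2) * (tprj C (n - 2) 0 * (shift C n * v)) - bar_bd C (n - 1) * (tprj C n 1 * v) = 0"
    unfolding eq tprj_0_tbd_app tprj_1_tbd_app by simp_all
  then have "bar_bd C (n - 1) * (tprj C n 1 * v) = norm_t C (n - 2) * (tprj C (n - 2) 0 * (shift C n * v))"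
    by simp
  note B = connes_shift[OF v this]
  \<comment> \<open>Column \<open>0\<close> of the equation for \<open>v\<close> reads
    \<open>z = \<partial> v_0 + (1 - t) v_1\<close>; by \<open>connes_shift\<close>,
    \<open>(1 - t) v_1\<close> is \<open>connes\<close> of the shift plus the boundary of
    \<open>(1 - t) \<eta> v_1\<close>.\<close>
  define y where "y = tprj C n 0 * v + one_t C n * (htpy C (n - 1) * (tprj C n 1 * v))"
  have y: "y \<in> mor A W (E n)"
    unfolding y_def by (rule mor_add[OF mor_mult[OF tprj_0_mor v]
      mor_mult[OF one_t_mor mor_mult[OF htpy_pred_mor mor_mult[OF tprj_1_mor v]]]])
  have "z = connes C n * (shift C n * v) + hoch_bd C n * y"
    unfolding B y_def by (subst z_eq) (simp add: distrib_left)
  then show "\<exists>x\<in>mor A W (tot C (n - 2)). \<exists>y\<in>mor A W (E (n - 1 + 1)).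
      tbd C (n - 2) * x = 0 \<and> z = connes C n * x + hoch_bd C (n - 1 + 1) * y"
    using dsv y mor_mult[OF shift_mor v] by (intro bexI[of _ "shift C n * v"] bexI[of _ y]) simp_all
qed

end

section \<open>Naturality\<close>

locale abelian_precyclic_morphism = abelian_category A + precyclic_morphism A C C' \<phi>
  for A :: "('o, 'm, 'z) preadditive_scheme" (structure) and C C' \<phi>
begin

sublocale src: abelian_precyclic A C ..
sublocale tgt: abelian_precyclic A C' ..

definition phi :: "int \<Rightarrow> ('o, 'm, 'z) arrow_ring"
  where "phi n = em (hoch_map A \<phi> n)"

definition tot_phi :: "int \<Rightarrow> ('o, 'm, 'z) arrow_ring"
  where "tot_phi n = em (tot_map A (CC A C) (CC A C') (\<lambda>p m. \<phi> m) n)"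

lemma hoch_map_in_Hom: "hoch_map A \<phi> n \<in> Hom A (src.E n) (tgt.E n)"
  using in_Hom by (simp add: hoch_map_def hoch_obj_def Zero_in_Hom proper_objectsI zero_object_Obj)

lemma phi_mor: "phi n \<in> mor A (src.E n) (tgt.E n)"
  unfolding phi_def by (rule emb_mor[OF hoch_map_in_Hom])

lemma phi_simps: "n < 0 \<Longrightarrow> phi n = 0" "phi (int m) = em (\<phi> m)"
  by (simp_all add: phi_def hoch_map_def emb_Zero zero_object_Obj)

section \<open>Morphisms commute with the components of the bicomplex\<close>

lemma \<phi>_e: "em (\<phi> n) * src.e n = em (\<phi> n)" "tgt.e n * em (\<phi> n) = em (\<phi> n)"
  by (rule mor_idm[OF emb_mor[OF in_Hom]], rule idm_mor_left[OF emb_mor[OF in_Hom]])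

lemma \<phi>_\<delta>: "i \<le> Suc n \<Longrightarrow> em (\<phi> n) * src.\<delta> (Suc n) i = tgt.\<delta> (Suc n) i * em (\<phi> (Suc n))"
  using commutes_face[of "Suc n" i] emb_Comp[OF src.face_Suc_in_Hom in_Hom, of i n]
    emb_Comp[OF in_Hom tgt.face_Suc_in_Hom, of i n]
  by (simp add: minus_one_power_iff)

lemma \<phi>_\<tau>: "em (\<phi> n) * src.\<tau> n = tgt.\<tau> n * em (\<phi> n)"
  using commutes_rot[of n] emb_Comp[OF source.rot_in_Hom in_Hom, of n]
    emb_Comp[OF in_Hom target.rot_in_Hom, of n]
  by (simp add: minus_one_power_iff)

lemma \<phi>_\<eta>: "em (\<phi> (Suc n)) * src.\<eta> n = tgt.\<eta> n * em (\<phi> n)"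
  using commutes_degen[of n] emb_Comp[OF src.degen_Suc_in_Hom in_Hom, of n]
    emb_Comp[OF in_Hom tgt.degen_Suc_in_Hom, of n]
  by (simp add: minus_one_power_iff)

lemma \<phi>_\<tau>_pow: "em (\<phi> n) * src.\<tau> n ^ k = tgt.\<tau> n ^ k * em (\<phi> n)"
proof (induction k)
  case (Suc k)
  have "em (\<phi> n) * src.\<tau> n ^ Suc k = em (\<phi> n) * src.\<tau> n * src.\<tau> n ^ k"
    by (simp only: power_Suc mult.assoc)
  also have "\<dots> = tgt.\<tau> n * (em (\<phi> n) * src.\<tau> n ^ k)"
    unfolding \<phi>_\<tau> by (simp only: mult.assoc)
  finally show ?case unfolding Suc by (simp only: power_Suc mult.assoc)
qed simp

lemma phi_hoch_bd: "phi (n - 1) * hoch_bd C n = hoch_bd C' n * phi n"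
proof (cases n rule: nonneg_int_cases')
  case (3 m)
  then have i: "n - 1 = int m" by simp
  show ?thesis
    unfolding i unfolding 3 src.component_simps tgt.component_simps phi_simps
    by (simp add: src.signed.b_def tgt.signed.b_def sum_distrib_left sum_distrib_right \<phi>_\<delta> del: sum.atMost_Suc)
qed (simp_all add: src.component_simps tgt.component_simps)

lemma phi_bar_bd: "phi (n - 1) * bar_bd C n = bar_bd C' n * phi n"
proof (cases n rule: nonneg_int_cases')
  case (3 m)
  then have i: "n - 1 = int m" by simp
  show ?thesis
    unfolding i unfolding 3 src.component_simps tgt.component_simps phi_simps
    by (simp add: src.signed.b'_def tgt.signed.b'_def sum_distrib_left sum_distrib_right \<phi>_\<delta> del: sum.lessThan_Suc)
qed (simp_all add: src.component_simps tgt.component_simps)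

lemma nonneg_int_eq: "\<not> n < 0 \<Longrightarrow> \<exists>m. n = int m"
  by (rule exI[of _ "nat n"]) simp

lemma phi_one_t: "phi n * one_t C n = one_t C' n * phi n"
proof (cases "n < 0")
  case False
  then obtain m where m: "n = int m" using nonneg_int_eq by blast
  show ?thesis unfolding m src.component_simps tgt.component_simps phi_simps
      right_diff_distrib left_diff_distrib \<phi>_\<tau> \<phi>_e ..
qed (simp add: src.component_simps tgt.component_simps)

lemma phi_norm_t: "phi n * norm_t C n = norm_t C' n * phi n"
proof (cases "n < 0")
  case False
  then obtain m where m: "n = int m" using nonneg_int_eq by blast
  show ?thesis unfolding m src.component_simps tgt.component_simps phi_simps
      src.signed.N_def tgt.signed.N_def sum_distrib_left sum_distrib_right
    by (simp only: mult.assoc mult_left_assoc[OF \<phi>_\<tau>_pow] \<phi>_e)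
qed (simp add: src.component_simps tgt.component_simps)

text \<open>Compatibility with the last degeneracy enters here, and through \<open>htpy\<close> it
  yields the naturality of \<open>connes\<close>.\<close>

lemma phi_htpy: "phi (n + 1) * htpy C n = htpy C' n * phi n"
proof (cases "n < 0")
  case False
  then obtain m where m: "n = int m" using nonneg_int_eq by blast
  have "n + 1 = int (Suc m)" by (simp add: m)
  then show ?thesis unfolding m src.component_simps tgt.component_simps phi_simps
    by (simp only: phi_simps \<phi>_\<eta>)
qed (simp add: src.component_simps tgt.component_simps)

lemma tot_map_in_Hom: "tot_map A (CC A C) (CC A C') (\<lambda>p m. \<phi> m) n \<in> Hom A (tot C n) (tot C' n)"
  and tprj_tot_phi: "tprj C' n q * tot_phi n = phi (n - int q) * tprj C n q"
proof -
  define f where "f p = tot_inj A (CC A C') n p \<cdot> \<phi> (nat n - p) \<cdot> tot_prj A (CC A C) n p" for p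
  have f: "f p \<in> Hom A (tot C n) (tot C' n) \<and>
      em (f p) = tinj C' n p * (phi (n - int p) * tprj C n p)" if p: "p < tot_size n" for p
  proof -
    have i: "n - int p = int (nat n - p)" using p by (auto simp: tot_size_def)
    note P = src.tot_prj_in_Hom[OF p] and I = tgt.tot_inj_in_Hom[OF p]
    have ph: "\<phi> (nat n - p) \<in> Hom A (src.E (n - int p)) (tgt.E (n - int p))"
      unfolding i using in_Hom by (simp add: hoch_obj_def)
    note c = Comp_in_Hom[OF P ph]
    show ?thesis
      using Comp_in_Hom[OF c I] p
      unfolding f_def emb_Comp[OF c I] emb_Comp[OF P ph]
      unfolding i phi_simps by (simp add: tinj_def tprj_def)
  qed
  have t: "tot_map A (CC A C) (CC A C') (\<lambda>p m. \<phi> m) n =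
      arr_sum A (tot C n) (tot C' n) f {..<tot_size n}"
    by (simp add: tot_map_def f_def[abs_def])
  have fH: "f p \<in> Hom A (tot C n) (tot C' n)" if "p \<in> {..<tot_size n}" for p
    using f that by blast
  show "tot_map A (CC A C) (CC A C') (\<lambda>p m. \<phi> m) n \<in> Hom A (tot C n) (tot C' n)"
    unfolding t by (rule arr_sum_in_Hom[OF src.tot_Obj tgt.tot_Obj fH finite_lessThan])
  have "tot_phi n = (\<Sum>p<tot_size n. em (f p))"
    unfolding tot_phi_def t by (rule emb_sum[OF src.tot_Obj tgt.tot_Obj fH finite_lessThan])
  then have "tprj C' n q * tot_phi n = (\<Sum>p<tot_size n. tprj C' n q * (tinj C' n p * (phi (n - int p) * tprj C n p)))"
    by (simp add: sum_distrib_left f)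
  also have "\<dots> = (\<Sum>p<tot_size n. if p = q then phi (n - int p) * tprj C n p else 0)"
    by (rule sum.cong[OF refl])
      (simp add: mult_left_assoc[OF tgt.tprj_tinj] idm_mor_left[OF mor_mult[OF phi_mor src.tprj_mor]])
  also have "\<dots> = phi (n - int q) * tprj C n q"
    by (simp add: tprj_def)
  finally show "tprj C' n q * tot_phi n = phi (n - int q) * tprj C n q" .
qed

lemma tot_phi_mor: "tot_phi n \<in> mor A (tot C n) (tot C' n)"
  unfolding tot_phi_def by (rule emb_mor[OF tot_map_in_Hom])

lemma tot_phi_tbd: "tot_phi (n - 1) * tbd C n = tbd C' n * tot_phi n"
proof (rule tgt.tot_eqI[OF mor_mult[OF tot_phi_mor src.tbd_mor] mor_mult[OF tgt.tbd_mor tot_phi_mor]])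
  fix q
  have v: "phi (n - 1 - int q) * vert C q (n - int q) = vert C' q (n - int q) * phi (n - int q)"
    using phi_hoch_bd[of "n - int q"] phi_bar_bd[of "n - int q"]
    by (simp add: vert_def algebra_simps)
  have h: "phi m * horiz C q m = horiz C' q m * phi m" for m
    by (simp add: horiz_def phi_one_t phi_norm_t)
  have i: "n - 1 - int q = n - int (q + 1)" by simp
  have "tprj C' (n - 1) q * (tot_phi (n - 1) * tbd C n) =
      phi (n - 1 - int q) * (tprj C (n - 1) q * tbd C n)"
    by (simp only: mult_left_assoc[OF tprj_tot_phi] mult.assoc)
  also have "\<dots> = vert C' q (n - int q) * (phi (n - int q) * tprj C n q) +
      horiz C' q (n - 1 - int q) * (phi (n - 1 - int q) * tprj C n (q + 1))"
    unfolding src.tprj_tbd distrib_left mult_left_assoc[OF v] mult_left_assoc[OF h] by (simp only: mult.assoc)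
  also have "\<dots> = vert C' q (n - int q) * (tprj C' n q * tot_phi n) +
      horiz C' q (n - 1 - int q) * (tprj C' n (q + 1) * tot_phi n)"
    unfolding tprj_tot_phi unfolding i ..
  also have "\<dots> = tprj C' (n - 1) q * (tbd C' n * tot_phi n)"
    by (simp only: mult_left_assoc[OF tgt.tprj_tbd] distrib_right mult.assoc)
  finally show "tprj C' (n - 1) q * (tot_phi (n - 1) * tbd C n) = tprj C' (n - 1) q * (tbd C' n * tot_phi n)" .
qed

lemma tot_phi_tinj_0: "tot_phi n * tinj C n 0 = tinj C' n 0 * phi n"
proof (rule tgt.tot_eqI[OF mor_mult[OF tot_phi_mor src.tinj_0_mor] mor_mult[OF tgt.tinj_0_mor phi_mor]])
  fix q
  show "tprj C' n q * (tot_phi n * tinj C n 0) = tprj C' n q * (tinj C' n 0 * phi n)"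
    unfolding mult_left_assoc[OF tprj_tot_phi] mult_left_assoc[OF tgt.tprj_tinj] mult.assoc src.tprj_tinj
    using mor_idm[OF phi_mor] idm_mor_left[OF phi_mor] by simp
qed

lemma tot_phi_shift: "tot_phi (n - 2) * shift C n = shift C' n * tot_phi n"
proof (rule tgt.tot_eqI[OF mor_mult[OF tot_phi_mor src.shift_mor] mor_mult[OF tgt.shift_mor tot_phi_mor]])
  fix q
  have i: "n - 2 - int q = n - int (q + 2)" by simp
  show "tprj C' (n - 2) q * (tot_phi (n - 2) * shift C n) = tprj C' (n - 2) q * (shift C' n * tot_phi n)"
    unfolding mult_left_assoc[OF tprj_tot_phi] mult_left_assoc[OF tgt.tprj_shift] mult.assoc src.tprj_shift
      tprj_tot_phi i ..
qed

lemma phi_connes: "phi (n - 1) * connes C n = connes C' n * tot_phi (n - 2)"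
proof -
  have h: "phi (n - 1) * htpy C (n - 2) = htpy C' (n - 2) * phi (n - 2)"
    using phi_htpy[of "n - 2"] by simp
  have p: "tprj C' (n - 2) 0 * tot_phi (n - 2) = phi (n - 2) * tprj C (n - 2) 0"
    using tprj_tot_phi[of "n - 2" 0] by simp
  show ?thesis
    unfolding connes_def
    by (simp only: mult.assoc p mult_left_assoc[OF phi_one_t] mult_left_assoc[OF h]
      mult_left_assoc[OF phi_norm_t])
qed

lemma preserves_homology_phi:
  "preserves_homology (hochschild A C) n (hochschild A C') n (phi n)"
  using phi_hoch_bd[of n] phi_hoch_bd[of "n + 1"] phi_mor[of n] phi_mor[of "n + 1"]
  by (intro preserves_homologyI[OF src.is_complex_hochschild tgt.is_complex_hochschild,
      where b = "phi (n + 1)" and c = "phi (n - 1)"])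
    (simp_all add: src.Ch_simps tgt.Ch_simps hoch_bd_def)

lemma preserves_homology_tot_phi:
  "preserves_homology (Tot A (CC A C)) n (Tot A (CC A C')) n (tot_phi n)"
  using tot_phi_tbd[of n] tot_phi_tbd[of "n + 1"] tot_phi_mor[of n] tot_phi_mor[of "n + 1"]
  by (intro preserves_homologyI[OF src.is_complex_Tot tgt.is_complex_Tot,
      where b = "tot_phi (n + 1)" and c = "tot_phi (n - 1)"])
    (simp_all add: src.Ch_simps tgt.Ch_simps tbd_def)

section \<open>The three natural squares\<close>

lemma HH_map_eq: "HH_map A C C' \<phi> n = hmap (hochschild A C) n (hochschild A C') n (phi n)"
  unfolding HH_map_def phi_def
  by (rule homology_map_eq_hmap)
    (use hoch_map_in_Hom preserves_homology_phi in \<open>simp_all add: src.Ch_simps tgt.Ch_simps phi_def\<close>)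

lemma HC_map_eq: "HC_map A C C' \<phi> n = hmap (Tot A (CC A C)) n (Tot A (CC A C')) n (tot_phi n)"
  unfolding HC_map_def tot_phi_def
  by (rule homology_map_eq_hmap)
    (use tot_map_in_Hom preserves_homology_tot_phi in \<open>simp_all add: src.Ch_simps tgt.Ch_simps tot_phi_def\<close>)

lemma incl_map_natural: "HC_map A C C' \<phi> n \<cdot> incl_map C n = incl_map C' n \<cdot> HH_map A C C' \<phi> n"
  unfolding HC_map_eq HH_map_eq incl_map_def
  by (rule hmap_square[OF src.preserves_homology_tinj preserves_homology_tot_phi
    preserves_homology_phi tgt.preserves_homology_tinj tot_phi_tinj_0])

lemma shift_map_natural:
  "HC_map A C C' \<phi> (n - 2) \<cdot> shift_map C n = shift_map C' n \<cdot> HC_map A C C' \<phi> n"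
  unfolding HC_map_eq shift_map_def
  by (rule hmap_square[OF src.preserves_homology_shift preserves_homology_tot_phi
    preserves_homology_tot_phi tgt.preserves_homology_shift tot_phi_shift])

lemma connes_map_natural:
  "HH_map A C C' \<phi> (n - 1) \<cdot> connes_map C n = connes_map C' n \<cdot> HC_map A C C' \<phi> (n - 2)"
  unfolding HC_map_eq HH_map_eq connes_map_def
  by (rule hmap_square[OF src.preserves_homology_connes preserves_homology_phi
    preserves_homology_tot_phi tgt.preserves_homology_connes phi_connes])

end

text \<open>The maps are functions of \<open>C\<close>, fixed before any object or morphism is
  considered, so that one choice serves all naturality squares at once.\<close>

theorem theorem2p8:
  fixes A :: "('o, 'm, 'z) preadditive_scheme" (structure)
  assumes "abelian_category A"
  shows "\<exists>I S B :: ('o, 'm) precyclic \<Rightarrow> int \<Rightarrow> 'm.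
    (\<forall>C. precyclic_object A C \<longrightarrow>
      (\<forall>n.
        I C n \<in> Hom A (HH A C n) (HC A C n) \<and>
        S C n \<in> Hom A (HC A C n) (HC A C (n - 2)) \<and>
        B C n \<in> Hom A (HC A C (n - 2)) (HH A C (n - 1)) \<and>
        exact_at A (I C n) (S C n) \<and>
        exact_at A (S C n) (B C n) \<and>
        exact_at A (B C n) (I C (n - 1)))) \<and>
    (\<forall>C C' \<phi>. precyclic_morphism A C C' \<phi> \<longrightarrow>
      (\<forall>n.
        HC_map A C C' \<phi> n \<cdot> I C n = I C' n \<cdot> HH_map A C C' \<phi> n \<and>
        HC_map A C C' \<phi> (n - 2) \<cdot> S C n = S C' n \<cdot> HC_map A C C' \<phi> n \<and>
        HH_map A C C' \<phi> (n - 1) \<cdot> B C n = B C' n \<cdot> HC_map A C C' \<phi> (n - 2)))"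
proof -
  interpret abelian_category A by fact
  have "incl_map C n \<in> Hom A (HH A C n) (HC A C n) \<and>
      shift_map C n \<in> Hom A (HC A C n) (HC A C (n - 2)) \<and>
      connes_map C n \<in> Hom A (HC A C (n - 2)) (HH A C (n - 1)) \<and>
      exact_at A (incl_map C n) (shift_map C n) \<and>
      exact_at A (shift_map C n) (connes_map C n) \<and>
      exact_at A (connes_map C n) (incl_map C (n - 1))" if "precyclic_object A C" for C n
  proof -
    interpret C: abelian_precyclic A C
      by (rule abelian_precyclic.intro[OF assms that])
    show ?thesis
      using hmap_in_Hom[OF C.preserves_homology_tinj] hmap_in_Hom[OF C.preserves_homology_shift]
        hmap_in_Hom[OF C.preserves_homology_connes]
        C.exact_incl_shift C.exact_shift_connes C.exact_connes_incl
      by (simp add: incl_map_def shift_map_def connes_map_def HH_def HC_def)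
  qed
  moreover have "HC_map A C C' \<phi> n \<cdot> incl_map C n = incl_map C' n \<cdot> HH_map A C C' \<phi> n \<and>
      HC_map A C C' \<phi> (n - 2) \<cdot> shift_map C n = shift_map C' n \<cdot> HC_map A C C' \<phi> n \<and>
      HH_map A C C' \<phi> (n - 1) \<cdot> connes_map C n = connes_map C' n \<cdot> HC_map A C C' \<phi> (n - 2)"
    if "precyclic_morphism A C C' \<phi>" for C C' \<phi> n
  proof -
    interpret M: abelian_precyclic_morphism A C C' \<phi>
      by (rule abelian_precyclic_morphism.intro[OF assms that])
    show ?thesis
      using M.incl_map_natural M.shift_map_natural M.connes_map_natural by blast
  qed
  ultimately show ?thesis by blast
qed

end
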